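(* (i) There is $n_0$ such that for all $n\ge n_0$, $\mathrm{ex}_3(n,\text{Berge-}B_2)=\lfloor n^2/8\rfloor$. (ii) For every integer $t\ge 3$ there is $n_0(t)$ such that for all $n\ge n_0(t)$, $\mathrm{ex}_3(n,\text{Berge-}B_t)=\lfloor n^2/8\rfloor+(t-1)^2$.
   Context: For a graph $F$ and a hypergraph $\mathcal H$, $\mathcal H$ contains a Berge copy of $F$ (a Berge-$F$) if there is an injection $\varphi:V(F)\to V(\mathcal H)$ and an injection $f:E(F)\to E(\mathcal H)$ such that for every edge $xy\in E(F)$, $\{\varphi(x),\varphi(y)\}\subseteq f(xy)$. A hypergraph is Berge-$F$-free if it contains no Berge-$F$. For integers $r\ge 2$, $n$, $\mathrm{ex}_r(n,\text{Berge-}F)$ denotes the maximum number of hyperedges in an $r$-uniform hypergraph on $n$ vertices (hyperedges are distinct $r$-element subsets) that is Berge-$F$-free. The book graph $B_t$ has vertices $u,v,w_1,\dots,w_t$ and edges $uv$, $uw_i$, $vw_i$ for $1\le i\le t$ (i.e. $t$ triangles sharing the edge $uv$). *)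

theory Defs
  imports Main
begin

definition berge_contains :: "'v set \<Rightarrow> 'v set set \<Rightarrow> 'a set \<Rightarrow> 'a set set \<Rightarrow> bool" where
  "berge_contains VF EF VH H \<longleftrightarrow>
     (\<exists>\<phi> f. inj_on \<phi> VF \<and> \<phi> ` VF \<subseteq> VH \<and> inj_on f EF \<and> f ` EF \<subseteq> H \<and>
            (\<forall>e\<in>EF. \<phi> ` e \<subseteq> f e))"

definition ex_berge :: "nat \<Rightarrow> nat \<Rightarrow> 'v set \<Rightarrow> 'v set set \<Rightarrow> nat" where
  "ex_berge r n VF EF = Max {card H | H. H \<subseteq> {e. e \<subseteq> {..<n} \<and> card e = r} \<and>
                                     \<not> berge_contains VF EF {..<n} H}"

text \<open>Book graph B_t: u = 0, v = 1, w_i = i + 1 (1 \<le> i \<le> t).\<close>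

definition book_V :: "nat \<Rightarrow> nat set" where
  "book_V t = {0..t+1}"

definition book_E :: "nat \<Rightarrow> nat set set" where
  "book_E t = {{0,1}} \<union> (\<Union>i\<in>{2..t+1}. {{0,i},{1,i}})"

end

theory Submission
  imports Defs Complex_Main
begin

text \<open>Let n be the number of vertices. A hyperedge with two unit pairs uses up two of the at
  most about n^2/4 unit pairs, which is the source of n^2/8; the bound on unit pairs is Mantel's
  argument with O(1) instead of no common neighbours. The other hyperedges resist a direct count:
  over each of its pairs, the third vertex of such a hyperedge lies in an exceptional set of at most
  3t vertices, so a set of o(n^2) shadow pairs that hits all triangles accounts for only o(n^2) of
  them. The obstacle is to pass from an asymptotic structure to an exact constant. Removing s
  vertices lowers n^2/8 by sn/4 - s^2/8, so s exceptional vertices are harmless as soon as s <= h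
  and they meet at most s(n/4 - h/8) hyperedges. This dictates two scales: z, the error up to which
  the core is known, and h, the degree defect that makes a vertex exceptional, with z/h and h/n at
  most 1/(1000t).\<close>

text \<open>
  Upper bound. Call a pair a unit pair if it lies in exactly one hyperedge. If uv is contained in
  a hyperedge, then all but 3t common neighbours w of u and v in the shadow graph satisfy: uvw is a
  hyperedge, and uw and vw are unit pairs. Hence the shadow has only O(n^2) triangles, and by
  triangle removal all but o(n^2) hyperedges contain two unit pairs. Summing degrees over the unit
  pairs uv, which have boundedly many common neighbours, shows that there are at most n^2/4 + O(n)
  of them, with near equality only if almost all degrees are close to n/2. The neighbourhoods of
  the two ends of a typical unit pair then give an almost complete bipartite core. Shadow edges
  inside one side of the core have codegree close to n/2, so they form a matching; hyperedges
  consist of a matching edge on one side and a vertex on the other side. Counting these exactly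
  gives |A||B|/2 plus an excess of at most (t-1)^2, since one of the two matchings has at most t-1
  edges and each of them contributes an excess of at most t-1. Vertices that do not fit this
  structure lie, together with their neighbours on the same side, in too few hyperedges to compete.

  Lower bound. Split the vertices into A and B with B perfectly matched and take all triples of
  a vertex of A and a matching edge of B. For t >= 3 replace the triples through t-1 disjoint
  pairs P of A by all triples consisting of P and a vertex of B, and add one triple for
  each of these pairs and each of t-1 matching edges of B.
\<close>

section \<open>Regularity and triangle removal\<close>

text \<open>The conditional expectation of \<open>f\<close> given the colouring \<open>c\<close>,
  for the uniform measure on \<open>\<Omega>\<close>.\<close>

definition avg :: "'w set \<Rightarrow> ('w \<Rightarrow> 'k) \<Rightarrow> ('w \<Rightarrow> real) \<Rightarrow> 'w \<Rightarrow> real" where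
  "avg \<Omega> c f w = (\<Sum>v\<in>{v\<in>\<Omega>. c v = c w}. f v) / real (card {v\<in>\<Omega>. c v = c w})"

lemma avg_cong: "c v = c w \<Longrightarrow> avg \<Omega> c f v = avg \<Omega> c f w"
  by (simp add: avg_def)

text \<open>On a colour class \<open>g\<close> is constant, and replacing \<open>f\<close> by its
  class mean keeps the class sum.\<close>

lemma sum_mult_avg:
  assumes fin: "finite \<Omega>"
    and g: "\<And>v w. v \<in> \<Omega> \<Longrightarrow> w \<in> \<Omega> \<Longrightarrow> c v = c w \<Longrightarrow> g v = (g w :: real)"
  shows "(\<Sum>w\<in>\<Omega>. g w * avg \<Omega> c f w) = (\<Sum>w\<in>\<Omega>. g w * f w)"
proof -
  have "(\<Sum>w\<in>{w\<in>\<Omega>. c w = k}. g w * avg \<Omega> c f w) = (\<Sum>w\<in>{w\<in>\<Omega>. c w = k}. g w * f w)"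
    if "k \<in> c ` \<Omega>" for k
  proof -
    obtain w0 where w0: "w0 \<in> \<Omega>" "c w0 = k" using \<open>k \<in> c ` \<Omega>\<close> by blast
    let ?S = "{w\<in>\<Omega>. c w = k}"
    have cp: "real (card ?S) \<noteq> 0" using w0 fin by (auto simp: card_eq_0_iff)
    have "(\<Sum>w\<in>?S. g w * avg \<Omega> c f w) = (\<Sum>w\<in>?S. g w0 * (sum f ?S / real (card ?S)))"
      using g[OF _ w0(1)] w0(2) by (intro sum.cong) (auto simp: avg_def)
    also have "\<dots> = g w0 * sum f ?S" using cp by simp
    also have "\<dots> = (\<Sum>w\<in>?S. g w * f w)"
      unfolding sum_distrib_left using g[OF _ w0(1)] w0(2) by (intro sum.cong) auto
    finally show ?thesis .
  qed
  then show ?thesis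
    unfolding sum.image_gen[OF fin, of "\<lambda>w. g w * avg \<Omega> c f w" c] sum.image_gen[OF fin, of "\<lambda>w. g w * f w" c]
    by (rule sum.cong[OF refl])
qed

text \<open>Pythagoras: the coarse average is the orthogonal projection of the fine one, since both
  have the same inner product with every function of the coarse colour.\<close>

lemma sum_avg_diff_square:
  assumes fin: "finite \<Omega>"
    and ref: "\<And>v w. v \<in> \<Omega> \<Longrightarrow> w \<in> \<Omega> \<Longrightarrow> c' v = c' w \<Longrightarrow> c v = c w"
  shows "(\<Sum>w\<in>\<Omega>. (avg \<Omega> c' f w - avg \<Omega> c f w)\<^sup>2)
    = (\<Sum>w\<in>\<Omega>. (avg \<Omega> c' f w)\<^sup>2) - (\<Sum>w\<in>\<Omega>. (avg \<Omega> c f w)\<^sup>2)"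
proof -
  have 1: "(\<Sum>w\<in>\<Omega>. avg \<Omega> c f w * avg \<Omega> c' f w) = (\<Sum>w\<in>\<Omega>. avg \<Omega> c f w * f w)"
    by (rule sum_mult_avg[OF fin]) (metis avg_cong ref)
  have 2: "(\<Sum>w\<in>\<Omega>. avg \<Omega> c f w * avg \<Omega> c f w) = (\<Sum>w\<in>\<Omega>. avg \<Omega> c f w * f w)"
    by (rule sum_mult_avg[OF fin]) (metis avg_cong)
  have "(\<Sum>w\<in>\<Omega>. (avg \<Omega> c' f w - avg \<Omega> c f w)\<^sup>2)
    = (\<Sum>w\<in>\<Omega>. (avg \<Omega> c' f w)\<^sup>2 + avg \<Omega> c f w * avg \<Omega> c f w - 2 * (avg \<Omega> c f w * avg \<Omega> c' f w))"
    by (intro sum.cong) (auto simp: power2_eq_square algebra_simps)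
  also have "\<dots> = (\<Sum>w\<in>\<Omega>. (avg \<Omega> c' f w)\<^sup>2) - (\<Sum>w\<in>\<Omega>. avg \<Omega> c f w * avg \<Omega> c f w)"
    by (simp add: sum.distrib sum_subtractf sum_distrib_left[symmetric] 1 2)
  finally show ?thesis by (simp add: power2_eq_square)
qed

text \<open>A partition is represented by a family F of sets, its parts being the atoms of F. Refining a
  partition is then just enlarging F, and a family of m sets has at most 2^m parts.\<close>

definition cls :: "'a set set \<Rightarrow> 'a \<Rightarrow> 'a set set" where
  "cls F x = {A \<in> F. x \<in> A}"

definition blk :: "'a set \<Rightarrow> 'a set set \<Rightarrow> 'a \<Rightarrow> 'a set" where
  "blk V F x = {y \<in> V. cls F y = cls F x}"

text \<open>The step function of block densities. Written as a conditional average, its change under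
  a larger \<open>F\<close> is governed by Pythagoras.\<close>

definition dens :: "'a set \<Rightarrow> ('a \<times> 'a) set \<Rightarrow> 'a set set \<Rightarrow> 'a \<times> 'a \<Rightarrow> real" where
  "dens V E F = avg (V \<times> V) (\<lambda>(x, y). (cls F x, cls F y)) (\<lambda>p. if p \<in> E then 1 else 0)"

definition energy :: "'a set \<Rightarrow> ('a \<times> 'a) set \<Rightarrow> 'a set set \<Rightarrow> real" where
  "energy V E F = (\<Sum>p\<in>V \<times> V. (dens V E F p)\<^sup>2)"

text \<open>Only one-sided irregularity of dense pairs matters for triangle counting: a large subrectangle
  that is much sparser than the pair.\<close>

definition irreg :: "('a \<times> 'a) set \<Rightarrow> real \<Rightarrow> 'a set \<Rightarrow> 'a set \<Rightarrow> 'a set \<Rightarrow> 'a set \<Rightarrow> bool" where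
  "irreg E \<epsilon> P Q X Y \<longleftrightarrow> X \<subseteq> P \<and> Y \<subseteq> Q \<and> \<epsilon> * card P \<le> card X \<and> \<epsilon> * card Q \<le> card Y \<and>
     real (card (E \<inter> X \<times> Y)) < \<epsilon> * card X * card Y \<and>
     2 * \<epsilon> * card P * card Q \<le> card (E \<inter> P \<times> Q)"

text \<open>Vertex pairs instead of block pairs: a block pair then counts with weight |P||Q|, and
  the blocks may have very different sizes.\<close>

definition bad :: "'a set \<Rightarrow> ('a \<times> 'a) set \<Rightarrow> real \<Rightarrow> 'a set set \<Rightarrow> ('a \<times> 'a) set" where
  "bad V E \<epsilon> F = {(x, y) \<in> V \<times> V. \<exists>X Y. irreg E \<epsilon> (blk V F x) (blk V F y) X Y}"

lemma blk_self: "x \<in> V \<Longrightarrow> x \<in> blk V F x"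
  by (simp add: blk_def)

lemma blk_eq: "y \<in> blk V F x \<Longrightarrow> blk V F y = blk V F x"
  by (auto simp: blk_def)

lemma card_blocks:
  assumes "finite F"
  shows "finite (blk V F ` U)" "card (blk V F ` U) \<le> 2 ^ card F"
proof -
  have "blk V F ` U \<subseteq> (\<lambda>C. {y \<in> V. cls F y = C}) ` Pow F"
    by (auto simp: blk_def cls_def)
  then have "finite (blk V F ` U)" "card (blk V F ` U) \<le> card (Pow F)"
    using assms by (meson finite_Pow_iff finite_imageI finite_subset surj_card_le)+
  then show "finite (blk V F ` U)" "card (blk V F ` U) \<le> 2 ^ card F"
    using assms by (auto simp: card_Pow)
qed

lemma sum_indicator:
  assumes "finite A" shows "(\<Sum>p\<in>A. if p \<in> E then 1 else (0::real)) = card (E \<inter> A)"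
  using assms by (simp add: sum.If_cases Int_commute)

lemma dens_blk:
  assumes "finite V" "(x, y) \<in> V \<times> V"
  shows "dens V E F (x, y) = card (E \<inter> blk V F x \<times> blk V F y) / (card (blk V F x) * card (blk V F y))"
proof -
  have "{v \<in> V \<times> V. (case v of (x, y) \<Rightarrow> (cls F x, cls F y)) = (cls F x, cls F y)} = blk V F x \<times> blk V F y"
    by (auto simp: blk_def)
  moreover have "finite (blk V F x \<times> blk V F y)" using assms by (simp add: blk_def)
  ultimately show ?thesis
    unfolding dens_def avg_def by (simp only: prod.case sum_indicator) (simp add: card_cartesian_product)
qed

lemma dens_range:
  assumes "finite V" "p \<in> V \<times> V"
  shows "0 \<le> dens V E F p" "dens V E F p \<le> 1"
proof -
  obtain x y where p: "p = (x, y)" by (cases p)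
  let ?P = "blk V F x" let ?Q = "blk V F y"
  have f: "finite (?P \<times> ?Q)" using assms by (simp add: blk_def)
  have "card (E \<inter> ?P \<times> ?Q) \<le> card (?P \<times> ?Q)" using f by (simp add: card_mono)
  then have "real (card (E \<inter> ?P \<times> ?Q)) \<le> real (card ?P * card ?Q)"
    by (simp only: card_cartesian_product of_nat_le_iff)
  then show "0 \<le> dens V E F p" "dens V E F p \<le> 1"
    using assms unfolding p dens_blk[OF assms(1) assms(2)[unfolded p]]
    by (auto simp: divide_le_eq)
qed

lemma energy_le:
  assumes "finite V" shows "energy V E F \<le> (card V)\<^sup>2"
proof -
  have "energy V E F \<le> (\<Sum>p\<in>V \<times> V. 1)"
    unfolding energy_def by (intro sum_mono) (metis assms dens_range power_le_one)
  then show ?thesis by (simp add: card_cartesian_product power2_eq_square)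
qed

lemma cls_mono: "F \<subseteq> G \<Longrightarrow> cls G x = cls G y \<Longrightarrow> cls F x = cls F y"
  unfolding cls_def by blast

lemma sum_dens_diff_square:
  assumes V: "finite V" and FG: "F \<subseteq> G"
  shows "(\<Sum>p\<in>V \<times> V. (dens V E G p - dens V E F p)\<^sup>2) = energy V E G - energy V E F"
proof -
  let ?c = "\<lambda>F (x, y). (cls F x, cls F y)"
  have ref: "?c F v = ?c F w" if "?c G v = ?c G w" for v w
    using that cls_mono[OF FG, of "fst v" "fst w"] cls_mono[OF FG, of "snd v" "snd w"]
    by (simp add: case_prod_unfold)
  show ?thesis unfolding energy_def dens_def
    by (rule sum_avg_diff_square[OF finite_cartesian_product[OF V V]]) (rule ref)
qed

lemma cls_mem: "A \<in> F \<Longrightarrow> cls F x = cls F y \<Longrightarrow> x \<in> A \<longleftrightarrow> y \<in> A"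
  unfolding cls_def by blast

text \<open>As \<open>X\<close> and \<open>Y\<close> belong to \<open>F\<close>, the rectangle is a
  union of block rectangles, and averaging over those preserves its edge count.\<close>

lemma sum_dens_rectangle:
  assumes "finite V" "X \<in> F" "Y \<in> F" "X \<subseteq> V" "Y \<subseteq> V"
  shows "(\<Sum>p\<in>X \<times> Y. dens V E F p) = card (E \<inter> X \<times> Y)"
proof -
  let ?i = "\<lambda>p. if p \<in> X \<times> Y then 1 else (0::real)"
  let ?e = "\<lambda>p. if p \<in> E then 1 else (0::real)"
  have eq: "(\<Sum>p\<in>X \<times> Y. h p) = (\<Sum>p\<in>V \<times> V. ?i p * h p)" for h :: "_ \<Rightarrow> real"
  proof -
    have "X \<times> Y \<subseteq> V \<times> V" using assms by auto
    then show ?thesis using assms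
      by (intro sum.mono_neutral_cong_left) auto
  qed
  have "(\<Sum>p\<in>V \<times> V. ?i p * dens V E F p) = (\<Sum>p\<in>V \<times> V. ?i p * ?e p)"
    unfolding dens_def
  proof (rule sum_mult_avg)
    fix v w assume "v \<in> V \<times> V" "w \<in> V \<times> V"
      "(case v of (x, y) \<Rightarrow> (cls F x, cls F y)) = (case w of (x, y) \<Rightarrow> (cls F x, cls F y))"
    then have "cls F (fst v) = cls F (fst w)" "cls F (snd v) = cls F (snd w)" by (auto split: prod.splits)
    then have "fst v \<in> X \<longleftrightarrow> fst w \<in> X" "snd v \<in> Y \<longleftrightarrow> snd w \<in> Y"
      using cls_mem assms(2,3) by metis+
    then show "?i v = ?i w" by (auto simp: mem_Times_iff)
  qed (use assms in simp)
  then have "(\<Sum>p\<in>X \<times> Y. dens V E F p) = (\<Sum>p\<in>X \<times> Y. ?e p)"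
    by (simp only: eq)
  also have "\<dots> = card (E \<inter> X \<times> Y)"
    by (rule sum_indicator) (use assms in \<open>auto intro: finite_subset\<close>)
  finally show ?thesis .
qed

lemma finite_bad: "finite V \<Longrightarrow> finite (bad V E \<epsilon> F)"
  by (rule finite_subset[of _ "V \<times> V"]) (auto simp: bad_def)

lemma blk_disjoint_blocks:
  "P \<in> blk V F ` V \<Longrightarrow> Q \<in> blk V F ` V \<Longrightarrow> P \<noteq> Q \<Longrightarrow> P \<inter> Q = {}"
  by (auto simp: blk_def)

lemma blk_subset: "blk V F x \<subseteq> V"
  by (auto simp: blk_def)

lemma union_of_rectangles:
  assumes "finite V" "finite F"
  defines "\<B> \<equiv> blk V F ` V"
  assumes "I \<subseteq> \<B> \<times> \<B>"
  shows "finite I"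
    and "(\<Sum>(P, Q)\<in>I. real (card P) * card Q) = card (\<Union>(P, Q)\<in>I. P \<times> Q)"
proof -
  have "finite \<B>" using card_blocks(1)[OF assms(2)] by (simp add: \<B>_def)
  then show fI: "finite I" using assms(4) by (blast intro: finite_subset finite_cartesian_product)
  have "card (\<Union>(P, Q)\<in>I. P \<times> Q) = (\<Sum>i\<in>I. card (case i of (P, Q) \<Rightarrow> P \<times> Q))"
  proof (rule card_UN_disjoint[OF fI])
    show "\<forall>i\<in>I. finite (case i of (P, Q) \<Rightarrow> P \<times> Q)"
    proof
      fix i assume "i \<in> I"
      then have "fst i \<in> \<B>" "snd i \<in> \<B>" using assms(4) by auto
      then have "finite (fst i)" "finite (snd i)" using assms(1) by (auto simp: \<B>_def blk_def)
      then show "finite (case i of (P, Q) \<Rightarrow> P \<times> Q)" by (simp add: case_prod_unfold)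
    qed
    show "\<forall>i\<in>I. \<forall>j\<in>I. i \<noteq> j \<longrightarrow> (case i of (P, Q) \<Rightarrow> P \<times> Q) \<inter> (case j of (P, Q) \<Rightarrow> P \<times> Q) = {}"
    proof (intro ballI impI)
      fix i j assume ij: "i \<in> I" "j \<in> I" "i \<noteq> j"
      obtain P Q where i: "i = (P, Q)" by (cases i)
      obtain P' Q' where j: "j = (P', Q')" by (cases j)
      have "P \<in> \<B>" "Q \<in> \<B>" "P' \<in> \<B>" "Q' \<in> \<B>" using ij i j assms(4) by auto
      moreover have "P \<noteq> P' \<or> Q \<noteq> Q'" using ij(3) i j by simp
      ultimately have "P \<inter> P' = {} \<or> Q \<inter> Q' = {}"
        unfolding \<B>_def using blk_disjoint_blocks by metis
      then show "(case i of (P, Q) \<Rightarrow> P \<times> Q) \<inter> (case j of (P, Q) \<Rightarrow> P \<times> Q) = {}"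
        by (auto simp: i j)
    qed
  qed
  then show "(\<Sum>(P, Q)\<in>I. real (card P) * card Q) = card (\<Union>(P, Q)\<in>I. P \<times> Q)"
    by (simp add: case_prod_unfold card_cartesian_product)
qed

text \<open>Add to \<open>F\<close> one pair of witnesses for each irregular block pair; there are
  at most \<open>4 ^ card F\<close> block pairs. On a witness rectangle the old density is at least
  \<open>2 * \<epsilon>\<close> and the new one averages below \<open>\<epsilon>\<close>, so the
  squared change there sums to at least \<open>\<epsilon> ^ 2\<close> |X||Y|, hence to
  \<open>\<epsilon> ^ 4\<close> |P||Q|. The last factor \<open>\<epsilon>\<close> comes from the
  weight of the irregular pairs.\<close>

lemma energy_increment:
  fixes \<epsilon> :: real
  assumes V: "finite V" and F: "finite F" and e: "\<epsilon> > 0"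
    and bad: "card (bad V E \<epsilon> F) > \<epsilon> * (card V)\<^sup>2"
  shows "\<exists>G. finite G \<and> card G \<le> card F + 2 * 4 ^ card F \<and>
    energy V E G \<ge> energy V E F + \<epsilon> ^ 5 * (card V)\<^sup>2"
proof -
  define \<B> where "\<B> = blk V F ` V"
  define I where "I = {(P, Q) \<in> \<B> \<times> \<B>. \<exists>X Y. irreg E \<epsilon> P Q X Y}"
  have IB: "I \<subseteq> \<B> \<times> \<B>" by (auto simp: I_def)
  note rect = union_of_rectangles[OF V F IB[unfolded \<B>_def]]
  have "\<forall>i\<in>I. \<exists>Z. irreg E \<epsilon> (fst i) (snd i) (fst Z) (snd Z)"
    by (auto simp: I_def)
  then obtain Z where Z: "\<And>i. i \<in> I \<Longrightarrow> irreg E \<epsilon> (fst i) (snd i) (fst (Z i)) (snd (Z i))"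
    by metis
  define G where "G = F \<union> (fst \<circ> Z) ` I \<union> (snd \<circ> Z) ` I"
  have fG: "finite G" and FG: "F \<subseteq> G" using F rect(1) by (auto simp: G_def)
  have cB: "finite \<B>" "card \<B> \<le> 2 ^ card F" using card_blocks[OF F] by (auto simp: \<B>_def)
  have "card I \<le> card (\<B> \<times> \<B>)" using IB cB by (intro card_mono) auto
  also have "\<dots> \<le> 2 ^ card F * 2 ^ card F" using cB by (simp add: card_cartesian_product mult_le_mono)
  also have "\<dots> = (4::nat) ^ card F" by (simp add: power_mult_distrib[symmetric])
  finally have cI: "card I \<le> 4 ^ card F" .
  have "card G \<le> card F + card I + card I" unfolding G_def
    by (intro order.trans[OF card_Un_le] add_mono card_image_le rect(1) order.refl)
  then have cG: "card G \<le> card F + 2 * 4 ^ card F" using cI by simp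
  have bad_eq: "bad V E \<epsilon> F = (\<Union>(P, Q)\<in>I. P \<times> Q)"
  proof (rule set_eqI)
    fix p :: "'a \<times> 'a" obtain x y where p: "p = (x, y)" by (cases p)
    have "p \<in> (\<Union>(P, Q)\<in>I. P \<times> Q) \<longleftrightarrow> (\<exists>P\<in>\<B>. \<exists>Q\<in>\<B>. (\<exists>X Y. irreg E \<epsilon> P Q X Y) \<and> x \<in> P \<and> y \<in> Q)"
      by (simp add: p I_def Bex_def)
    also have "\<dots> \<longleftrightarrow> (\<exists>x'\<in>V. \<exists>y'\<in>V. (\<exists>X Y. irreg E \<epsilon> (blk V F x') (blk V F y') X Y)
       \<and> x \<in> blk V F x' \<and> y \<in> blk V F y')"
      unfolding \<B>_def by blast
    also have "\<dots> \<longleftrightarrow> p \<in> bad V E \<epsilon> F"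
    proof
      assume "p \<in> bad V E \<epsilon> F"
      then show "\<exists>x'\<in>V. \<exists>y'\<in>V. (\<exists>X Y. irreg E \<epsilon> (blk V F x') (blk V F y') X Y)
       \<and> x \<in> blk V F x' \<and> y \<in> blk V F y'"
        using blk_self[of x V F] blk_self[of y V F]
        by (intro bexI[of _ x] bexI[of _ y]) (simp_all add: p bad_def)
    next
      assume "\<exists>x'\<in>V. \<exists>y'\<in>V. (\<exists>X Y. irreg E \<epsilon> (blk V F x') (blk V F y') X Y)
       \<and> x \<in> blk V F x' \<and> y \<in> blk V F y'"
      then obtain x' y' where *: "\<exists>X Y. irreg E \<epsilon> (blk V F x') (blk V F y') X Y"
        "x \<in> blk V F x'" "y \<in> blk V F y'" by blast
      have "x \<in> V" "y \<in> V" using *(2,3) by (simp_all add: blk_def)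
      then show "p \<in> bad V E \<epsilon> F" using *(1) blk_eq[OF *(2)] blk_eq[OF *(3)]
        by (simp add: p bad_def)
    qed
    finally show "p \<in> bad V E \<epsilon> F \<longleftrightarrow> p \<in> (\<Union>(P, Q)\<in>I. P \<times> Q)" by simp
  qed
  let ?D = "dens V E F" and ?D' = "dens V E G"
  let ?R = "\<lambda>i. fst (Z i) \<times> snd (Z i)"
  have fin: "finite P" if "P \<subseteq> V" for P using V that finite_subset by blast
  have Zsub: "fst (Z i) \<subseteq> fst i" "snd (Z i) \<subseteq> snd i" "fst i \<subseteq> V" "snd i \<subseteq> V" if "i \<in> I" for i
  proof -
    show "fst (Z i) \<subseteq> fst i" "snd (Z i) \<subseteq> snd i" using Z[OF that] by (simp_all add: irreg_def)
    have "fst i \<in> \<B>" "snd i \<in> \<B>" using that IB by auto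
    then show "fst i \<subseteq> V" "snd i \<subseteq> V" by (auto simp: \<B>_def blk_def)
  qed
  have ZV: "fst (Z i) \<subseteq> V" "snd (Z i) \<subseteq> V" if "i \<in> I" for i
    using Zsub[OF that] by auto
  have key: "(\<Sum>p\<in>?R i. (?D' p - ?D p)\<^sup>2) \<ge> \<epsilon> ^ 4 * (card (fst i) * card (snd i))" if i: "i \<in> I" for i
  proof -
    obtain P Q where PQ: "i = (P, Q)" by (cases i)
    obtain X Y where XY: "Z i = (X, Y)" by (cases "Z i")
    have ir: "irreg E \<epsilon> P Q X Y" using Z[OF i] PQ XY by simp
    obtain x y where xy: "x \<in> V" "y \<in> V" "P = blk V F x" "Q = blk V F y"
      using i PQ IB by (auto simp: \<B>_def)
    have XP: "X \<subseteq> P" "Y \<subseteq> Q" using ir by (auto simp: irreg_def)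
    have PV: "P \<subseteq> V" "Q \<subseteq> V" using blk_subset xy by metis+
    have cpos: "real (card P) > 0" "real (card Q) > 0"
      using xy blk_self[of x V F] blk_self[of y V F] fin PV by (auto simp: card_gt_0_iff)
    have Dge: "?D p \<ge> 2 * \<epsilon>" if p: "p \<in> X \<times> Y" for p
    proof -
      obtain a b where ab: "p = (a, b)" "a \<in> P" "b \<in> Q" using p XP by (cases p) auto
      then have "blk V F a = P" "blk V F b = Q" using xy blk_eq by metis+
      moreover have "(a, b) \<in> V \<times> V" using ab PV by auto
      ultimately have "?D p = card (E \<inter> P \<times> Q) / (card P * card Q)"
        using dens_blk[OF V] ab by metis
      moreover have "2 * \<epsilon> * (real (card P) * card Q) \<le> card (E \<inter> P \<times> Q)"
        using ir by (simp add: irreg_def mult.assoc)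
      ultimately show ?thesis using cpos by (simp add: pos_le_divide_eq)
    qed
    have "X \<in> G" "Y \<in> G" using i XY by (force simp: G_def)+
    then have sD': "(\<Sum>p\<in>X \<times> Y. ?D' p) = card (E \<inter> X \<times> Y)"
      using XP PV by (intro sum_dens_rectangle V) auto
    have lt: "real (card (E \<inter> X \<times> Y)) < \<epsilon> * card X * card Y" using ir by (simp add: irreg_def)
    have "(\<Sum>p\<in>X \<times> Y. 2 * \<epsilon>) \<le> (\<Sum>p\<in>X \<times> Y. ?D p)" using Dge by (rule sum_mono)
    then have sD: "2 * \<epsilon> * (card X * card Y) \<le> (\<Sum>p\<in>X \<times> Y. ?D p)"
      by (simp add: card_cartesian_product mult_ac)
    \<comment> \<open>A linear lower bound for the square takes the place of Cauchy-Schwarz: it can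
      be summed using only the edge counts of the rectangle.\<close>
    have pt: "(?D' p - ?D p)\<^sup>2 \<ge> 2 * \<epsilon> * (?D p - ?D' p) - \<epsilon>\<^sup>2" for p
    proof -
      have "0 \<le> (?D p - ?D' p - \<epsilon>)\<^sup>2" by simp
      then show ?thesis by (simp add: power2_eq_square algebra_simps)
    qed
    have big: "\<epsilon> * (card X * card Y) \<le> (\<Sum>p\<in>X \<times> Y. ?D p) - (\<Sum>p\<in>X \<times> Y. ?D' p)"
      using sD sD' lt by (simp add: algebra_simps)
    have "(\<epsilon> * card P) * (\<epsilon> * card Q) \<le> card X * card Y" unfolding of_nat_mult
      using ir e by (intro mult_mono) (auto simp: irreg_def)
    then have "\<epsilon>\<^sup>2 * ((\<epsilon> * card P) * (\<epsilon> * card Q)) \<le> \<epsilon>\<^sup>2 * (card X * card Y)"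
      by (intro mult_left_mono) auto
    then have "\<epsilon> ^ 4 * (card P * card Q) \<le> \<epsilon>\<^sup>2 * (card X * card Y)"
      by (simp add: power2_eq_square power4_eq_xxxx mult_ac)
    also have "\<dots> = 2 * \<epsilon> * (\<epsilon> * (card X * card Y)) - \<epsilon>\<^sup>2 * (card X * card Y)"
      by (simp add: power2_eq_square)
    also have "\<dots> \<le> 2 * \<epsilon> * ((\<Sum>p\<in>X \<times> Y. ?D p) - (\<Sum>p\<in>X \<times> Y. ?D' p)) - \<epsilon>\<^sup>2 * (card X * card Y)"
      using big e by (intro diff_right_mono mult_left_mono) auto
    also have "\<dots> = (\<Sum>p\<in>X \<times> Y. 2 * \<epsilon> * (?D p - ?D' p) - \<epsilon>\<^sup>2)"
      by (simp add: sum_subtractf sum_distrib_left[symmetric] card_cartesian_product)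
    also have "\<dots> \<le> (\<Sum>p\<in>X \<times> Y. (?D' p - ?D p)\<^sup>2)" using pt by (rule sum_mono)
    finally show ?thesis unfolding XY unfolding PQ by simp
  qed
  have "\<epsilon> ^ 5 * (card V)\<^sup>2 = \<epsilon> ^ 4 * (\<epsilon> * (card V)\<^sup>2)" by (simp add: numeral_eq_Suc)
  also have "\<dots> \<le> \<epsilon> ^ 4 * card (bad V E \<epsilon> F)" using bad e by (intro mult_left_mono) auto
  also have "\<dots> = (\<Sum>i\<in>I. \<epsilon> ^ 4 * (card (fst i) * card (snd i)))"
    unfolding bad_eq rect(2)[symmetric] sum_distrib_left by (simp add: case_prod_unfold)
  also have "\<dots> \<le> (\<Sum>i\<in>I. \<Sum>p\<in>?R i. (?D' p - ?D p)\<^sup>2)" using key by (rule sum_mono)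
  also have "\<dots> = (\<Sum>p\<in>(\<Union>i\<in>I. ?R i). (?D' p - ?D p)\<^sup>2)"
  proof (rule sum.UNION_disjoint[symmetric, OF rect(1)])
    show "\<forall>i\<in>I. finite (?R i)" by (intro ballI finite_cartesian_product fin ZV)
    show "\<forall>i\<in>I. \<forall>j\<in>I. i \<noteq> j \<longrightarrow> ?R i \<inter> ?R j = {}"
    proof (intro ballI impI)
      fix i j assume ij: "i \<in> I" "j \<in> I" "i \<noteq> j"
      have "fst i \<in> \<B>" "snd i \<in> \<B>" "fst j \<in> \<B>" "snd j \<in> \<B>" using ij IB by auto
      moreover have "fst i \<noteq> fst j \<or> snd i \<noteq> snd j" using ij(3) by (simp add: prod_eq_iff)
      ultimately have "fst i \<inter> fst j = {} \<or> snd i \<inter> snd j = {}"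
        unfolding \<B>_def using blk_disjoint_blocks by metis
      then show "?R i \<inter> ?R j = {}" using Zsub(1,2)[OF ij(1)] Zsub(1,2)[OF ij(2)] by blast
    qed
  qed
  also have "\<dots> \<le> (\<Sum>p\<in>V \<times> V. (?D' p - ?D p)\<^sup>2)"
  proof (rule sum_mono2)
    show "(\<Union>i\<in>I. ?R i) \<subseteq> V \<times> V" by (intro UN_least Sigma_mono ZV)
  qed (use V in auto)
  also have "\<dots> = energy V E G - energy V E F" by (rule sum_dens_diff_square[OF V FG])
  finally have "energy V E F + \<epsilon> ^ 5 * (card V)\<^sup>2 \<le> energy V E G" by linarith
  then show ?thesis using fG cG by blast
qed

text \<open>The size of the family after i refinements, by the recursion of
  \<open>energy_increment\<close>.\<close>

fun tower :: "nat \<Rightarrow> nat" where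
  "tower 0 = 0" | "tower (Suc i) = tower i + 2 * 4 ^ tower i"

text \<open>A refinement adds \<open>\<epsilon> ^ 5\<close> n^2 to an energy that never exceeds n^2,
  so it cannot be repeated more than \<open>1 / \<epsilon> ^ 5\<close> times. The bound on the
  family depends on \<open>\<epsilon>\<close> alone.\<close>

lemma regularity:
  fixes \<epsilon> :: real
  assumes e: "\<epsilon> > 0"
  shows "\<exists>M. \<forall>(V::'a set) E. finite V \<longrightarrow>
    (\<exists>F. finite F \<and> card F \<le> M \<and> card (bad V E \<epsilon> F) \<le> \<epsilon> * (card V)\<^sup>2)"
proof -
  obtain N :: nat where N: "1 / \<epsilon> ^ 5 < N" using reals_Archimedean2 by blast
  have mono: "tower i \<le> tower j" if "i \<le> j" for i j
    using that by (rule lift_Suc_mono_le[of tower, rotated]) simp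
  have "\<exists>F. finite F \<and> card F \<le> tower N \<and> card (bad V E \<epsilon> F) \<le> \<epsilon> * (card V)\<^sup>2"
    if V: "finite V" for V :: "'a set" and E
  proof (cases "V = {}")
    case True
    then show ?thesis by (intro exI[of _ "{}"]) (simp add: bad_def)
  next
    case False
    then have cV: "real ((card V)\<^sup>2) > 0" using V by auto
    show ?thesis
    proof (rule ccontr)
      assume no: "\<not> ?thesis"
      have "\<exists>F. finite F \<and> card F \<le> tower i \<and> energy V E F \<ge> i * \<epsilon> ^ 5 * (card V)\<^sup>2" if "i \<le> N" for i
        using that
      proof (induction i)
        case 0
        show ?case by (intro exI[of _ "{}"]) (simp add: energy_def sum_nonneg)
      next
        case (Suc i)
        then obtain F where F: "finite F" "card F \<le> tower i" "energy V E F \<ge> i * \<epsilon> ^ 5 * (card V)\<^sup>2"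
          by auto
        moreover have "card F \<le> tower N" using F mono[of i N] Suc by simp
        ultimately have "card (bad V E \<epsilon> F) > \<epsilon> * (card V)\<^sup>2" using no by force
        then obtain G where G: "finite G" "card G \<le> card F + 2 * 4 ^ card F"
          "energy V E G \<ge> energy V E F + \<epsilon> ^ 5 * (card V)\<^sup>2"
          using energy_increment[OF V F(1) e] by blast
        have "(4::nat) ^ card F \<le> 4 ^ tower i" using F by (intro power_increasing) auto
        then have "card G \<le> tower (Suc i)" using G(2) F(2) unfolding tower.simps by linarith
        moreover have "energy V E G \<ge> Suc i * \<epsilon> ^ 5 * (card V)\<^sup>2"
          using G F by (simp add: algebra_simps)
        ultimately show ?case using G by blast
      qed
      then obtain F where F: "energy V E F \<ge> N * \<epsilon> ^ 5 * (card V)\<^sup>2" by blast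
      then have "N * \<epsilon> ^ 5 * real ((card V)\<^sup>2) \<le> 1 * real ((card V)\<^sup>2)" using energy_le[OF V, of E F] by simp
      then have "N * \<epsilon> ^ 5 \<le> 1" using cV by (rule mult_right_le_imp_le)
      then show False using N e by (simp add: field_simps)
    qed
  qed
  then show ?thesis by blast
qed

section \<open>Counting triangles in regular triples, and triangle removal\<close>

lemma irregD:
  fixes \<epsilon> :: real
  assumes "\<not> (\<exists>X Y. irreg E \<epsilon> P Q X Y)" "2 * \<epsilon> * card P * card Q \<le> card (E \<inter> P \<times> Q)"
    "X \<subseteq> P" "Y \<subseteq> Q" "\<epsilon> * card P \<le> card X" "\<epsilon> * card Q \<le> card Y"
  shows "\<epsilon> * card X * card Y \<le> card (E \<inter> X \<times> Y)"
proof (rule ccontr)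
  assume "\<not> ?thesis"
  then have "irreg E \<epsilon> P Q X Y" unfolding irreg_def using assms(2-) by linarith
  then show False using assms(1) by blast
qed

text \<open>Too many vertices of low degree would form, together with all of \<open>Q\<close>, a
  large sparse rectangle.\<close>

lemma few_low_degree:
  fixes \<epsilon> :: real
  assumes f: "finite P" "finite Q" and e: "0 < \<epsilon>" "\<epsilon> \<le> 1" and ne: "P \<noteq> {}" "Q \<noteq> {}"
    and reg: "\<not> (\<exists>X Y. irreg E \<epsilon> P Q X Y)" "2 * \<epsilon> * card P * card Q \<le> card (E \<inter> P \<times> Q)"
  shows "real (card {x\<in>P. card {y\<in>Q. (x, y) \<in> E} < \<epsilon> * card Q}) < \<epsilon> * card P"
proof (rule ccontr)
  let ?X = "{x\<in>P. card {y\<in>Q. (x, y) \<in> E} < \<epsilon> * card Q}"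
  assume "\<not> ?thesis"
  then have large: "\<epsilon> * card P \<le> card ?X" by simp
  have cP: "real (card P) > 0" "real (card Q) > 0" using f ne by (auto simp: card_gt_0_iff)
  then have "real (card ?X) > 0" using large mult_pos_pos[OF e(1)] by (meson order_less_le_trans)
  then have nX: "?X \<noteq> {}" by (auto simp: card_gt_0_iff)
  have "E \<inter> ?X \<times> Q = (SIGMA x:?X. {y\<in>Q. (x, y) \<in> E})" by auto
  then have "real (card (E \<inter> ?X \<times> Q)) = (\<Sum>x\<in>?X. real (card {y\<in>Q. (x, y) \<in> E}))"
    using f by simp
  also have "\<dots> < (\<Sum>x\<in>?X. \<epsilon> * card Q)"
    using f nX by (intro sum_strict_mono) auto
  also have "\<dots> = \<epsilon> * card ?X * card Q" by simp
  also have "\<dots> \<le> card (E \<inter> ?X \<times> Q)"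
    using cP e large by (intro irregD[OF reg]) (auto simp: mult_le_cancel_right2)
  finally show False by simp
qed

definition tri :: "('a \<times> 'a) set \<Rightarrow> ('a \<times> 'a \<times> 'a) set" where
  "tri E = {(x, y, z). (x, y) \<in> E \<and> (y, z) \<in> E \<and> (x, z) \<in> E}"

text \<open>All but fewer than \<open>2 * \<epsilon> * card P\<close> vertices of \<open>P\<close>,
  hence at least half of them, have large neighbourhoods in both \<open>Q\<close> and
  \<open>R\<close>. Regularity of \<open>Q\<close> and \<open>R\<close> then gives edges between
  these two neighbourhoods.\<close>

lemma triangle_counting:
  fixes \<epsilon> :: real
  assumes f: "finite P" "finite Q" "finite R" and e: "0 < \<epsilon>" "\<epsilon> \<le> 1 / 4"
    and ne: "P \<noteq> {}" "Q \<noteq> {}" "R \<noteq> {}"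
    and PQ: "\<not> (\<exists>X Y. irreg E \<epsilon> P Q X Y)" "2 * \<epsilon> * card P * card Q \<le> card (E \<inter> P \<times> Q)"
    and PR: "\<not> (\<exists>X Y. irreg E \<epsilon> P R X Y)" "2 * \<epsilon> * card P * card R \<le> card (E \<inter> P \<times> R)"
    and QR: "\<not> (\<exists>X Y. irreg E \<epsilon> Q R X Y)" "2 * \<epsilon> * card Q * card R \<le> card (E \<inter> Q \<times> R)"
  shows "\<epsilon> ^ 3 / 2 * card P * card Q * card R \<le> card (tri E \<inter> P \<times> Q \<times> R)"
proof -
  let ?NQ = "\<lambda>x. {y\<in>Q. (x, y) \<in> E}" let ?NR = "\<lambda>x. {y\<in>R. (x, y) \<in> E}"
  let ?A = "{x\<in>P. card (?NQ x) < \<epsilon> * card Q}" let ?B = "{x\<in>P. card (?NR x) < \<epsilon> * card R}"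
  let ?C = "P - (?A \<union> ?B)"
  have e1: "\<epsilon> \<le> 1" using e by simp
  have A: "real (card ?A) < \<epsilon> * card P"
    by (rule few_low_degree) (use f e e1 ne PQ in auto)
  have B: "real (card ?B) < \<epsilon> * card P"
    by (rule few_low_degree) (use f e e1 ne PR in auto)
  have "card (?A \<union> ?B) \<le> card ?A + card ?B" by (rule card_Un_le)
  moreover have "card ?C = card P - card (?A \<union> ?B)" using f by (intro card_Diff_subset) auto
  ultimately have "real (card ?C) \<ge> real (card P) - (real (card ?A) + real (card ?B))" by linarith
  then have "card P - 2 * (\<epsilon> * card P) \<le> card ?C" using A B by linarith
  moreover have "\<epsilon> * card P \<le> 1 / 4 * card P" using e by (intro mult_right_mono) auto
  ultimately have C: "card P / 2 \<le> card ?C" by linarith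
  have deg: "\<epsilon> ^ 3 * card Q * card R \<le> card (E \<inter> ?NQ x \<times> ?NR x)" if "x \<in> ?C" for x
  proof -
    have l: "\<epsilon> * card Q \<le> card (?NQ x)" "\<epsilon> * card R \<le> card (?NR x)" using that by auto
    have "\<epsilon> ^ 3 * card Q * card R = \<epsilon> * ((\<epsilon> * card Q) * (\<epsilon> * card R))" by (simp add: power3_eq_cube)
    also have "\<dots> \<le> \<epsilon> * (card (?NQ x) * card (?NR x))" unfolding of_nat_mult
      using l e by (intro mult_left_mono mult_mono) auto
    also have "\<dots> \<le> card (E \<inter> ?NQ x \<times> ?NR x)"
      using irregD[OF QR, of "?NQ x" "?NR x"] l by (auto simp: mult.assoc)
    finally show ?thesis .
  qed
  have "\<epsilon> ^ 3 / 2 * card P * card Q * card R = (card P / 2) * (\<epsilon> ^ 3 * card Q * card R)" by simp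
  also have "\<dots> \<le> card ?C * (\<epsilon> ^ 3 * card Q * card R)" using C e by (intro mult_right_mono) auto
  also have "\<dots> = (\<Sum>x\<in>?C. \<epsilon> ^ 3 * card Q * card R)" by simp
  also have "\<dots> \<le> (\<Sum>x\<in>?C. real (card (E \<inter> ?NQ x \<times> ?NR x)))" using deg by (rule sum_mono)
  also have "\<dots> = card (SIGMA x:?C. E \<inter> ?NQ x \<times> ?NR x)" using f by simp
  also have "\<dots> \<le> card (tri E \<inter> P \<times> Q \<times> R)" unfolding of_nat_le_iff
    using f by (intro card_mono) (auto simp: tri_def)
  finally show ?thesis .
qed

lemma card_small_blocks:
  fixes c :: real
  assumes V: "finite V" and F: "finite F" and c: "0 \<le> c"
  shows "real (card {x\<in>V. card (blk V F x) < c}) \<le> 2 ^ card F * c"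
proof -
  let ?S = "{x\<in>V. card (blk V F x) < c}"
  let ?J = "blk V F ` ?S"
  note J = card_blocks[OF F, of V ?S]
  have "?S \<subseteq> \<Union>?J" using blk_self by fastforce
  moreover have "finite (\<Union>?J)" using V J by (auto simp: blk_def)
  ultimately have "card ?S \<le> card (\<Union>?J)" by (simp add: card_mono)
  also have "\<dots> \<le> sum card ?J" by (rule card_Union_le_sum_card) 
  finally have "real (card ?S) \<le> (\<Sum>P\<in>?J. real (card P))" by (simp flip: of_nat_sum)
  also have "\<dots> \<le> (\<Sum>P\<in>?J. c)" by (intro sum_mono) auto
  also have "\<dots> = card ?J * c" by simp
  also have "\<dots> \<le> 2 ^ card F * c" using J c by (intro mult_right_mono) (auto simp flip: of_nat_le_iff)
  finally show ?thesis .
qed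

lemma card_sparse_edges:
  fixes c :: real
  assumes V: "finite V" and F: "finite F" and c: "0 \<le> c"
  shows "real (card {(x, y) \<in> E \<inter> V \<times> V. card (E \<inter> blk V F x \<times> blk V F y)
      < c * card (blk V F x) * card (blk V F y)}) \<le> c * (card V)\<^sup>2"
    (is "real (card ?S) \<le> _")
proof -
  define \<B> where "\<B> = blk V F ` V"
  define I where "I = {(P, Q) \<in> \<B> \<times> \<B>. card (E \<inter> P \<times> Q) < c * card P * card Q}"
  have IB: "I \<subseteq> blk V F ` V \<times> blk V F ` V" by (auto simp: I_def \<B>_def)
  note rect = union_of_rectangles[OF V F IB]
  have sub: "P \<subseteq> V \<and> Q \<subseteq> V" if "(P, Q) \<in> I" for P Q using that by (auto simp: I_def \<B>_def blk_def)
  have fin: "finite (E \<inter> fst i \<times> snd i)" if "i \<in> I" for i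
    using sub[of "fst i" "snd i"] that V by (auto intro: finite_subset)
  have "?S \<subseteq> (\<Union>i\<in>I. E \<inter> fst i \<times> snd i)"
  proof
    fix p assume p: "p \<in> ?S"
    obtain x y where xy: "p = (x, y)" by (cases p)
    have "(blk V F x, blk V F y) \<in> I" using p by (auto simp: xy I_def \<B>_def)
    moreover have "x \<in> blk V F x" "y \<in> blk V F y" using p by (auto simp: xy blk_self)
    ultimately show "p \<in> (\<Union>i\<in>I. E \<inter> fst i \<times> snd i)" using p by (force simp: xy)
  qed
  then have "card ?S \<le> card (\<Union>i\<in>I. E \<inter> fst i \<times> snd i)"
    by (rule card_mono[rotated]) (rule finite_UN_I[OF rect(1) fin])
  also have "\<dots> \<le> (\<Sum>i\<in>I. card (E \<inter> fst i \<times> snd i))" by (rule card_UN_le[OF rect(1)])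
  finally have "real (card ?S) \<le> (\<Sum>i\<in>I. real (card (E \<inter> fst i \<times> snd i)))"
    by (simp flip: of_nat_sum)
  also have "\<dots> \<le> (\<Sum>i\<in>I. c * (card (fst i) * card (snd i)))"
    by (intro sum_mono) (auto simp: I_def mult.assoc)
  also have "\<dots> = c * card (\<Union>(P, Q)\<in>I. P \<times> Q)"
    unfolding rect(2)[symmetric] sum_distrib_left by (simp add: case_prod_unfold)
  finally have le: "real (card ?S) \<le> c * card (\<Union>(P, Q)\<in>I. P \<times> Q)" .
  have "card (\<Union>(P, Q)\<in>I. P \<times> Q) \<le> card (V \<times> V)"
    using sub V by (intro card_mono) blast+
  then have "c * card (\<Union>(P, Q)\<in>I. P \<times> Q) \<le> c * card (V \<times> V)"
    using c by (intro mult_left_mono) (simp_all only: of_nat_le_iff)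
  with le have "real (card ?S) \<le> c * card (V \<times> V)" by (rule order.trans)
  then show ?thesis by (simp add: card_cartesian_product power2_eq_square)
qed

text \<open>\<open>R\<close> collects the edges in irregular block pairs, in sparse block pairs and
  at vertices of small blocks, at most \<open>\<eta>\<close>, \<open>2 * \<eta>\<close> and
  \<open>2 * \<eta>\<close> times n^2 edges. A triangle that avoids \<open>R\<close> lies in three
  large, dense and regular block pairs, which contain more triangles than there are.\<close>

theorem triangle_removal:
  fixes \<epsilon> :: real
  assumes e: "\<epsilon> > 0"
  shows "\<exists>\<delta>::real. \<delta> > 0 \<and> (\<forall>(V::'a set) E. finite V \<longrightarrow> E \<subseteq> V \<times> V \<longrightarrow> card (tri E) \<le> \<delta> * card V ^ 3 \<longrightarrow>
    (\<exists>R\<subseteq>E. card R \<le> \<epsilon> * (card V)\<^sup>2 \<and>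
       (\<forall>(x, y, z)\<in>tri E. (x, y) \<in> R \<or> (y, z) \<in> R \<or> (x, z) \<in> R)))"
proof -
  define \<eta> where "\<eta> = min (\<epsilon> / 5) (1 / 4)"
  have \<eta>: "\<eta> > 0" "\<eta> \<le> 1 / 4" "5 * \<eta> \<le> \<epsilon>" using e by (auto simp: \<eta>_def)
  obtain M where M: "\<And>(V::'a set) E. finite V \<Longrightarrow>
      \<exists>F. finite F \<and> card F \<le> M \<and> card (bad V E \<eta> F) \<le> \<eta> * (card V)\<^sup>2"
    using regularity[OF \<eta>(1)] by blast
  \<comment> \<open>At most 2^M blocks have fewer than \<open>\<beta>\<close> n vertices, so
    together these cover at most \<open>\<eta>\<close> n vertices. \<open>\<delta>\<close> is half
    of the constant that triangle counting gives for blocks of size \<open>\<beta>\<close> n, which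
    makes the final inequality strict.\<close>
  define \<beta> where "\<beta> = \<eta> / 2 ^ M"
  define \<delta> where "\<delta> = \<eta> ^ 3 * \<beta> ^ 3 / 4"
  have \<beta>: "\<beta> > 0" and \<delta>: "\<delta> > 0" using \<eta> by (auto simp: \<beta>_def \<delta>_def)
  have "\<exists>R\<subseteq>E. card R \<le> \<epsilon> * (card V)\<^sup>2 \<and>
       (\<forall>(x, y, z)\<in>tri E. (x, y) \<in> R \<or> (y, z) \<in> R \<or> (x, z) \<in> R)"
    if V: "finite V" and EV: "E \<subseteq> V \<times> V" and few: "card (tri E) \<le> \<delta> * card V ^ 3" for V :: "'a set" and E
  proof -
    obtain F where F: "finite F" "card F \<le> M" "card (bad V E \<eta> F) \<le> \<eta> * (card V)\<^sup>2"
      using M[OF V] by blast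
    let ?b = "blk V F" and ?n = "real (card V)"
    define S where "S = {x\<in>V. card (?b x) < \<beta> * ?n}"
    define D where "D = {(x, y) \<in> E \<inter> V \<times> V. card (E \<inter> ?b x \<times> ?b y) < 2 * \<eta> * card (?b x) * card (?b y)}"
    define R where "R = E \<inter> (bad V E \<eta> F \<union> D \<union> S \<times> V \<union> V \<times> S)"
    have fE: "finite E" using EV V by (auto intro: finite_subset)
    have "real (card S) \<le> 2 ^ card F * (\<beta> * ?n)"
      unfolding S_def using card_small_blocks[OF V F(1)] \<beta> by simp
    also have "\<dots> \<le> 2 ^ M * (\<beta> * ?n)" using F \<beta> by (intro mult_right_mono power_increasing) auto
    finally have cS: "real (card S) \<le> \<eta> * ?n" by (simp add: \<beta>_def)
    have cSV: "real (card S * card V) \<le> \<eta> * (card V)\<^sup>2"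
      using mult_right_mono[OF cS, of ?n] by (simp add: power2_eq_square mult.assoc)
    have cD: "real (card D) \<le> 2 * \<eta> * (card V)\<^sup>2"
      unfolding D_def using card_sparse_edges[OF V F(1), of "2 * \<eta>" E] \<eta> by simp
    have fS: "finite S" "finite D" "finite (bad V E \<eta> F)"
      using V fE finite_bad[OF V] by (auto simp: S_def D_def intro: finite_subset[OF _ fE])
    have "card R \<le> card (bad V E \<eta> F \<union> D \<union> S \<times> V \<union> V \<times> S)"
      unfolding R_def using fS V by (intro card_mono) auto
    also have "\<dots> \<le> card (bad V E \<eta> F) + card D + card (S \<times> V) + card (V \<times> S)"
      by (intro order.trans[OF card_Un_le] add_mono order.refl)
    finally have "real (card R) \<le> real (card (bad V E \<eta> F)) + card D + 2 * (card S * card V)"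
      by (simp add: card_cartesian_product mult.commute flip: of_nat_add of_nat_mult)
    also have "\<dots> \<le> 5 * \<eta> * (card V)\<^sup>2" using F(3) cD cSV by linarith
    also have "\<dots> \<le> \<epsilon> * (card V)\<^sup>2" using \<eta> by (intro mult_right_mono) auto
    finally have cR: "real (card R) \<le> \<epsilon> * (card V)\<^sup>2" .
    have "(x, y) \<in> R \<or> (y, z) \<in> R \<or> (x, z) \<in> R" if t: "(x, y, z) \<in> tri E" for x y z
    proof (rule ccontr)
      assume no: "\<not> ?thesis"
      have E: "(x, y) \<in> E" "(y, z) \<in> E" "(x, z) \<in> E" using t by (auto simp: tri_def)
      then have xyz: "x \<in> V" "y \<in> V" "z \<in> V" using EV by auto
      then have n0: "?n > 0" using V by (auto simp: card_gt_0_iff)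
      have ok: "\<not> (\<exists>X Y. irreg E \<eta> (?b u) (?b v) X Y)"
        "2 * \<eta> * card (?b u) * card (?b v) \<le> card (E \<inter> ?b u \<times> ?b v)"
        "\<beta> * ?n \<le> card (?b u)" "\<beta> * ?n \<le> card (?b v)"
        if "(u, v) \<in> E" "(u, v) \<notin> R" for u v
      proof -
        have uv: "u \<in> V" "v \<in> V" using that EV by auto
        have "(u, v) \<notin> bad V E \<eta> F" "(u, v) \<notin> D" "u \<notin> S" "v \<notin> S"
          using that uv by (auto simp: R_def)
        then show "\<not> (\<exists>X Y. irreg E \<eta> (?b u) (?b v) X Y)"
          "2 * \<eta> * card (?b u) * card (?b v) \<le> card (E \<inter> ?b u \<times> ?b v)"
          "\<beta> * ?n \<le> card (?b u)" "\<beta> * ?n \<le> card (?b v)"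
          using uv that by (simp_all add: bad_def D_def S_def not_less)
      qed
      have xy: "(x, y) \<notin> R" and yz: "(y, z) \<notin> R" and xz: "(x, z) \<notin> R" using no by auto
      have fb: "finite (?b u)" for u using V by (simp add: blk_def)
      have nb: "?b x \<noteq> {}" "?b y \<noteq> {}" "?b z \<noteq> {}"
        using xyz blk_self[of x V F] blk_self[of y V F] blk_self[of z V F] by auto
      have "\<eta> ^ 3 / 2 * card (?b x) * card (?b y) * card (?b z) \<le> card (tri E \<inter> ?b x \<times> ?b y \<times> ?b z)"
        by (rule triangle_counting[OF fb fb fb \<eta>(1,2) nb
              ok(1,2)[OF E(1) xy] ok(1,2)[OF E(3) xz] ok(1,2)[OF E(2) yz]])
      also have "\<dots> \<le> card (tri E)"
      proof -
        have "tri E \<subseteq> V \<times> V \<times> V" using EV by (auto simp: tri_def)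
        then have "finite (tri E)" using V by (auto intro: finite_subset)
        then show ?thesis by (simp add: card_mono)
      qed
      also have "\<dots> \<le> \<delta> * ?n ^ 3" using few by simp
      also have "\<dots> < \<eta> ^ 3 / 2 * ((\<beta> * ?n) * (\<beta> * ?n) * (\<beta> * ?n))"
        using \<eta> \<beta> n0 by (simp add: \<delta>_def power3_eq_cube)
      also have "\<dots> \<le> \<eta> ^ 3 / 2 * (real (card (?b x)) * card (?b y) * card (?b z))"
        using ok(3,4)[OF E(1) xy] ok(4)[OF E(2) yz] \<beta> n0 \<eta>
        by (intro mult_left_mono mult_mono) auto
      finally show False by (simp add: mult.assoc)
    qed
    then show ?thesis using cR by (intro exI[of _ R]) (auto simp: R_def)
  qed
  then show ?thesis using \<delta> by (intro exI[of _ \<delta>] conjI allI impI)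
qed

section \<open>Berge books\<close>

text \<open>A Berge book with core edge \<open>uv\<close> and page vertices \<open>W\<close>: the
  hyperedge \<open>e\<close> represents \<open>uv\<close>, while \<open>g w\<close> and
  \<open>h w\<close> represent \<open>uw\<close> and \<open>vw\<close>.\<close>

definition book_in :: "'a set set \<Rightarrow> nat \<Rightarrow> 'a \<Rightarrow> 'a \<Rightarrow> bool" where
  "book_in H t u v \<longleftrightarrow> u \<noteq> v \<and> (\<exists>W g h e. finite W \<and> card W = t \<and> u \<notin> W \<and> v \<notin> W \<and>
     inj_on g W \<and> inj_on h W \<and> g ` W \<inter> h ` W = {} \<and>
     e \<in> H \<and> u \<in> e \<and> v \<in> e \<and> e \<notin> g ` W \<and> e \<notin> h ` W \<and>
     (\<forall>w\<in>W. g w \<in> H \<and> u \<in> g w \<and> w \<in> g w \<and> h w \<in> H \<and> v \<in> h w \<and> w \<in> h w))"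

lemma book_inI:
  assumes "u \<noteq> v" "finite W" "card W = t" "u \<notin> W" "v \<notin> W"
    "inj_on g W" "inj_on h W" "g ` W \<inter> h ` W = {}"
    "e \<in> H" "u \<in> e" "v \<in> e" "e \<notin> g ` W" "e \<notin> h ` W"
    "\<And>w. w \<in> W \<Longrightarrow> g w \<in> H \<and> u \<in> g w \<and> w \<in> g w"
    "\<And>w. w \<in> W \<Longrightarrow> h w \<in> H \<and> v \<in> h w \<and> w \<in> h w"
  shows "book_in H t u v"
  unfolding book_in_def using assms(1)
proof (rule conjI)
  show "\<exists>W g h e. finite W \<and> card W = t \<and> u \<notin> W \<and> v \<notin> W \<and>
     inj_on g W \<and> inj_on h W \<and> g ` W \<inter> h ` W = {} \<and>
     e \<in> H \<and> u \<in> e \<and> v \<in> e \<and> e \<notin> g ` W \<and> e \<notin> h ` W \<and>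
     (\<forall>w\<in>W. g w \<in> H \<and> u \<in> g w \<and> w \<in> g w \<and> h w \<in> H \<and> v \<in> h w \<and> w \<in> h w)"
    by (rule exI[of _ W], rule exI[of _ g], rule exI[of _ h], rule exI[of _ e])
      (use assms in \<open>intro conjI ballI; simp\<close>)
qed

lemma book_in_sym: "book_in H t u v \<Longrightarrow> book_in H t v u"
  unfolding book_in_def by (metis Int_commute)

lemma berge_contains_bookI:
  assumes b: "book_in H t u v" and HV: "\<And>e. e \<in> H \<Longrightarrow> e \<subseteq> V"
  shows "berge_contains (book_V t) (book_E t) V H"
proof -
  obtain W g h e where uv: "u \<noteq> v" and W: "finite W" "card W = t" "u \<notin> W" "v \<notin> W"
    and gh: "inj_on g W" "inj_on h W" "g ` W \<inter> h ` W = {}"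
    and e: "e \<in> H" "u \<in> e" "v \<in> e" "e \<notin> g ` W" "e \<notin> h ` W"
    and inc: "\<And>w. w \<in> W \<Longrightarrow> g w \<in> H \<and> u \<in> g w \<and> w \<in> g w \<and> h w \<in> H \<and> v \<in> h w \<and> w \<in> h w"
    using b unfolding book_in_def by metis
  have "card {2..t+1} = card W" using W by simp
  then obtain \<beta> where \<beta>: "bij_betw \<beta> {2..t+1} W"
    using W(1) by (meson bij_betw_iff_card finite_atLeastAtMost)
  then have \<beta>W: "\<beta> i \<in> W" if "i \<in> {2..t+1}" for i using that bij_betwE by blast
  have \<beta>i: "\<beta> i = \<beta> j \<longleftrightarrow> i = j" if "i \<in> {2..t+1}" "j \<in> {2..t+1}" for i j
    using \<beta> that by (meson bij_betw_imp_inj_on inj_on_eq_iff)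
  define \<phi> where "\<phi> i = (if i = 0 then u else if i = 1 then v else \<beta> i)" for i
  \<comment> \<open>Every edge of the book other than \<open>{0, 1}\<close> is \<open>{0, i}\<close>
    or \<open>{1, i}\<close> with \<open>i \<ge> 2\<close>, so \<open>Max\<close> reads off the
    page.\<close>
  define f where "f d = (if d = {0, 1} then e else if 0 \<in> d then g (\<beta> (Max d)) else h (\<beta> (Max d)))" for d
  have f1: "f {0, 1} = e" by (simp add: f_def)
  have f2: "f {0, i} = g (\<beta> i)" if "i \<in> {2..t+1}" for i
    using that by (auto simp: f_def doubleton_eq_iff)
  have f3: "f {1, i} = h (\<beta> i)" if "i \<in> {2..t+1}" for i
    using that by (auto simp: f_def doubleton_eq_iff max_def)
  have E_cases: "d = {0, 1} \<or> (\<exists>i\<in>{2..t+1}. d = {0, i}) \<or> (\<exists>i\<in>{2..t+1}. d = {1, i})" if "d \<in> book_E t" for d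
    using that by (auto simp: book_E_def)
  have V_cases: "i = 0 \<or> i = 1 \<or> i \<in> {2..t+1}" if "i \<in> book_V t" for i
    using that by (auto simp: book_V_def)
  have \<phi>s: "\<phi> 0 = u" "\<phi> 1 = v" "\<And>i. i \<in> {2..t+1} \<Longrightarrow> \<phi> i = \<beta> i" by (auto simp: \<phi>_def)
  have "inj_on \<phi> (book_V t)"
  proof (rule inj_onI)
    fix i j assume ij: "i \<in> book_V t" "j \<in> book_V t" and eq: "\<phi> i = \<phi> j"
    show "i = j" using V_cases[OF ij(1)] V_cases[OF ij(2)] eq \<phi>s \<beta>W \<beta>i W uv by metis
  qed
  moreover have "\<phi> ` book_V t \<subseteq> V"
  proof (rule image_subsetI)
    fix i assume i: "i \<in> book_V t"
    have "u \<in> V" "v \<in> V" "W \<subseteq> V" using e HV inc by blast+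
    then show "\<phi> i \<in> V" using V_cases[OF i] \<phi>s \<beta>W by (metis subsetD)
  qed
  moreover have "inj_on f (book_E t)"
  proof (rule inj_onI)
    fix c d assume cd: "c \<in> book_E t" "d \<in> book_E t" and eq: "f c = f d"
    have ne: "g w \<noteq> h w'" "e \<noteq> g w" "e \<noteq> h w" if "w \<in> W" "w' \<in> W" for w w'
      using that gh e by blast+
    have ginj: "g (\<beta> i) = g (\<beta> j) \<longleftrightarrow> i = j" "h (\<beta> i) = h (\<beta> j) \<longleftrightarrow> i = j"
      if "i \<in> {2..t+1}" "j \<in> {2..t+1}" for i j
      using that gh \<beta>W \<beta>i by (metis inj_on_eq_iff)+
    consider "c = {0, 1}" | i where "i \<in> {2..t+1}" "c = {0, i}" | i where "i \<in> {2..t+1}" "c = {1, i}"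
      using E_cases[OF cd(1)] by blast
    then show "c = d"
    proof cases
      case 1
      then show ?thesis using E_cases[OF cd(2)] eq f1 f2 f3 ne \<beta>W by metis
    next
      case 2
      then show ?thesis using E_cases[OF cd(2)] eq f1 f2 f3 ne \<beta>W ginj by metis
    next
      case 3
      then show ?thesis using E_cases[OF cd(2)] eq f1 f2 f3 ne \<beta>W ginj by metis
    qed
  qed
  moreover have "f d \<in> H \<and> \<phi> ` d \<subseteq> f d" if "d \<in> book_E t" for d
    using E_cases[OF that]
  proof (elim disjE bexE)
    assume "d = {0, 1}" then show ?thesis using f1 e \<phi>s by simp
  next
    fix i assume "i \<in> {2..t+1}" "d = {0, i}"
    then show ?thesis using f2 inc[OF \<beta>W] \<phi>s by simp
  next
    fix i assume "i \<in> {2..t+1}" "d = {1, i}"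
    then show ?thesis using f3 inc[OF \<beta>W] \<phi>s by simp
  qed
  ultimately show ?thesis unfolding berge_contains_def
    by (intro exI[of _ \<phi>] exI[of _ f] conjI) blast+
qed

lemma berge_contains_bookD:
  assumes "berge_contains (book_V t) (book_E t) V H"
  shows "\<exists>u v. book_in H t u v"
proof -
  obtain \<phi> f where \<phi>: "inj_on \<phi> (book_V t)" and f: "inj_on f (book_E t)" "f ` book_E t \<subseteq> H"
    and inc: "\<And>d. d \<in> book_E t \<Longrightarrow> \<phi> ` d \<subseteq> f d"
    using assms unfolding berge_contains_def by metis
  let ?I = "{2..t+1}"
  have V: "0 \<in> book_V t" "1 \<in> book_V t" "?I \<subseteq> book_V t" by (auto simp: book_V_def)
  have E: "{0, 1} \<in> book_E t" "\<And>i. i \<in> ?I \<Longrightarrow> {0, i} \<in> book_E t" "\<And>i. i \<in> ?I \<Longrightarrow> {1, i} \<in> book_E t"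
    by (auto simp: book_E_def)
  have \<phi>I: "inj_on \<phi> ?I" using \<phi> V(3) by (rule inj_on_subset)
  define \<psi> where "\<psi> = the_inv_into ?I \<phi>"
  have \<psi>: "\<psi> (\<phi> i) = i" if "i \<in> ?I" for i using that \<phi>I by (simp add: \<psi>_def the_inv_into_f_f)
  define g where "g w = f {0, \<psi> w}" for w
  define h where "h w = f {1, \<psi> w}" for w
  have gh: "g (\<phi> i) = f {0, i}" "h (\<phi> i) = f {1, i}" if "i \<in> ?I" for i
    using \<psi>[OF that] by (simp_all add: g_def h_def)
  have feq: "f c = f d \<longleftrightarrow> c = d" if "c \<in> book_E t" "d \<in> book_E t" for c d
    using f that by (meson inj_on_eq_iff)
  have \<phi>eq: "\<phi> i = \<phi> j \<longleftrightarrow> i = j" if "i \<in> book_V t" "j \<in> book_V t" for i j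
    using \<phi> that by (meson inj_on_eq_iff)
  have I01: "0 \<notin> ?I" "1 \<notin> ?I" by auto
  have inj: "f {0, i} = f {0, j} \<longleftrightarrow> i = j" "f {1, i} = f {1, j} \<longleftrightarrow> i = j" "f {0, i} \<noteq> f {1, j}"
    "f {0, 1} \<noteq> f {0, i}" "f {0, 1} \<noteq> f {1, i}" if "i \<in> ?I" "j \<in> ?I" for i j
    using feq[OF E(2) E(2)] feq[OF E(3) E(3)] feq[OF E(2) E(3)] feq[OF E(1) E(2)] feq[OF E(1) E(3)] that
    by (auto simp: doubleton_eq_iff)
  have im: "g ` \<phi> ` ?I = (\<lambda>i. f {0, i}) ` ?I" "h ` \<phi> ` ?I = (\<lambda>i. f {1, i}) ` ?I"
    unfolding image_image by (intro image_cong refl gh; assumption)+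
  have "book_in H t (\<phi> 0) (\<phi> 1)"
  proof (rule book_inI[of _ _ "\<phi> ` ?I" _ g h "f {0, 1}"])
    show "\<phi> 0 \<noteq> \<phi> 1" using \<phi>eq[OF V(1,2)] by simp
    show "card (\<phi> ` ?I) = t" using \<phi>I by (simp add: card_image)
    show "\<phi> 0 \<notin> \<phi> ` ?I" "\<phi> 1 \<notin> \<phi> ` ?I"
      using \<phi>eq[OF V(1)] \<phi>eq[OF V(2)] V(3) I01 by (simp_all only: image_iff) blast+
    show "inj_on g (\<phi> ` ?I)"
      by (rule inj_onI; elim imageE) (simp add: gh inj del: atLeastAtMost_iff)
    show "inj_on h (\<phi> ` ?I)"
      by (rule inj_onI; elim imageE) (simp add: gh inj del: atLeastAtMost_iff One_nat_def)
    show "g ` \<phi> ` ?I \<inter> h ` \<phi> ` ?I = {}"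
      unfolding im using inj(3) by fast
    show "f {0, 1} \<in> H" using f E by blast
    show "f {0, 1} \<notin> g ` \<phi> ` ?I" "f {0, 1} \<notin> h ` \<phi> ` ?I"
      unfolding im using inj(4,5) by fast+
    fix w assume "w \<in> \<phi> ` ?I"
    then obtain i where i: "w = \<phi> i" "i \<in> ?I" by (rule imageE)
    show "g w \<in> H \<and> \<phi> 0 \<in> g w \<and> w \<in> g w"
      using gh(1)[OF i(2)] inc[OF E(2)[OF i(2)]] f(2) E(2)[OF i(2)] i(1) by auto
    show "h w \<in> H \<and> \<phi> 1 \<in> h w \<and> w \<in> h w"
      using gh(2)[OF i(2)] inc[OF E(3)[OF i(2)]] f(2) E(3)[OF i(2)] i(1) by auto
  qed (use inc[OF E(1)] in auto)
  then show ?thesis by blast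
qed

text \<open>Choosing \<open>w\<close> rules out only the at most three elements of \<open>W\<close>
  in \<open>p w \<union> q w\<close>. Any other \<open>x\<close> lies in \<open>p x\<close> and in
  \<open>q x\<close>, so these differ from \<open>p w\<close> and \<open>q w\<close>.\<close>

lemma greedy_independent:
  assumes "finite W" "3 * k \<le> card W"
    and "\<And>w. w \<in> W \<Longrightarrow> card (W \<inter> (p w \<union> q w)) \<le> 3" and "\<And>w. w \<in> W \<Longrightarrow> w \<in> p w \<and> w \<in> q w"
  shows "\<exists>I\<subseteq>W. card I = k \<and> (\<forall>w\<in>I. \<forall>w'\<in>I. w \<noteq> w' \<longrightarrow> {p w, q w} \<inter> {p w', q w'} = {})"
  using assms
proof (induction k arbitrary: W)
  case 0
  then show ?case by (intro exI[of _ "{}"]) auto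
next
  case (Suc k)
  then obtain w where w: "w \<in> W" by fastforce
  define W' where "W' = W - (p w \<union> q w)"
  have "card W = card W' + card (W \<inter> (p w \<union> q w))"
    unfolding W'_def using Suc.prems(1) by (metis Int_commute card_Diff_subset_Int card_mono finite_Int inf_le2 le_add_diff_inverse2)
  then have "3 * k \<le> card W'" using Suc.prems(2) Suc.prems(3)[OF w] by simp
  moreover have "card (W' \<inter> (p x \<union> q x)) \<le> 3" if "x \<in> W'" for x
  proof -
    have "card (W' \<inter> (p x \<union> q x)) \<le> card (W \<inter> (p x \<union> q x))"
      using Suc.prems(1) by (intro card_mono) (auto simp: W'_def)
    then show ?thesis using Suc.prems(3)[of x] that by (simp add: W'_def)
  qed
  ultimately obtain I where I: "I \<subseteq> W'" "card I = k"
    "\<forall>x\<in>I. \<forall>y\<in>I. x \<noteq> y \<longrightarrow> {p x, q x} \<inter> {p y, q y} = {}"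
    using Suc.IH[of W'] Suc.prems by (auto simp: W'_def)
  have fI: "finite I" using I Suc.prems(1) by (auto simp: W'_def intro: finite_subset)
  have wI: "w \<notin> I" using I Suc.prems(4)[OF w] by (auto simp: W'_def)
  have sep: "{p w, q w} \<inter> {p x, q x} = {}" if "x \<in> I" for x
  proof -
    have "x \<notin> p w" "x \<notin> q w" "x \<in> p x" "x \<in> q x"
      using that I(1) Suc.prems(4)[of x] by (auto simp: W'_def)
    then show ?thesis by auto
  qed
  show ?case
  proof (intro exI[of _ "insert w I"] conjI)
    show "insert w I \<subseteq> W" using I w by (auto simp: W'_def)
    show "card (insert w I) = Suc k" using fI wI I by simp
    show "\<forall>x\<in>insert w I. \<forall>y\<in>insert w I. x \<noteq> y \<longrightarrow> {p x, q x} \<inter> {p y, q y} = {}"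
      using I(3) sep by (metis Int_commute insert_iff)
  qed
qed

section \<open>Shadow neighbourhoods and codegrees in a book-free hypergraph\<close>

locale book_free =
  fixes V :: "'a set" and H :: "'a set set" and t :: nat
  assumes finite_V: "finite V"
    and edge_subset: "e \<in> H \<Longrightarrow> e \<subseteq> V"
    and edge_card: "e \<in> H \<Longrightarrow> card e = 3"
    and free: "\<not> book_in H t u v"
begin

definition N :: "'a \<Rightarrow> 'a set" where
  "N x = {y. y \<noteq> x \<and> (\<exists>e\<in>H. x \<in> e \<and> y \<in> e)}"

definition unit_pair :: "'a \<Rightarrow> 'a \<Rightarrow> bool" where
  "unit_pair x y \<longleftrightarrow> x \<noteq> y \<and> card {e\<in>H. x \<in> e \<and> y \<in> e} = 1"

text \<open>The vertices w for which uw and vw can be represented by different hyperedges.\<close>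

definition good :: "'a \<Rightarrow> 'a \<Rightarrow> 'a set" where
  "good u v = {w. w \<noteq> u \<and> w \<noteq> v \<and> (\<exists>p\<in>H. \<exists>q\<in>H. p \<noteq> q \<and> u \<in> p \<and> w \<in> p \<and> v \<in> q \<and> w \<in> q)}"

definition L :: "'a \<Rightarrow> 'a \<Rightarrow> 'a set" where
  "L u v = {w. {u, v, w} \<in> H}"

definition D :: "'a \<Rightarrow> 'a \<Rightarrow> 'a set" where
  "D u v = {w. {u, v, w} \<in> H \<and> unit_pair u w \<and> unit_pair v w}"

lemma finite_H: "finite H"
  by (rule finite_subset[of _ "Pow V"]) (use edge_subset finite_V in auto)

lemma N_sym: "y \<in> N x \<longleftrightarrow> x \<in> N y"
  by (auto simp: N_def)

lemma N_subset: "N x \<subseteq> V"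
  using edge_subset by (auto simp: N_def)

lemma finite_N: "finite (N x)"
  using N_subset finite_V by (rule finite_subset)

lemma N_irrefl: "x \<notin> N x"
  by (simp add: N_def)

lemma edge_distinct: "{x, y, z} \<in> H \<Longrightarrow> x \<noteq> y \<and> x \<noteq> z \<and> y \<noteq> z"
  using edge_card[of "{x, y, z}"] by (auto simp: card_insert_if split: if_splits)

lemma edge_eq:
  assumes "e \<in> H" "x \<in> e" "y \<in> e" "z \<in> e" "x \<noteq> y" "x \<noteq> z" "y \<noteq> z"
  shows "e = {x, y, z}"
proof (rule card_subset_eq[symmetric])
  show "finite e" using edge_subset assms(1) finite_V by (meson finite_subset)
  show "card {x, y, z} = card e" using edge_card[OF assms(1)] assms(5-) by simp
qed (use assms in auto)

lemma edgeE:
  assumes "e \<in> H" obtains x y z where "e = {x, y, z}" "x \<noteq> y" "x \<noteq> z" "y \<noteq> z"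
  using edge_card[OF assms] by (auto simp: card_3_iff)

lemma edge_third:
  assumes "e \<in> H" "x \<in> e" "y \<in> e" "x \<noteq> y"
  obtains z where "e = {x, y, z}" "z \<noteq> x" "z \<noteq> y"
  using edge_card[OF assms(1)] assms by (auto simp: card_3_iff)

lemma N_I: "e \<in> H \<Longrightarrow> x \<in> e \<Longrightarrow> y \<in> e \<Longrightarrow> x \<noteq> y \<Longrightarrow> y \<in> N x"
  unfolding N_def by blast

lemma edge_N: "{x, y, z} \<in> H \<Longrightarrow> y \<in> N x \<and> z \<in> N x \<and> z \<in> N y"
  using edge_distinct[of x y z] by (simp add: N_I[of "{x, y, z}"])

lemma L_subset: "L u v \<subseteq> N u \<inter> N v"
  using edge_N by (auto simp: L_def)

lemma D_subset: "D u v \<subseteq> L u v"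
  by (auto simp: D_def L_def)

lemma good_subset: "good u v \<subseteq> N u \<inter> N v"
  by (auto simp: good_def N_def)

text \<open>A greedy choice of \<open>t\<close> pages with core \<open>uv\<close>: the hyperedges
  \<open>p w\<close> and \<open>q w\<close> each contain one vertex besides \<open>w\<close> and a
  core vertex, so \<open>w\<close> conflicts with at most two other candidates.\<close>

lemma card_good:
  assumes "v \<in> N u" shows "card (good u v) \<le> 3 * t"
proof (rule ccontr)
  assume no: "\<not> ?thesis"
  obtain e where e: "e \<in> H" "u \<in> e" "v \<in> e" and uv: "u \<noteq> v" using assms by (auto simp: N_def)
  obtain x where x: "e = {u, v, x}" using edge_third[OF e uv] by metis
  \<comment> \<open>Without the third vertex \<open>x\<close> of the core hyperedge
    \<open>e\<close>, no candidate page lies in \<open>e\<close>, so \<open>e\<close> differs from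
    all page hyperedges.\<close>
  define W where "W = good u v - {x}"
  have fg: "finite (good u v)" using good_subset finite_N by (meson finite_Int finite_subset)
  have cW: "3 * t \<le> card W" using no fg by (auto simp: W_def card_Diff_singleton_if)
  have "\<forall>w\<in>W. \<exists>p q. p \<in> H \<and> q \<in> H \<and> p \<noteq> q \<and> u \<in> p \<and> w \<in> p \<and> v \<in> q \<and> w \<in> q"
    by (auto simp: W_def good_def)
  then obtain p q where pq: "\<And>w. w \<in> W \<Longrightarrow> p w \<in> H \<and> q w \<in> H \<and> p w \<noteq> q w \<and> u \<in> p w \<and> w \<in> p w \<and> v \<in> q w \<and> w \<in> q w"
    by metis
  have Wuv: "u \<notin> W" "v \<notin> W" "x \<notin> W" by (auto simp: W_def good_def)
  have three: "card (W \<inter> (p w \<union> q w)) \<le> 3" if w: "w \<in> W" for w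
  proof -
    have ne: "u \<noteq> w" "v \<noteq> w" using w Wuv by auto
    obtain a where a: "p w = {u, w, a}" using edge_third[of "p w" u w] pq[OF w] ne by metis
    obtain b where b: "q w = {v, w, b}" using edge_third[of "q w" v w] pq[OF w] ne by metis
    have "W \<inter> (p w \<union> q w) \<subseteq> {w, a, b}" using a b Wuv by auto
    then have "card (W \<inter> (p w \<union> q w)) \<le> card {w, a, b}" by (intro card_mono) auto
    also have "\<dots> \<le> 3" by (simp add: card_insert_if)
    finally show ?thesis .
  qed
  have fW: "finite W" using fg by (simp add: W_def)
  obtain I where I: "I \<subseteq> W" "card I = t" "\<forall>w\<in>I. \<forall>w'\<in>I. w \<noteq> w' \<longrightarrow> {p w, q w} \<inter> {p w', q w'} = {}"
    using greedy_independent[OF fW cW, of p q] three pq by blast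
  have "book_in H t u v"
  proof (rule book_inI[of _ _ I _ p q e, OF uv _ I(2) _ _ _ _ _ e])
    show "finite I" using I fW by (meson finite_subset)
    show "u \<notin> I" "v \<notin> I" using I Wuv by auto
    show "inj_on p I" "inj_on q I" using I(3) by (auto simp: inj_on_def)
    show "p ` I \<inter> q ` I = {}"
    proof -
      have "p w \<noteq> q w'" if "w \<in> I" "w' \<in> I" for w w'
        using that I(1,3) pq by (cases "w = w'") auto
      then show ?thesis by auto
    qed
    have "w \<notin> e" if "w \<in> I" for w using that I(1) Wuv x by auto
    then show "e \<notin> p ` I" "e \<notin> q ` I" using I(1) pq by blast+
    show "p w \<in> H \<and> u \<in> p w \<and> w \<in> p w" "q w \<in> H \<and> v \<in> q w \<and> w \<in> q w" if "w \<in> I" for w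
      using that I(1) pq by auto
  qed
  then show False using free by blast
qed

text \<open>If \<open>w\<close> is not good, every hyperedge through \<open>u\<close>,
  \<open>w\<close> equals every hyperedge through \<open>v\<close>, \<open>w\<close>. So there is
  only one, namely \<open>uvw\<close>, and both pairs are unit pairs.\<close>

lemma common_nbr_cases:
  assumes "v \<in> N u" shows "N u \<inter> N v \<subseteq> good u v \<union> D u v"
proof
  fix w assume w: "w \<in> N u \<inter> N v"
  show "w \<in> good u v \<union> D u v"
  proof (cases "w \<in> good u v")
    case False
    obtain p q where pq: "p \<in> H" "u \<in> p" "w \<in> p" "q \<in> H" "v \<in> q" "w \<in> q" and ne: "w \<noteq> u" "w \<noteq> v"
      using w by (auto simp: N_def)
    have eq: "p' = q'" if "p' \<in> H" "u \<in> p'" "w \<in> p'" "q' \<in> H" "v \<in> q'" "w \<in> q'" for p' q'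
      using that False ne unfolding good_def by blast
    have uv: "u \<noteq> v" using assms by (auto simp: N_def)
    have "p = q" using eq pq by blast
    then have "p = {u, v, w}" using edge_eq[of p u v w] pq uv ne by auto
    moreover have "{e\<in>H. u \<in> e \<and> w \<in> e} = {p}" "{e\<in>H. v \<in> e \<and> w \<in> e} = {p}"
      using eq pq by blast+
    ultimately show ?thesis using pq ne by (auto simp: D_def unit_pair_def)
  qed simp
qed

lemma card_common_nbrs:
  assumes "v \<in> N u" shows "card (N u \<inter> N v \<inter> X) \<le> 3 * t + card (D u v \<inter> X)"
proof -
  have f: "finite (good u v)" "finite (D u v)"
    using good_subset[of u v] D_subset[of u v] L_subset[of u v] finite_N[of u] by (meson finite_Int finite_subset)+
  have "card (N u \<inter> N v \<inter> X) \<le> card (good u v \<union> (D u v \<inter> X))"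
    using common_nbr_cases[OF assms] f by (intro card_mono) auto
  also have "\<dots> \<le> card (good u v) + card (D u v \<inter> X)" by (rule card_Un_le)
  finally show ?thesis using card_good[OF assms] by simp
qed

lemma card_L:
  assumes "v \<in> N u" shows "card (L u v \<inter> X) \<le> 3 * t + card (D u v \<inter> X)"
proof -
  have "card (L u v \<inter> X) \<le> card (N u \<inter> N v \<inter> X)"
    using L_subset[of u v] finite_N by (intro card_mono) auto
  then show ?thesis using card_common_nbrs[OF assms, of X] by simp
qed

lemma unit_pair_unique:
  assumes "unit_pair x w" "e \<in> H" "x \<in> e" "w \<in> e" "e' \<in> H" "x \<in> e'" "w \<in> e'"
  shows "e = e'"
proof -
  have "card {e\<in>H. x \<in> e \<and> w \<in> e} = 1" using assms(1) by (simp add: unit_pair_def)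
  then obtain d where d: "{e\<in>H. x \<in> e \<and> w \<in> e} = {d}" by (rule card_1_singletonE)
  have "e \<in> {e\<in>H. x \<in> e \<and> w \<in> e}" "e' \<in> {e\<in>H. x \<in> e \<and> w \<in> e}" using assms by simp_all
  then show ?thesis unfolding d by simp
qed

text \<open>For \<open>w\<close> in both sets, the unit pair \<open>xw\<close> would lie in two
  hyperedges.\<close>

lemma D_disjoint:
  assumes "y \<noteq> y'" shows "D x y \<inter> D x y' = {}"
proof (rule ccontr)
  assume "D x y \<inter> D x y' \<noteq> {}"
  then obtain w where w: "{x, y, w} \<in> H" "{x, y', w} \<in> H" "unit_pair x w" by (auto simp: D_def)
  then have "{x, y, w} = {x, y', w}" by (intro unit_pair_unique[of x w]) auto
  then show False using assms edge_distinct[OF w(1)] edge_distinct[OF w(2)] by (auto simp: doubleton_eq_iff)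
qed

lemma sum_card_D:
  assumes "finite Y" shows "(\<Sum>y\<in>Y. card (D x y \<inter> X)) \<le> card (N x \<inter> X)"
proof -
  have f: "finite (D x y)" for y
    using D_subset[of x y] L_subset[of x y] finite_N[of x] by (meson finite_Int finite_subset)
  have "(\<Sum>y\<in>Y. card (D x y \<inter> X)) = card (\<Union>y\<in>Y. D x y \<inter> X)"
    using assms f D_disjoint by (subst card_UN_disjoint) blast+
  also have "\<dots> \<le> card (N x \<inter> X)"
    using D_subset L_subset finite_N by (intro card_mono) blast+
  finally show ?thesis .
qed

text \<open>Two shadow neighbours of \<open>x\<close> cannot both have almost full codegree with
  \<open>x\<close>. This is what later forces the shadow inside a side to be a matching.\<close>

lemma card_two_D:
  assumes "y \<noteq> y'" shows "card (D x y \<inter> X) + card (D x y' \<inter> X) \<le> card (N x \<inter> X)"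
  using sum_card_D[of "{y, y'}" x X] assms by simp

text \<open>The codegrees at \<open>x\<close> add up to about one degree, because up to
  \<open>3 * t\<close> each they count disjoint subsets of \<open>N x\<close>. Hence the number of
  hyperedges at a vertex is linear in its shadow degree.\<close>

lemma sum_card_L:
  assumes Y: "Y \<subseteq> N x" shows "(\<Sum>y\<in>Y. card (L x y \<inter> X)) \<le> 3 * t * card Y + card (N x \<inter> X)"
proof -
  have fY: "finite Y" using Y finite_N by (rule finite_subset)
  have "(\<Sum>y\<in>Y. card (L x y \<inter> X)) \<le> (\<Sum>y\<in>Y. 3 * t + card (D x y \<inter> X))"
    using card_L Y by (intro sum_mono) blast
  also have "\<dots> = 3 * t * card Y + (\<Sum>y\<in>Y. card (D x y \<inter> X))" by (simp add: sum.distrib)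
  finally show ?thesis using sum_card_D[OF fY, of x X] by simp
qed

lemma card_edges_at:
  "card {e\<in>H. x \<in> e \<and> e \<subseteq> insert x X} \<le> (3 * t + 1) * card (N x \<inter> X)"
proof -
  let ?Y = "N x \<inter> X"
  have f: "finite (L x y)" for y
    using L_subset[of x y] finite_N[of x] by (meson finite_Int finite_subset)
  have "{e\<in>H. x \<in> e \<and> e \<subseteq> insert x X} \<subseteq> (\<Union>y\<in>?Y. (\<lambda>w. {x, y, w}) ` (L x y \<inter> X))"
  proof
    fix e assume e: "e \<in> {e\<in>H. x \<in> e \<and> e \<subseteq> insert x X}"
    then have eH: "e \<in> H" "x \<in> e" by simp_all
    obtain y where y: "y \<in> e" "y \<noteq> x"
      using edgeE[OF eH(1)] by (metis insertI1 insertI2)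
    obtain w where w: "e = {x, y, w}" "w \<noteq> x" by (rule edge_third[OF eH y(1) y(2)[symmetric]])
    then show "e \<in> (\<Union>y\<in>?Y. (\<lambda>w. {x, y, w}) ` (L x y \<inter> X))"
      using e y edge_N[of x y w] by (intro UN_I[of y]) (auto simp: L_def)
  qed
  then have "card {e\<in>H. x \<in> e \<and> e \<subseteq> insert x X} \<le> card (\<Union>y\<in>?Y. (\<lambda>w. {x, y, w}) ` (L x y \<inter> X))"
    using finite_N f by (intro card_mono) auto
  also have "\<dots> \<le> (\<Sum>y\<in>?Y. card ((\<lambda>w. {x, y, w}) ` (L x y \<inter> X)))"
    using finite_N by (intro card_UN_le) auto
  also have "\<dots> \<le> (\<Sum>y\<in>?Y. card (L x y \<inter> X))" using f by (intro sum_mono card_image_le) auto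
  also have "\<dots> \<le> 3 * t * card ?Y + card ?Y" by (rule sum_card_L) auto
  finally show ?thesis by simp
qed

section \<open>Triangles of the shadow graph\<close>

definition G :: "('a \<times> 'a) set" where
  "G = {(x, y). y \<in> N x}"

lemma G_subset: "G \<subseteq> V \<times> V"
  using N_subset N_sym by (auto simp: G_def)

text \<open>Quadratic in the number of vertices, hence below any \<open>\<delta>\<close> n^3 for
  large n: the input for triangle removal.\<close>

lemma card_tri_G: "card (tri G) \<le> (3 * t + 1) * (card V)\<^sup>2"
proof -
  have N': "N x \<inter> V = N x" for x using N_subset by blast
  have cN: "card (N x) \<le> card V" for x using N_subset finite_V by (intro card_mono)
  have "tri G = (SIGMA x:V. SIGMA y:N x. N x \<inter> N y)"
    using N_subset N_sym by (auto simp: tri_def G_def)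
  then have "card (tri G) = (\<Sum>x\<in>V. \<Sum>y\<in>N x. card (N x \<inter> N y))"
    using finite_V finite_N by simp
  also have "\<dots> \<le> (\<Sum>x\<in>V. (3 * t + 1) * card V)"
  proof (rule sum_mono)
    fix x
    have "(\<Sum>y\<in>N x. card (N x \<inter> N y)) \<le> (\<Sum>y\<in>N x. 3 * t + card (D x y \<inter> V))"
    proof (rule sum_mono)
      fix y assume "y \<in> N x"
      then show "card (N x \<inter> N y) \<le> 3 * t + card (D x y \<inter> V)"
        using card_common_nbrs[of y x V] N' by (metis Int_assoc)
    qed
    also have "\<dots> = 3 * t * card (N x) + (\<Sum>y\<in>N x. card (D x y \<inter> V))" by (simp add: sum.distrib)
    also have "\<dots> \<le> 3 * t * card (N x) + card (N x)"
      using sum_card_D[OF finite_N, of x V x] N'[of x] by simp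
    also have "\<dots> = (3 * t + 1) * card (N x)" by simp
    also have "\<dots> \<le> (3 * t + 1) * card V" using cN by (intro mult_left_mono) auto
    finally show "(\<Sum>y\<in>N x. card (N x \<inter> N y)) \<le> (3 * t + 1) * card V" .
  qed
  finally show ?thesis by (simp add: power2_eq_square algebra_simps)
qed

section \<open>Unit pairs and the bipartite core\<close>

definition two_unit :: "'a set \<Rightarrow> bool" where
  "two_unit e \<longleftrightarrow> (\<exists>u v w. e = {u, v, w} \<and> u \<noteq> v \<and> unit_pair u w \<and> unit_pair v w)"

lemma good_if_not_two_unit:
  assumes "{x, y, z} \<in> H" "\<not> two_unit {x, y, z}" shows "z \<in> good x y"
proof -
  have "y \<in> N x" "z \<in> N x \<inter> N y" using edge_N[OF assms(1)] by auto
  moreover have "z \<notin> D x y" using assms edge_distinct[OF assms(1)] by (auto simp: D_def two_unit_def)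
  ultimately show ?thesis using common_nbr_cases by blast
qed

lemma finite_good: "finite (good x y)"
  using good_subset[of x y] finite_N[of x] by (meson finite_Int finite_subset)

text \<open>The vertices of a hyperedge form a shadow triangle, so \<open>R\<close> contains one of
  its pairs. Over that pair the third vertex is good, which leaves at most \<open>3 * t\<close>
  hyperedges per element of \<open>R\<close>.\<close>

lemma card_not_two_unit:
  assumes R: "R \<subseteq> G" and hit: "\<forall>(x, y, z)\<in>tri G. (x, y) \<in> R \<or> (y, z) \<in> R \<or> (x, z) \<in> R"
  shows "card {e\<in>H. \<not> two_unit e} \<le> 3 * t * card R"
proof -
  have fR: "finite R" using R G_subset finite_V by (meson finite_SigmaI finite_subset)
  let ?F = "\<lambda>p. (\<lambda>w. {fst p, snd p, w}) ` good (fst p) (snd p)"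
  have "{e\<in>H. \<not> two_unit e} \<subseteq> (\<Union>p\<in>R. ?F p)"
  proof
    fix e assume "e \<in> {e\<in>H. \<not> two_unit e}"
    then have e: "e \<in> H" "\<not> two_unit e" by auto
    obtain x y z where xyz: "e = {x, y, z}" by (rule edgeE[OF e(1)])
    have *: "e \<in> ?F (a, b)" if "e = {a, b, c}" for a b c
      using good_if_not_two_unit[of a b c] e that by auto
    have "(x, y, z) \<in> tri G" using edge_N[of x y z] e xyz by (auto simp: tri_def G_def)
    then consider "(x, y) \<in> R" | "(y, z) \<in> R" | "(x, z) \<in> R" using hit by auto
    then show "e \<in> (\<Union>p\<in>R. ?F p)"
    proof cases
      case 1 then show ?thesis by (rule UN_I) (rule *[OF xyz])
    next
      case 2
      have "e = {y, z, x}" using xyz by auto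
      from 2 *[OF this] show ?thesis by (rule UN_I)
    next
      case 3
      have "e = {x, z, y}" using xyz by auto
      from 3 *[OF this] show ?thesis by (rule UN_I)
    qed
  qed
  then have "card {e\<in>H. \<not> two_unit e} \<le> card (\<Union>p\<in>R. ?F p)"
    using fR finite_good by (intro card_mono) auto
  also have "\<dots> \<le> (\<Sum>p\<in>R. card (?F p))" by (rule card_UN_le[OF fR])
  also have "\<dots> \<le> (\<Sum>p\<in>R. 3 * t)"
  proof (rule sum_mono)
    fix p assume "p \<in> R"
    then have "snd p \<in> N (fst p)" using R by (auto simp: G_def)
    then show "card (?F p) \<le> 3 * t" using card_good card_image_le[OF finite_good] by (meson order.trans)
  qed
  finally show ?thesis by (simp add: mult.commute)
qed

section \<open>Degrees in the graph of unit pairs, and stability\<close>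

definition Nu :: "'a \<Rightarrow> 'a set" where
  "Nu x = {y. unit_pair x y}"

definition U :: "('a \<times> 'a) set" where
  "U = {(x, y). unit_pair x y}"

lemma unit_pair_sym: "unit_pair x y \<longleftrightarrow> unit_pair y x"
  by (auto simp: unit_pair_def conj_commute)

lemma Nu_subset: "Nu x \<subseteq> N x"
proof
  fix y assume "y \<in> Nu x"
  then have "x \<noteq> y" "card {e\<in>H. x \<in> e \<and> y \<in> e} = 1" by (auto simp: Nu_def unit_pair_def)
  moreover then have "{e\<in>H. x \<in> e \<and> y \<in> e} \<noteq> {}" by (metis card.empty zero_neq_one)
  ultimately show "y \<in> N x" by (auto intro: N_I)
qed

lemma finite_Nu: "finite (Nu x)"
  using Nu_subset finite_N by (rule finite_subset)

lemma U_Sigma: "U = (SIGMA x:V. Nu x)"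
proof -
  have "x \<in> V" if "unit_pair x y" for x y
    using that Nu_subset[of x] N_subset[of y] N_sym[of y x] by (auto simp: Nu_def)
  then show ?thesis by (auto simp: U_def Nu_def)
qed

lemma finite_U: "finite U"
  using finite_V finite_Nu by (simp add: U_Sigma)

lemma card_U: "card U = (\<Sum>x\<in>V. card (Nu x))"
  using finite_V finite_Nu by (simp add: U_Sigma)

text \<open>Two unit pairs are four ordered pairs in \<open>U\<close>, and no unit pair is shared by
  two hyperedges.\<close>

lemma card_two_unit: "4 * card {e\<in>H. two_unit e} \<le> card U"
proof -
  let ?H1 = "{e\<in>H. two_unit e}"
  define P where "P e = {p\<in>U. fst p \<in> e \<and> snd p \<in> e}" for e
  have fP: "finite (P e)" for e using finite_U by (simp add: P_def)
  have four: "4 \<le> card (P e)" if e1: "e \<in> ?H1" for e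
  proof -
    obtain u v w where e: "e = {u, v, w}" "u \<noteq> v" "unit_pair u w" "unit_pair v w"
      using e1 by (auto simp: two_unit_def)
    then have "{(u, w), (v, w), (w, u), (w, v)} \<subseteq> P e"
      using unit_pair_sym by (auto simp: P_def U_def)
    then have "card {(u, w), (v, w), (w, u), (w, v)} \<le> card (P e)" using fP by (intro card_mono)
    moreover have "u \<noteq> w" "v \<noteq> w" using e by (auto simp: unit_pair_def)
    ultimately show ?thesis using e(2) by (auto simp: card_insert_if)
  qed
  have "4 * card ?H1 = (\<Sum>e\<in>?H1. 4)" by simp
  also have "\<dots> \<le> (\<Sum>e\<in>?H1. card (P e))" using four by (intro sum_mono) auto
  also have "\<dots> = card (\<Union>e\<in>?H1. P e)"
  proof (rule card_UN_disjoint[symmetric])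
    show "\<forall>e\<in>?H1. \<forall>e'\<in>?H1. e \<noteq> e' \<longrightarrow> P e \<inter> P e' = {}"
    proof (intro ballI impI, rule ccontr)
      fix e e' assume *: "e \<in> ?H1" "e' \<in> ?H1" "e \<noteq> e'" "P e \<inter> P e' \<noteq> {}"
      then obtain p where "p \<in> P e" "p \<in> P e'" by auto
      then have "e = e'" using * by (intro unit_pair_unique[of "fst p" "snd p"]) (auto simp: P_def U_def)
      then show False using * by simp
    qed
  qed (use finite_H fP in auto)
  also have "\<dots> \<le> card U" using finite_U by (intro card_mono) (auto simp: P_def)
  finally show ?thesis .
qed

lemma card_D_unit:
  assumes "unit_pair x y" shows "card (D x y) \<le> 1"
proof -
  have "w = w'" if "w \<in> D x y" "w' \<in> D x y" for w w'
  proof -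
    have h: "{x, y, w} \<in> H" "{x, y, w'} \<in> H" using that by (auto simp: D_def)
    then have "{x, y, w} = {x, y, w'}" by (intro unit_pair_unique[OF assms]) auto
    then show ?thesis using edge_distinct[OF h(1)] edge_distinct[OF h(2)] by auto
  qed
  moreover have "finite (D x y)"
    using D_subset[of x y] L_subset[of x y] finite_N[of x] by (meson finite_Int finite_subset)
  ultimately show ?thesis by (simp add: card_le_Suc0_iff_eq)
qed

lemma card_common_unit:
  assumes "unit_pair x y" shows "card (N x \<inter> N y) \<le> 3 * t + 1"
proof -
  have "y \<in> N x" using assms Nu_subset by (auto simp: Nu_def)
  then show ?thesis using card_common_nbrs[of y x UNIV] card_D_unit[OF assms] by simp
qed

text \<open>Mantel's argument: the ends of a unit pair have at most \<open>3 * t + 1\<close> common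
  neighbours, so their shadow degrees sum to at most \<open>card V + 3 * t + 1\<close>. Summed over
  \<open>U\<close>, a vertex contributes its degree once for each of its unit pairs.\<close>

lemma sum_squares_unit_degrees:
  "2 * (\<Sum>x\<in>V. (card (Nu x))\<^sup>2) \<le> card U * (card V + 3 * t + 1)"
proof -
  have le: "card (N (fst p)) + card (N (snd p)) \<le> card V + 3 * t + 1" if "p \<in> U" for p
  proof -
    have "card (N (fst p)) + card (N (snd p)) = card (N (fst p) \<union> N (snd p)) + card (N (fst p) \<inter> N (snd p))"
      using finite_N by (intro card_Un_Int)
    moreover have "card (N (fst p) \<union> N (snd p)) \<le> card V"
      using N_subset finite_V by (intro card_mono) auto
    moreover have "card (N (fst p) \<inter> N (snd p)) \<le> 3 * t + 1"
      using that by (intro card_common_unit) (auto simp: U_def)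
    ultimately show ?thesis by linarith
  qed
  have swap: "(\<Sum>p\<in>U. card (N (snd p))) = (\<Sum>p\<in>U. card (N (fst p)))"
    using unit_pair_sym
    by (intro sum.reindex_bij_witness[of _ prod.swap prod.swap]) (auto simp: U_def)
  have "(\<Sum>x\<in>V. (card (Nu x))\<^sup>2) \<le> (\<Sum>x\<in>V. card (Nu x) * card (N x))"
    unfolding power2_eq_square using Nu_subset finite_N by (intro sum_mono mult_left_mono card_mono) auto
  also have "\<dots> = (\<Sum>x\<in>V. \<Sum>y\<in>Nu x. card (N x))" by simp
  also have "\<dots> = (\<Sum>p\<in>U. card (N (fst p)))"
    unfolding U_Sigma using finite_V finite_Nu by (subst sum.Sigma) (auto simp: case_prod_unfold)
  finally have "2 * (\<Sum>x\<in>V. (card (Nu x))\<^sup>2) \<le> (\<Sum>p\<in>U. card (N (fst p)) + card (N (snd p)))"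
    by (simp add: sum.distrib swap)
  also have "\<dots> \<le> (\<Sum>p\<in>U. card V + 3 * t + 1)" using le by (rule sum_mono)
  finally show ?thesis by simp
qed

text \<open>Chebyshev's inequality: near equality in \<open>sum_squares_unit_degrees\<close> bounds
  the sum of the squared deviations of the unit degrees from n/2 by \<open>\<rho> ^ 3\<close> n^3.
  \<open>U\<close> consists of ordered pairs, so its extremal size is n^2/2.\<close>

lemma card_atypical:
  fixes \<rho> :: real
  assumes \<rho>: "0 < \<rho>" "\<rho> \<le> 1 / 16" and K: "3 * t + 1 \<le> \<rho> ^ 3 * card V"
    and U: "card U \<ge> (card V)\<^sup>2 / 2 - \<rho> ^ 3 * (card V)\<^sup>2" and V0: "card V > 0"
  shows "card {v\<in>V. card (Nu v) < (1 / 2 - \<rho>) * card V} \<le> \<rho> * card V"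
proof -
  let ?n = "real (card V)" and ?B = "{v\<in>V. card (Nu v) < (1 / 2 - \<rho>) * card V}"
  let ?X = "real (card U)" and ?x = "\<lambda>v. real (card (Nu v))"
  have n0: "?n > 0" using V0 by simp
  have cU: "?X = (\<Sum>v\<in>V. ?x v)" by (simp add: card_U)
  have "real (2 * (\<Sum>x\<in>V. (card (Nu x))\<^sup>2)) \<le> real (card U * (card V + 3 * t + 1))"
    using sum_squares_unit_degrees by (simp only: of_nat_le_iff)
  then have sq: "2 * (\<Sum>v\<in>V. (?x v)\<^sup>2) \<le> ?X * (?n + 3 * t + 1)" by (simp add: algebra_simps)
  have Xle: "?X \<le> ?n\<^sup>2"
  proof -
    have "card U \<le> card (V \<times> V)" using finite_V Nu_subset N_subset
      by (intro card_mono) (auto simp: U_Sigma)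
    then have "real (card U) \<le> real (card V * card V)" by (simp only: card_cartesian_product of_nat_le_iff)
    then show ?thesis by (simp add: power2_eq_square)
  qed
  have "(\<Sum>v\<in>V. (?x v - ?n / 2)\<^sup>2) = (\<Sum>v\<in>V. (?x v)\<^sup>2 - ?n * ?x v + ?n\<^sup>2 / 4)"
    by (intro sum.cong) (auto simp: power2_eq_square algebra_simps)
  also have "\<dots> = (\<Sum>v\<in>V. (?x v)\<^sup>2) - ?n * ?X + ?n * (?n\<^sup>2 / 4)"
    by (simp add: sum.distrib sum_subtractf cU flip: sum_distrib_left)
  also have "\<dots> \<le> ?X * (?n + 3 * t + 1) / 2 - ?n * ?X + ?n * (?n\<^sup>2 / 4)" using sq by linarith
  also have "\<dots> = ?n * (?n\<^sup>2 / 2 - ?X) / 2 + (3 * t + 1) * ?X / 2" by (simp add: field_simps)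
  also have "\<dots> \<le> ?n * (\<rho> ^ 3 * ?n\<^sup>2) / 2 + (\<rho> ^ 3 * ?n) * ?n\<^sup>2 / 2"
    using U K Xle n0 \<rho>
    by (intro add_mono divide_right_mono mult_left_mono mult_mono) auto
  also have "\<dots> = \<rho> ^ 3 * ?n ^ 3" by (simp add: power2_eq_square power3_eq_cube)
  finally have var: "(\<Sum>v\<in>V. (?x v - ?n / 2)\<^sup>2) \<le> \<rho> ^ 3 * ?n ^ 3" .
  have "card ?B * (\<rho> * ?n)\<^sup>2 = (\<Sum>v\<in>?B. (\<rho> * ?n)\<^sup>2)" by simp
  also have "\<dots> \<le> (\<Sum>v\<in>?B. (?x v - ?n / 2)\<^sup>2)"
  proof (rule sum_mono)
    fix v assume "v \<in> ?B"
    then have "\<rho> * ?n \<le> ?n / 2 - ?x v" by (simp add: algebra_simps)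
    then have "(\<rho> * ?n)\<^sup>2 \<le> (?n / 2 - ?x v)\<^sup>2" using \<rho> by (intro power_mono) auto
    then show "(\<rho> * ?n)\<^sup>2 \<le> (?x v - ?n / 2)\<^sup>2" by (simp add: power2_commute)
  qed
  also have "\<dots> \<le> (\<Sum>v\<in>V. (?x v - ?n / 2)\<^sup>2)" using finite_V by (intro sum_mono2) auto
  also have "\<dots> \<le> (\<rho> * ?n) * (\<rho> * ?n)\<^sup>2" using var by (simp add: power2_eq_square power3_eq_cube mult_ac)
  finally show ?thesis using \<rho> n0 by (simp add: mult_le_cancel_right)
qed

text \<open>The sides are the unit neighbourhoods of the two ends of a unit pair \<open>uv\<close>
  of typical vertices. Such a pair exists because the pairs meeting the few atypical vertices cannot
  exhaust \<open>U\<close>.\<close>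

lemma core_partition:
  fixes \<rho> :: real
  assumes \<rho>: "0 < \<rho>" "\<rho> \<le> 1 / 16" and K: "3 * t + 1 \<le> \<rho> ^ 3 * card V"
    and U: "card U \<ge> (card V)\<^sup>2 / 2 - \<rho> ^ 3 * (card V)\<^sup>2" and V0: "card V > 0"
  shows "\<exists>A B. A \<subseteq> V \<and> B \<subseteq> V \<and> A \<inter> B = {} \<and>
    (1 / 2 - 7 * \<rho>) * card V \<le> card A \<and> (1 / 2 - 7 * \<rho>) * card V \<le> card B \<and>
    (\<forall>a\<in>A. (1 / 2 - 7 * \<rho>) * card V \<le> card (N a \<inter> B)) \<and>
    (\<forall>b\<in>B. (1 / 2 - 7 * \<rho>) * card V \<le> card (N b \<inter> A))"
proof -
  let ?n = "real (card V)"
  define Z where "Z = {v\<in>V. card (Nu v) < (1 / 2 - \<rho>) * card V}"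
  have Z: "card Z \<le> \<rho> * ?n" unfolding Z_def by (rule card_atypical[OF assms])
  have fZ: "finite Z" using finite_V by (simp add: Z_def)
  have n0: "?n > 0" using V0 by simp
  have "\<rho> * (\<rho> * \<rho>) \<le> \<rho> * (1 * (1 / 16))" using \<rho> by (intro mult_left_mono mult_mono) auto
  then have "\<rho> ^ 3 \<le> \<rho> * (1 / 16)" by (simp add: power3_eq_cube mult.assoc)
  then have \<rho>3: "\<rho> ^ 3 \<le> \<rho>" "\<rho> ^ 3 \<le> 1 / 16" using \<rho> by auto
  have K': "real (3 * t + 1) \<le> \<rho> * ?n"
    using K mult_right_mono[OF \<rho>3(1), of ?n] by simp
  have "\<exists>p\<in>U. fst p \<notin> Z \<and> snd p \<notin> Z"
  proof (rule ccontr)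
    assume "\<not> ?thesis"
    then have "U \<subseteq> Z \<times> V \<union> V \<times> Z" using Nu_subset N_subset by (force simp: U_Sigma)
    then have "card U \<le> card (Z \<times> V \<union> V \<times> Z)" using fZ finite_V by (intro card_mono) auto
    also have "\<dots> \<le> card (Z \<times> V) + card (V \<times> Z)" by (rule card_Un_le)
    finally have "real (card U) \<le> 2 * (card Z * ?n)" by (simp add: card_cartesian_product mult.commute flip: of_nat_add of_nat_mult)
    also have "\<dots> \<le> 2 * (\<rho> * ?n * ?n)" using Z by (intro mult_left_mono mult_right_mono) auto
    also have "\<dots> \<le> 2 * (1 / 16 * ?n * ?n)" using \<rho> by (intro mult_left_mono mult_right_mono) auto
    also have "\<dots> = ?n\<^sup>2 / 8" by (simp add: power2_eq_square)
    finally have "real (card U) \<le> ?n\<^sup>2 / 8" .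
    moreover have "\<rho> ^ 3 * ?n\<^sup>2 \<le> 1 / 16 * ?n\<^sup>2" using \<rho>3 by (intro mult_right_mono) auto
    moreover have "?n\<^sup>2 > 0" using n0 by simp
    moreover have "?n\<^sup>2 / 2 - \<rho> ^ 3 * ?n\<^sup>2 \<le> card U" using U by simp
    ultimately show False by linarith
  qed
  then obtain u v where uv: "unit_pair u v" "u \<in> V" "v \<in> V" "u \<notin> Z" "v \<notin> Z"
    using Nu_subset N_subset by (fastforce simp: U_Sigma Nu_def)
  have big: "(1 / 2 - \<rho>) * ?n \<le> card (Nu x)" if "x \<in> V" "x \<notin> Z" for x using that by (simp add: Z_def)
  \<comment> \<open>Removing the boundedly many common neighbours of \<open>u\<close> and
    \<open>v\<close> makes \<open>A\<close> disjoint from \<open>B\<close>.\<close>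
  define A where "A = Nu v - (Z \<union> (N u \<inter> N v))"
  define B where "B = Nu u - Z"
  have AV: "A \<subseteq> V" "B \<subseteq> V" using Nu_subset N_subset by (auto simp: A_def B_def)
  have fAB: "finite A" "finite B" using AV finite_V finite_subset by auto
  have uN: "u \<in> N v" "v \<in> N u" using uv Nu_subset unit_pair_sym by (auto simp: Nu_def)
  have cc: "card (N u \<inter> N v) \<le> 3 * t + 1" using card_common_unit[OF uv(1)] .
  have dis: "A \<inter> B = {}" using Nu_subset by (auto simp: A_def B_def)
  have cB: "(1 / 2 - 2 * \<rho>) * ?n \<le> card B"
  proof -
    have "card (Nu u) - card Z \<le> card B" unfolding B_def by (rule diff_card_le_card_Diff[OF fZ])
    then show ?thesis using big[of u] uv Z by (simp add: algebra_simps)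
  qed
  have cA: "(1 / 2 - 3 * \<rho>) * ?n \<le> card A"
  proof -
    have "card (Nu v) - card (Z \<union> (N u \<inter> N v)) \<le> card A"
      unfolding A_def using fZ finite_N by (intro diff_card_le_card_Diff) auto
    moreover have "card (Z \<union> (N u \<inter> N v)) \<le> card Z + (3 * t + 1)"
      using card_Un_le[of Z "N u \<inter> N v"] cc by linarith
    ultimately show ?thesis using big[of v] uv Z K' by (simp add: algebra_simps)
  qed
  have rest: "card (V - (A \<union> B)) \<le> 5 * \<rho> * ?n"
  proof -
    have "card (V - (A \<union> B)) = card V - card (A \<union> B)" using AV fAB by (intro card_Diff_subset) auto
    moreover have "card (A \<union> B) = card A + card B" using fAB dis by (intro card_Un_disjoint)
    moreover have "card (A \<union> B) \<le> card V" using AV finite_V by (intro card_mono) auto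
    ultimately show ?thesis using cA cB by (simp add: algebra_simps of_nat_diff)
  qed
  \<comment> \<open>\<open>X\<close> is the side of \<open>x\<close> itself. It lies in the
    neighbourhood of the unit neighbour \<open>w\<close>, so \<open>x\<close> has O(1) neighbours in
    \<open>X\<close>; the rest of its degree goes to \<open>Y\<close>, up to the
    \<open>5 * \<rho>\<close> n vertices outside both sides.\<close>
  have key: "(1 / 2 - 7 * \<rho>) * ?n \<le> card (N x \<inter> Y)"
    if x: "x \<in> V" "x \<notin> Z" "unit_pair w x" and XY: "X \<union> Y = A \<union> B" "X \<subseteq> N w" for x w X Y
  proof -
    have "N x \<subseteq> (N x \<inter> Y) \<union> (N x \<inter> N w) \<union> (V - (A \<union> B))" using N_subset XY by blast
    then have "card (N x) \<le> card ((N x \<inter> Y) \<union> (N x \<inter> N w) \<union> (V - (A \<union> B)))"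
      using finite_N finite_V by (intro card_mono) auto
    also have "\<dots> \<le> card (N x \<inter> Y) + card (N x \<inter> N w) + card (V - (A \<union> B))"
      by (intro order.trans[OF card_Un_le] add_mono order.refl)
    finally have "real (card (N x)) \<le> card (N x \<inter> Y) + card (N x \<inter> N w) + card (V - (A \<union> B))" by linarith
    moreover have "card (N x \<inter> N w) \<le> 3 * t + 1" using card_common_unit[OF x(3)] by (simp add: Int_commute)
    moreover have "card (Nu x) \<le> card (N x)" using Nu_subset finite_N by (intro card_mono)
    ultimately show ?thesis using big[OF x(1,2)] rest K' by (simp add: algebra_simps)
  qed
  have "\<forall>a\<in>A. (1 / 2 - 7 * \<rho>) * ?n \<le> card (N a \<inter> B)"
  proof
    fix a assume a: "a \<in> A"
    show "(1 / 2 - 7 * \<rho>) * ?n \<le> card (N a \<inter> B)"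
      by (rule key[of a v A B]) (use a AV Nu_subset in \<open>auto simp: A_def Nu_def\<close>)
  qed
  moreover have "\<forall>b\<in>B. (1 / 2 - 7 * \<rho>) * ?n \<le> card (N b \<inter> A)"
  proof
    fix b assume b: "b \<in> B"
    show "(1 / 2 - 7 * \<rho>) * ?n \<le> card (N b \<inter> A)"
      by (rule key[of b u B A]) (use b AV Nu_subset in \<open>auto simp: B_def Nu_def\<close>)
  qed
  moreover have "0 \<le> \<rho> * ?n" using \<rho> by simp
  ultimately show ?thesis using AV dis cA cB
    by (intro exI[of _ A] exI[of _ B]) (simp add: algebra_simps)
qed

end

text \<open>At least n^2/8 hyperedges, almost all with two unit pairs, force \<open>card U\<close>
  close to n^2/2, and stability applies.\<close>

lemma core_structure:
  fixes \<zeta> :: real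
  assumes \<zeta>: "0 < \<zeta>"
  shows "\<exists>n0. \<forall>(V::'a set) H. book_free V H t \<longrightarrow> n0 \<le> card V \<longrightarrow> (card V)\<^sup>2 / 8 \<le> card H \<longrightarrow>
    (\<exists>A B. A \<subseteq> V \<and> B \<subseteq> V \<and> A \<inter> B = {} \<and>
      (1 / 2 - \<zeta>) * card V \<le> card A \<and> (1 / 2 - \<zeta>) * card V \<le> card B \<and>
      (\<forall>a\<in>A. (1 / 2 - \<zeta>) * card V \<le> card (book_free.N H a \<inter> B)) \<and>
      (\<forall>b\<in>B. (1 / 2 - \<zeta>) * card V \<le> card (book_free.N H b \<inter> A)))"
proof -
  define \<rho> where "\<rho> = min (\<zeta> / 7) (1 / 16)"
  have \<rho>: "0 < \<rho>" "\<rho> \<le> 1 / 16" "7 * \<rho> \<le> \<zeta>" using \<zeta> by (auto simp: \<rho>_def)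
  \<comment> \<open>Chosen to make \<open>12 * t * \<epsilon> \<le> \<rho> ^ 3\<close>: in
    \<open>4 * card H \<le> card U + 12 * t * card R\<close> the removed pairs must cost no more
    than the defect that \<open>core_partition\<close> tolerates.\<close>
  define \<epsilon> where "\<epsilon> = \<rho> ^ 3 / (12 * (t + 1))"
  have \<epsilon>: "\<epsilon> > 0" using \<rho> by (simp add: \<epsilon>_def)
  have "12 * t * \<epsilon> = \<rho> ^ 3 * (t / (t + 1))" by (simp add: \<epsilon>_def field_simps)
  also have "\<dots> \<le> \<rho> ^ 3 * 1" using \<rho> by (intro mult_left_mono) auto
  finally have \<epsilon>t: "12 * t * \<epsilon> \<le> \<rho> ^ 3" by simp
  obtain \<delta> :: real where \<delta>: "\<delta> > 0" and rem: "\<forall>(V::'a set) E. finite V \<longrightarrow> E \<subseteq> V \<times> V \<longrightarrow>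
      card (tri E) \<le> \<delta> * card V ^ 3 \<longrightarrow>
    (\<exists>R\<subseteq>E. card R \<le> \<epsilon> * (card V)\<^sup>2 \<and>
       (\<forall>(x, y, z)\<in>tri E. (x, y) \<in> R \<or> (y, z) \<in> R \<or> (x, z) \<in> R))"
    using triangle_removal[OF \<epsilon>, where 'a = 'a] by (elim exE conjE) (rule that)
  obtain n1 :: nat where n1: "(3 * t + 1) / \<delta> \<le> n1" using real_arch_simple by blast
  obtain n2 :: nat where n2: "(3 * t + 1) / \<rho> ^ 3 \<le> n2" using real_arch_simple by blast
  show ?thesis
  proof (intro exI[of _ "max 1 (max n1 n2)"] allI impI)
    fix V :: "'a set" and H
    assume bf: "book_free V H t" and n: "max 1 (max n1 n2) \<le> card V" and large: "(card V)\<^sup>2 / 8 \<le> card H"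
    interpret book_free V H t by (rule bf)
    let ?n = "real (card V)"
    have n': "(3 * t + 1) / \<delta> \<le> ?n" "(3 * t + 1) / \<rho> ^ 3 \<le> ?n" "card V > 0" using n n1 n2 by linarith+
    have K: "real (3 * t + 1) \<le> \<delta> * ?n" "real (3 * t + 1) \<le> \<rho> ^ 3 * ?n"
      using n' \<delta> \<rho> by (simp_all add: divide_le_eq mult.commute)
    have "real (card (tri G)) \<le> real ((3 * t + 1) * (card V)\<^sup>2)" using card_tri_G by (simp only: of_nat_le_iff)
    also have "\<dots> \<le> \<delta> * ?n * ?n\<^sup>2" using mult_right_mono[OF K(1), of "?n\<^sup>2"] by (simp add: algebra_simps)
    finally have "card (tri G) \<le> \<delta> * card V ^ 3" by (simp add: power2_eq_square power3_eq_cube mult_ac)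
    then obtain R where R: "R \<subseteq> G" "card R \<le> \<epsilon> * (card V)\<^sup>2"
      "\<forall>(x, y, z)\<in>tri G. (x, y) \<in> R \<or> (y, z) \<in> R \<or> (x, z) \<in> R"
      using rem[rule_format, OF finite_V G_subset] by blast
    have "H = {e\<in>H. two_unit e} \<union> {e\<in>H. \<not> two_unit e}" by auto
    then have "card H \<le> card {e\<in>H. two_unit e} + card {e\<in>H. \<not> two_unit e}"
      using card_Un_le by metis
    then have "4 * card H \<le> card U + 12 * t * card R"
      using card_two_unit card_not_two_unit[OF R(1,3)] by linarith
    then have "real (4 * card H) \<le> real (card U + 12 * t * card R)" by (simp only: of_nat_le_iff)
    then have "4 * real (card H) \<le> card U + 12 * t * real (card R)" by simp
    also have "12 * t * real (card R) \<le> 12 * t * (\<epsilon> * (card V)\<^sup>2)" using R(2) by (intro mult_left_mono) auto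
    also have "12 * t * (\<epsilon> * (card V)\<^sup>2) \<le> \<rho> ^ 3 * (card V)\<^sup>2"
      using mult_right_mono[OF \<epsilon>t, of "(card V)\<^sup>2"] by (simp add: mult_ac)
    finally have "(card V)\<^sup>2 / 2 - \<rho> ^ 3 * (card V)\<^sup>2 \<le> card U" using large by simp
    then obtain A B where AB: "A \<subseteq> V" "B \<subseteq> V" "A \<inter> B = {}"
      "(1 / 2 - 7 * \<rho>) * card V \<le> card A" "(1 / 2 - 7 * \<rho>) * card V \<le> card B"
      "\<forall>a\<in>A. (1 / 2 - 7 * \<rho>) * card V \<le> card (N a \<inter> B)"
      "\<forall>b\<in>B. (1 / 2 - 7 * \<rho>) * card V \<le> card (N b \<inter> A)"
      using core_partition[OF \<rho>(1,2) K(2) _ n'(3)] by blast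
    have le: "(1 / 2 - \<zeta>) * ?n \<le> (1 / 2 - 7 * \<rho>) * ?n" using \<rho> by (intro mult_right_mono) auto
    show "\<exists>A B. A \<subseteq> V \<and> B \<subseteq> V \<and> A \<inter> B = {} \<and>
      (1 / 2 - \<zeta>) * card V \<le> card A \<and> (1 / 2 - \<zeta>) * card V \<le> card B \<and>
      (\<forall>a\<in>A. (1 / 2 - \<zeta>) * card V \<le> card (N a \<inter> B)) \<and>
      (\<forall>b\<in>B. (1 / 2 - \<zeta>) * card V \<le> card (N b \<inter> A))"
      using AB(1-3) order.trans[OF le AB(4)] order.trans[OF le AB(5)]
        order.trans[OF le bspec[OF AB(6)]] order.trans[OF le bspec[OF AB(7)]]
      by (intro exI[of _ A] exI[of _ B] conjI ballI)
  qed
qed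

section \<open>Counting between two matchings\<close>

text \<open>For t = 2 there is no excess: three hyperedges inside the union of two matching edges P and Q,
  together with one outer hyperedge through P and one through Q, already form a Berge book whose
  core joins P to Q.\<close>

definition gain :: "nat \<Rightarrow> nat" where
  "gain t = (if t = 2 then 0 else t - 1)"

text \<open>\<open>\<kappa>\<close> bounds how many vertices of the opposite side fail to form a
  hyperedge with a given matched pair; it is later a small multiple of n. The assumptions
  \<open>large\<close> allow a third vertex outside any \<open>t + 1\<close> given ones, and
  \<open>\<kappa>_small\<close> settles the case in which both matchings are small.\<close>

locale matched_bipartition = book_free V H t
  for V :: "'a set" and H t +
  fixes A B :: "'a set" and \<kappa> :: real
  assumes AV: "A \<subseteq> V" and BV: "B \<subseteq> V" and disj: "A \<inter> B = {}"
    and matching_A: "a \<in> A \<Longrightarrow> card (N a \<inter> A) \<le> 1"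
    and matching_B: "b \<in> B \<Longrightarrow> card (N b \<inter> B) \<le> 1"
    and codegree_A: "a \<in> A \<Longrightarrow> a' \<in> N a \<inter> A \<Longrightarrow> card B - \<kappa> \<le> card (L a a' \<inter> B)"
    and codegree_B: "b \<in> B \<Longrightarrow> b' \<in> N b \<inter> B \<Longrightarrow> card A - \<kappa> \<le> card (L b b' \<inter> A)"
    and large: "t + 3 + \<kappa> \<le> card A" "t + 3 + \<kappa> \<le> card B"
    and \<kappa>_small: "8 * t * \<kappa> * (card A + card B) \<le> card A * card B"
    and \<kappa>_pos: "0 < \<kappa>"
    and t2: "2 \<le> t"
begin

lemma swapped: "matched_bipartition V H t B A \<kappa>"
proof -
  have "8 * t * \<kappa> * (card B + card A) \<le> card B * card A"
    using \<kappa>_small by (simp add: mult.commute add.commute)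
  then show ?thesis
    by unfold_locales (use AV BV disj matching_A matching_B codegree_A codegree_B large \<kappa>_pos t2 in auto)
qed

text \<open>Meaningful on \<open>MA\<close> only, where the neighbour on the same side exists and is
  unique.\<close>

definition mateA :: "'a \<Rightarrow> 'a" where
  "mateA a = (THE a'. a' \<in> N a \<inter> A)"

definition mateB :: "'a \<Rightarrow> 'a" where
  "mateB b = (THE b'. b' \<in> N b \<inter> B)"

definition MA :: "'a set" where
  "MA = {a\<in>A. N a \<inter> A \<noteq> {}}"

definition MB :: "'a set" where
  "MB = {b\<in>B. N b \<inter> B \<noteq> {}}"

definition H' :: "'a set set" where
  "H' = {e\<in>H. e \<subseteq> A \<union> B}"

lemma fin: "finite A" "finite B" "finite MA" "finite MB" "finite H'"
  using AV BV finite_V finite_H by (auto simp: MA_def MB_def H'_def intro: finite_subset)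

lemma mateA_eq:
  assumes "a \<in> A" "a' \<in> N a" "a' \<in> A" shows "mateA a = a'"
  unfolding mateA_def
proof (rule the_equality)
  fix c assume c: "c \<in> N a \<inter> A"
  have "finite (N a \<inter> A)" using fin by simp
  then have "card (N a \<inter> A) \<le> Suc 0 \<longleftrightarrow> (\<forall>x\<in>N a \<inter> A. \<forall>y\<in>N a \<inter> A. x = y)"
    by (rule card_le_Suc0_iff_eq)
  then show "c = a'" using c assms matching_A[OF assms(1)] by simp
qed (use assms in simp)

lemma mateB_eq:
  assumes "b \<in> B" "b' \<in> N b" "b' \<in> B" shows "mateB b = b'"
  unfolding mateB_def
proof (rule the_equality)
  fix c assume c: "c \<in> N b \<inter> B"
  have "finite (N b \<inter> B)" using fin by simp
  then have "card (N b \<inter> B) \<le> Suc 0 \<longleftrightarrow> (\<forall>x\<in>N b \<inter> B. \<forall>y\<in>N b \<inter> B. x = y)"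
    by (rule card_le_Suc0_iff_eq)
  then show "c = b'" using c assms matching_B[OF assms(1)] by simp
qed (use assms in simp)

lemma MA_mate:
  assumes "a \<in> MA"
  shows "a \<in> A" "mateA a \<in> N a" "mateA a \<in> A" "mateA (mateA a) = a" "mateA a \<noteq> a" "mateA a \<in> MA"
proof -
  obtain a' where a': "a \<in> A" "a' \<in> N a" "a' \<in> A" using assms by (auto simp: MA_def)
  have eq: "mateA a = a'" by (rule mateA_eq[OF a'])
  have "a \<in> N a'" using a' N_sym by blast
  then have "mateA a' = a" by (rule mateA_eq[OF a'(3) _ a'(1)])
  then show "a \<in> A" "mateA a \<in> N a" "mateA a \<in> A" "mateA (mateA a) = a" "mateA a \<noteq> a" "mateA a \<in> MA"
    using a' eq \<open>a \<in> N a'\<close> N_irrefl[of a] by (auto simp: MA_def)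
qed

lemma MB_mate:
  assumes "b \<in> MB"
  shows "b \<in> B" "mateB b \<in> N b" "mateB b \<in> B" "mateB (mateB b) = b" "mateB b \<noteq> b" "mateB b \<in> MB"
proof -
  obtain b' where b': "b \<in> B" "b' \<in> N b" "b' \<in> B" using assms by (auto simp: MB_def)
  have eq: "mateB b = b'" by (rule mateB_eq[OF b'])
  have "b \<in> N b'" using b' N_sym by blast
  then have "mateB b' = b" by (rule mateB_eq[OF b'(3) _ b'(1)])
  then show "b \<in> B" "mateB b \<in> N b" "mateB b \<in> B" "mateB (mateB b) = b" "mateB b \<noteq> b" "mateB b \<in> MB"
    using b' eq \<open>b \<in> N b'\<close> N_irrefl[of b] by (auto simp: MB_def)
qed

lemma pair_in_A: "{x, y, z} \<in> H \<Longrightarrow> x \<in> A \<Longrightarrow> y \<in> A \<Longrightarrow> x \<in> MA \<and> y = mateA x"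
  using edge_N[of x y z] mateA_eq[of x y] by (auto simp: MA_def)

lemma pair_in_B: "{x, y, z} \<in> H \<Longrightarrow> x \<in> B \<Longrightarrow> y \<in> B \<Longrightarrow> x \<in> MB \<and> y = mateB x"
  using edge_N[of x y z] mateB_eq[of x y] by (auto simp: MB_def)

text \<open>Three vertices on one side are impossible, since one of them would have two mates. So
  two vertices share a side, and these are mates.\<close>

lemma H'_cases:
  assumes "e \<in> H'"
  obtains a b where "a \<in> MA" "b \<in> B" "e = {a, mateA a, b}" | a b where "a \<in> A" "b \<in> MB" "e = {a, b, mateB b}"
proof -
  have e: "e \<in> H" "e \<subseteq> A \<union> B" using assms by (auto simp: H'_def)
  obtain x y z where xyz: "e = {x, y, z}" "x \<noteq> y" "x \<noteq> z" "y \<noteq> z" by (rule edgeE[OF e(1)])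
  have perms: "{x, y, z} \<in> H" "{x, z, y} \<in> H" "{y, z, x} \<in> H" using e xyz by (auto simp: insert_commute)
  have noA: "\<not> (x \<in> A \<and> y \<in> A \<and> z \<in> A)"
    using pair_in_A[OF perms(1)] pair_in_A[OF perms(2)] xyz by metis
  have noB: "\<not> (x \<in> B \<and> y \<in> B \<and> z \<in> B)"
    using pair_in_B[OF perms(1)] pair_in_B[OF perms(2)] xyz by metis
  have xyzAB: "x \<in> A \<or> x \<in> B" "y \<in> A \<or> y \<in> B" "z \<in> A \<or> z \<in> B" using e xyz by auto
  consider "x \<in> A" "y \<in> A" "z \<in> B" | "x \<in> A" "z \<in> A" "y \<in> B" | "y \<in> A" "z \<in> A" "x \<in> B"
    | "x \<in> B" "y \<in> B" "z \<in> A" | "x \<in> B" "z \<in> B" "y \<in> A" | "y \<in> B" "z \<in> B" "x \<in> A"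
    using noA noB xyzAB by metis
  then show thesis
  proof cases
    case 1 then show ?thesis using that(1)[of x z] pair_in_A[OF perms(1)] xyz by simp
  next
    case 2 then show ?thesis using that(1)[of x y] pair_in_A[OF perms(2)] xyz by (simp add: insert_commute)
  next
    case 3 then show ?thesis using that(1)[of y x] pair_in_A[OF perms(3)] xyz by (simp add: insert_commute)
  next
    case 4 then show ?thesis using that(2)[of z x] pair_in_B[OF perms(1)] xyz by (simp add: insert_commute)
  next
    case 5 then show ?thesis using that(2)[of y x] pair_in_B[OF perms(2)] xyz by (simp add: insert_commute)
  next
    case 6 then show ?thesis using that(2)[of x y] pair_in_B[OF perms(3)] xyz by simp
  qed
qed

lemma not_both: "x \<in> A \<Longrightarrow> x \<in> B \<Longrightarrow> False"
  using disj by auto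

text \<open>Supplies a hyperedge over a matched pair, for instance to represent the core of a book,
  that avoids prescribed vertices.\<close>

lemma third_outside_A:
  assumes "a \<in> MA" "finite T" "card T \<le> t + 1"
  obtains x where "{a, mateA a, x} \<in> H" "x \<in> B" "x \<notin> T"
proof -
  have "card B - \<kappa> \<le> card (L a (mateA a) \<inter> B)"
    using codegree_A MA_mate[OF assms(1)] by simp
  then have "card T < card (L a (mateA a) \<inter> B)" using large(2) assms(3) by linarith
  then have "\<not> L a (mateA a) \<inter> B \<subseteq> T" using assms(2) by (meson card_mono not_less)
  then show thesis using that by (auto simp: L_def)
qed

lemma third_outside_B:
  assumes "b \<in> MB" "finite T" "card T \<le> t + 1"
  obtains x where "{b, mateB b, x} \<in> H" "x \<in> A" "x \<notin> T"
proof -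
  have "card A - \<kappa> \<le> card (L b (mateB b) \<inter> A)"
    using codegree_B MB_mate[OF assms(1)] by simp
  then have "card T < card (L b (mateB b) \<inter> A)" using large(1) assms(3) by linarith
  then have "\<not> L b (mateB b) \<inter> A \<subseteq> T" using assms(2) by (meson card_mono not_less)
  then show thesis using that by (auto simp: L_def)
qed

lemma obtain_idx: obtains idx :: "'a \<Rightarrow> nat" where "inj_on idx V"
  using finite_V finite_imp_inj_to_nat_seg by metis

text \<open>Apart from \<open>a\<close>, such a hyperedge is a matching edge of \<open>B\<close>,
  and different matching edges are disjoint.\<close>

lemma card_unmatched:
  assumes a: "a \<in> A" "a \<notin> MA"
  shows "2 * card {e\<in>H'. a \<in> e} \<le> card B"
proof -
  let ?E = "{e\<in>H'. a \<in> e}"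
  have form: "\<exists>b\<in>MB. e = {a, b, mateB b}" if "e \<in> ?E" for e
  proof -
    have e: "e \<in> H'" "a \<in> e" using that by auto
    from e(1) show ?thesis
    proof (cases rule: H'_cases)
      case (1 c b)
      then show ?thesis using e a MA_mate[of c] not_both by auto
    next
      case (2 c b)
      then show ?thesis using e a MB_mate[of b] not_both by auto
    qed
  qed
  have two: "card (e - {a}) = 2" if e: "e \<in> ?E" for e
  proof -
    obtain b where b: "b \<in> MB" "e = {a, b, mateB b}" using form[OF e] by auto
    note mb = MB_mate[OF b(1)]
    have "a \<noteq> b" "a \<noteq> mateB b" using a mb(1,3) not_both by auto
    then have "e - {a} = {b, mateB b}" using b by auto
    then show ?thesis using mb(5) by simp
  qed
  have "2 * card ?E = (\<Sum>e\<in>?E. card (e - {a}))" using two by simp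
  also have "\<dots> = card (\<Union>e\<in>?E. e - {a})"
  proof (rule card_UN_disjoint[symmetric])
    show "finite ?E" using fin by simp
    show "\<forall>e\<in>?E. finite (e - {a})" using form by auto
    show "\<forall>e\<in>?E. \<forall>e'\<in>?E. e \<noteq> e' \<longrightarrow> (e - {a}) \<inter> (e' - {a}) = {}"
    proof (intro ballI impI)
      fix e e' assume ee: "e \<in> ?E" "e' \<in> ?E" "e \<noteq> e'"
      obtain b where b: "b \<in> MB" "e = {a, b, mateB b}" using form[OF ee(1)] by auto
      obtain b' where b': "b' \<in> MB" "e' = {a, b', mateB b'}" using form[OF ee(2)] by auto
      have "{b, mateB b} \<inter> {b', mateB b'} = {}"
      proof (rule ccontr)
        assume "\<not> ?thesis"
        then have "b = b' \<or> b = mateB b' \<or> mateB b = b' \<or> mateB b = mateB b'" by auto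
        then have "b = b' \<or> b = mateB b'" using MB_mate(4)[OF b(1)] MB_mate(4)[OF b'(1)] by metis
        then have "e = e'" using b(2) b'(2) MB_mate(4)[OF b'(1)] by auto
        then show False using ee(3) by simp
      qed
      then show "(e - {a}) \<inter> (e' - {a}) = {}" using b b' by auto
    qed
  qed
  also have "\<dots> \<le> card B" using form MB_mate fin by (intro card_mono) fastforce+
  finally show ?thesis .
qed

text \<open>The core is \<open>ab\<close>, represented by \<open>e\<close>, and the pages are the
  two mates: \<open>p\<close> and \<open>q\<close> represent the edges from \<open>a\<close> to
  \<open>mateB b\<close> and from \<open>b\<close> to \<open>mateA a\<close>, while hyperedges
  reaching outside the four vertices represent the matching edges.\<close>

lemma book_two:
  assumes t: "t = 2" and ab: "a \<in> MA" "b \<in> MB"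
    and e: "e \<in> H" "a \<in> e" "b \<in> e" and p: "p \<in> H" "a \<in> p" "mateB b \<in> p" and q: "q \<in> H" "mateA a \<in> q" "b \<in> q"
    and ne: "e \<noteq> p" "e \<noteq> q" "p \<noteq> q"
    and sub: "e \<subseteq> {a, mateA a, b, mateB b}" "p \<subseteq> {a, mateA a, b, mateB b}" "q \<subseteq> {a, mateA a, b, mateB b}"
  shows False
proof -
  note a = MA_mate[OF ab(1)] and b = MB_mate[OF ab(2)]
  have c: "finite {b, mateB b}" "card {b, mateB b} \<le> t + 1" "finite {a, mateA a}" "card {a, mateA a} \<le> t + 1"
    using a(5) b(5) t by auto
  obtain x where x: "{a, mateA a, x} \<in> H" "x \<in> B" "x \<notin> {b, mateB b}"
    by (rule third_outside_A[OF ab(1) c(1,2)])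
  obtain y where y: "{b, mateB b, y} \<in> H" "y \<in> A" "y \<notin> {a, mateA a}"
    by (rule third_outside_B[OF ab(2) c(3,4)])
  let ?f = "{a, mateA a, x}" and ?g = "{b, mateB b, y}"
  have d: "a \<noteq> b" "mateA a \<noteq> b" "a \<noteq> mateB b" "mateA a \<noteq> mateB b" "x \<noteq> a" "x \<noteq> mateA a" "y \<noteq> b" "y \<noteq> mateB b" "x \<noteq> y"
    using a b x y not_both by auto
  have xo: "x \<notin> e" "x \<notin> p" "x \<notin> q" "y \<notin> e" "y \<notin> p" "y \<notin> q" using sub x y d by auto
  have fg: "?f \<noteq> e" "?f \<noteq> p" "?f \<noteq> q" "?g \<noteq> e" "?g \<noteq> p" "?g \<noteq> q" "?f \<noteq> ?g"
    using xo d x by auto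
  have "book_in H t a b"
  proof (rule book_inI[of _ _ "{mateA a, mateB b}" _ "\<lambda>w. if w = mateA a then ?f else p" "\<lambda>w. if w = mateA a then q else ?g" e])
    show "inj_on (\<lambda>w. if w = mateA a then ?f else p) {mateA a, mateB b}"
      using fg d by (auto simp: inj_on_def)
    show "inj_on (\<lambda>w. if w = mateA a then q else ?g) {mateA a, mateB b}"
      using fg d by (auto simp: inj_on_def)
    show "(\<lambda>w. if w = mateA a then ?f else p) ` {mateA a, mateB b} \<inter> (\<lambda>w. if w = mateA a then q else ?g) ` {mateA a, mateB b} = {}"
      using fg d ne by auto
    show "e \<notin> (\<lambda>w. if w = mateA a then ?f else p) ` {mateA a, mateB b}"
      "e \<notin> (\<lambda>w. if w = mateA a then q else ?g) ` {mateA a, mateB b}"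
      using fg ne by auto
  qed (use a b d e p q x y t in auto)
  then show False using free by blast
qed

text \<open>Each hyperedge meeting the pair aa' is charged to one vertex of B: aa'b is charged to b, and for
  a matching edge bb' the hyperedges abb' and a'bb' are charged to different ends of bb'. A
  vertex charged twice is a page of a Berge book with core aa'.\<close>

lemma card_matched:
  assumes a: "a \<in> MA"
  shows "card {e\<in>H'. a \<in> e \<or> mateA a \<in> e} \<le> card B + gain t"
proof -
  obtain idx :: "'a \<Rightarrow> nat" where idx: "inj_on idx V" by (rule obtain_idx)
  let ?a' = "mateA a" let ?m = mateB
  note ma = MA_mate[OF a]
  have abne: "u \<noteq> a" "u \<noteq> ?a'" if "u \<in> B" for u using that ma not_both by auto
  define X where "X = {b\<in>B. {a, ?a', b} \<in> H}"
  \<comment> \<open>\<open>idx\<close> orients every matching edge of \<open>B\<close>: a hyperedge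
    with \<open>a\<close> is charged to the smaller end, one with the mate of \<open>a\<close> to
    the larger end. So \<open>Y\<close> and \<open>Z\<close> are disjoint, and neither contains both
    ends of a matching edge.\<close>
  define Y where "Y = {b\<in>MB. {a, b, ?m b} \<in> H \<and> idx b < idx (?m b)}"
  define Z where "Z = {b\<in>MB. {?a', b, ?m b} \<in> H \<and> idx (?m b) < idx b}"
  have fXYZ: "finite X" "finite Y" "finite Z" using fin by (auto simp: X_def Y_def Z_def)
  have YZ: "Y \<inter> Z = {}" by (auto simp: Y_def Z_def)
  have YZB: "Y \<subseteq> MB" "Z \<subseteq> MB" "X \<subseteq> B" by (auto simp: X_def Y_def Z_def)
  have idxm: "idx b < idx (?m b) \<or> idx (?m b) < idx b" if "b \<in> MB" for b
  proof -
    have "b \<in> V" "?m b \<in> V" using MB_mate[OF that] BV by auto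
    then have "idx b \<noteq> idx (?m b)" using idx MB_mate(5)[OF that] by (metis inj_on_eq_iff)
    then show ?thesis by linarith
  qed
  have "{e\<in>H'. a \<in> e \<or> ?a' \<in> e} \<subseteq> (\<lambda>b. {a, ?a', b}) ` X \<union> (\<lambda>b. {a, b, ?m b}) ` Y \<union> (\<lambda>b. {?a', b, ?m b}) ` Z"
  proof
    fix e assume "e \<in> {e\<in>H'. a \<in> e \<or> ?a' \<in> e}"
    then have e: "e \<in> H'" "a \<in> e \<or> ?a' \<in> e" by auto
    have eH: "e \<in> H" using e by (simp add: H'_def)
    from e(1) show "e \<in> (\<lambda>b. {a, ?a', b}) ` X \<union> (\<lambda>b. {a, b, ?m b}) ` Y \<union> (\<lambda>b. {?a', b, ?m b}) ` Z"
    proof (cases rule: H'_cases)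
      case (1 c b)
      then have "a = c \<or> a = mateA c \<or> ?a' = c \<or> ?a' = mateA c" using e(2) ma not_both by auto
      then have "c = a \<or> c = ?a'" using MA_mate(4)[OF 1(1)] ma(4) by metis
      then have "e = {a, ?a', b}" using 1(3) ma(4) by auto
      then show ?thesis using eH 1(2) by (auto simp: X_def)
    next
      case (2 c b)
      note mb = MB_mate[OF 2(2)]
      have c: "c = a \<or> c = ?a'" using e(2) 2(3) abne[OF mb(1)] abne[OF mb(3)] by auto
      \<comment> \<open>The end to which the charging rule assigns \<open>e\<close>: the smaller one
        for \<open>a\<close>, the larger one for its mate.\<close>
      define b0 where "b0 = (if c = a \<longleftrightarrow> idx b < idx (?m b) then b else ?m b)"
      have e0: "e = {c, b0, ?m b0}" "b0 \<in> MB" using 2 mb by (auto simp: b0_def)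
      show ?thesis
      proof (cases "c = a")
        case True
        then have "idx b0 < idx (?m b0)" using idxm[OF 2(2)] mb(4) by (auto simp: b0_def)
        then have "b0 \<in> Y" using e0 eH True by (auto simp: Y_def)
        then show ?thesis using e0 True by blast
      next
        case False
        then have ca: "c = ?a'" using c by simp
        have "idx (?m b0) < idx b0" using idxm[OF 2(2)] mb(4) False by (auto simp: b0_def)
        then have "b0 \<in> Z" using e0 eH ca by (auto simp: Z_def)
        then show ?thesis using e0 ca by blast
      qed
    qed
  qed
  then have "card {e\<in>H'. a \<in> e \<or> ?a' \<in> e} \<le> card ((\<lambda>b. {a, ?a', b}) ` X \<union> (\<lambda>b. {a, b, ?m b}) ` Y \<union> (\<lambda>b. {?a', b, ?m b}) ` Z)"
    using fXYZ by (intro card_mono) auto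
  also have "\<dots> \<le> card X + card Y + card Z"
    using fXYZ by (intro order.trans[OF card_Un_le] add_mono card_image_le)
  also have "\<dots> = card X + card (Y \<union> Z)" using fXYZ YZ by (simp add: card_Un_disjoint)
  also have "\<dots> = card (X \<union> (Y \<union> Z)) + card (X \<inter> (Y \<union> Z))" using fXYZ by (intro card_Un_Int) auto
  finally have main: "card {e\<in>H'. a \<in> e \<or> ?a' \<in> e} \<le> card (X \<union> (Y \<union> Z)) + card (X \<inter> (Y \<union> Z))" .
  define T where "T = X \<inter> (Y \<union> Z)"
  have fT: "finite T" using fXYZ by (simp add: T_def)
  have XYZ: "X \<union> (Y \<union> Z) \<subseteq> B" using YZB MB_mate by auto
  have T: "card T \<le> t - 1"
  proof (rule ccontr)
    assume "\<not> ?thesis"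
    then have "t \<le> card T" by simp
    then obtain W where W: "W \<subseteq> T" "card W = t" "finite W" using fT by (meson obtain_subset_with_card_n)
    obtain x where x: "{a, ?a', x} \<in> H" "x \<in> B" "x \<notin> W" using third_outside_A[OF a W(3)] W(2) by auto
    \<comment> \<open>A page \<open>w\<close> is charged by the hyperedge over \<open>aa'\<close>
      and by one containing its mate. The latter contains only one of \<open>a\<close>,
      \<open>a'\<close> and must represent the edge from that vertex to \<open>w\<close>; the former
      represents the other edge.\<close>
    let ?p = "\<lambda>w. if w \<in> Y then {a, w, ?m w} else {a, ?a', w}"
    let ?q = "\<lambda>w. if w \<in> Y then {a, ?a', w} else {?a', w, ?m w}"
    have w: "w \<in> B" "?m w \<in> B" "w \<noteq> a" "w \<noteq> ?a'" "?m w \<noteq> a" "?m w \<noteq> ?a'" "w \<noteq> x" "{a, ?a', w} \<in> H"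
      "?m (?m w) = w" "w \<in> Y \<or> w \<in> Z" if "w \<in> W" for w
    proof -
      have wT: "w \<in> T" using that W(1) by auto
      then show "w \<in> B" "w \<in> Y \<or> w \<in> Z" "{a, ?a', w} \<in> H" by (auto simp: T_def X_def)
      then have "w \<in> MB" using YZB by auto
      then show "?m w \<in> B" "?m (?m w) = w" by (auto dest: MB_mate)
      then show "w \<noteq> a" "w \<noteq> ?a'" "?m w \<noteq> a" "?m w \<noteq> ?a'" using abne \<open>w \<in> B\<close> by auto
      show "w \<noteq> x" using that x(3) by auto
    qed
    have notin: "?a' \<notin> {a, w, ?m w}" "a \<notin> {?a', w, ?m w}" if "w \<in> W" for w
      using w(3-6)[OF that] ma(5) by auto
    have dist: "{a, w, ?m w} \<noteq> {a, ?a', w'}" "{a, w, ?m w} \<noteq> {?a', w', ?m w'}" "{?a', w, ?m w} \<noteq> {a, ?a', w'}"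
      if "w \<in> W" for w w'
      using notin[OF that] by blast+
    have dist2: "{a, ?a', u} = {a, ?a', v} \<longleftrightarrow> u = v" if "u \<in> B" for u v
      using abne[OF that] by auto
    have same: "u = v \<or> u = ?m v" if "{c, u, ?m u} = {c, v, ?m v}" "u \<in> W" "v \<in> W" "c = a \<or> c = ?a'" for c u v
      using that w[OF that(2)] w[OF that(3)] by auto
    have "book_in H t a ?a'"
    proof (rule book_inI[of _ _ W _ ?p ?q "{a, ?a', x}"])
      show "card W = t" by (rule W(2))
      show "a \<notin> W" "?a' \<notin> W" using w(3,4) by blast+
      show "inj_on ?p W"
      proof (rule inj_onI)
        fix u v assume uv: "u \<in> W" "v \<in> W" and eq: "?p u = ?p v"
        consider "u \<in> Y" "v \<in> Y" | "u \<in> Y" "v \<notin> Y" | "u \<notin> Y" "v \<in> Y" | "u \<notin> Y" "v \<notin> Y" by blast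
        then show "u = v"
        proof cases
          case 1
          then have "u = v \<or> u = ?m v" using eq uv same[of a u v] by simp
          moreover have "u \<noteq> ?m v" using 1 w(9)[OF uv(2)] by (auto simp: Y_def)
          ultimately show ?thesis by simp
        next
          case 2 then show ?thesis using eq dist(1)[OF uv(1), of v] by simp
        next
          case 3 then show ?thesis using eq[symmetric] dist(1)[OF uv(2), of u] by simp
        next
          case 4 then show ?thesis using eq dist2[OF w(1)[OF uv(1)], of v] by simp
        qed
      qed
      show "inj_on ?q W"
      proof (rule inj_onI)
        fix u v assume uv: "u \<in> W" "v \<in> W" and eq: "?q u = ?q v"
        consider "u \<in> Y" "v \<in> Y" | "u \<in> Y" "v \<notin> Y" | "u \<notin> Y" "v \<in> Y" | "u \<notin> Y" "v \<notin> Y" by blast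
        then show "u = v"
        proof cases
          case 1 then show ?thesis using eq dist2[OF w(1)[OF uv(1)], of v] by simp
        next
          case 2 then show ?thesis using eq[symmetric] dist(3)[OF uv(2), of u] by simp
        next
          case 3 then show ?thesis using eq dist(3)[OF uv(1), of v] by simp
        next
          case 4
          then have "u = v \<or> u = ?m v" using eq uv same[of ?a' u v] by simp
          moreover have "u \<noteq> ?m v" using 4 w(9,10)[OF uv(2)] w(10)[OF uv(1)] by (auto simp: Z_def)
          ultimately show ?thesis by simp
        qed
      qed
      have "?p u \<noteq> ?q v" if uv: "u \<in> W" "v \<in> W" for u v
        using dist(1)[OF uv(1), of v] dist(2)[OF uv(1), of v] dist(3)[OF uv(2), of u, symmetric]
          dist2[OF w(1)[OF uv(1)], of v] by (cases "u \<in> Y"; cases "v \<in> Y") auto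
      then show "?p ` W \<inter> ?q ` W = {}" by blast
      have "{a, ?a', x} \<noteq> ?p u" "{a, ?a', x} \<noteq> ?q u" if u: "u \<in> W" for u
        using dist(1)[OF u, of x, symmetric] dist(3)[OF u, of x, symmetric] dist2[OF x(2), of u] w(7)[OF u]
        by (cases "u \<in> Y"; auto)+
      then show "{a, ?a', x} \<notin> ?p ` W" "{a, ?a', x} \<notin> ?q ` W" by blast+
      fix u assume u: "u \<in> W"
      show "?p u \<in> H \<and> a \<in> ?p u \<and> u \<in> ?p u" using w(8)[OF u] by (auto simp: Y_def)
      show "?q u \<in> H \<and> ?a' \<in> ?q u \<and> u \<in> ?q u" using w(8,10)[OF u] by (auto simp: Y_def Z_def)
    qed (use ma W(3) x in auto)
    then show False using free by blast
  qed
  show ?thesis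
  proof (cases "t = 2")
    case False
    have "card (X \<union> (Y \<union> Z)) \<le> card B" using XYZ fin by (intro card_mono)
    then show ?thesis using main T False by (simp add: gain_def T_def)
  next
    case True
    have TB: "T \<subseteq> MB" using YZB by (auto simp: T_def)
    \<comment> \<open>For t = 2 the mate of a doubly charged vertex is not charged at all: otherwise
      three hyperedges would lie inside the two matching edges, contrary to \<open>book_two\<close>.
      The uncharged mates compensate for the double charges.\<close>
    have out: "?m b \<notin> X \<union> (Y \<union> Z)" if b: "b \<in> T" for b
    proof
      have bM: "b \<in> MB" using b TB by auto
      note mb = MB_mate[OF bM]
      have d: "a \<noteq> ?a'" "b \<noteq> ?m b" "a \<noteq> b" "a \<noteq> ?m b" "?a' \<noteq> b" "?a' \<noteq> ?m b" using ma mb not_both by auto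
      have E1: "{a, ?a', b} \<in> H" using b by (auto simp: T_def X_def)
      assume "?m b \<in> X \<union> (Y \<union> Z)"
      then consider "{a, ?a', ?m b} \<in> H" "{a, b, ?m b} \<in> H" | "{a, ?a', ?m b} \<in> H" "{?a', b, ?m b} \<in> H"
        | "{a, b, ?m b} \<in> H" "{?a', b, ?m b} \<in> H"
        using b mb(4) by (auto simp: T_def X_def Y_def Z_def insert_commute)
      then show False
      proof cases
        case 1
        show False
          by (rule book_two[OF True a bM, of "{a, b, ?m b}" "{a, ?a', ?m b}" "{a, ?a', b}"])
            (use 1 E1 d in auto)
      next
        case 2
        have a': "mateA ?a' = a" "?a' \<in> MA" using ma by auto
        show False
          by (rule book_two[OF True a'(2) bM, of "{?a', b, ?m b}" "{a, ?a', ?m b}" "{a, ?a', b}"])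
            (use 2 E1 d a' in auto)
      next
        case 3
        show False
          by (rule book_two[OF True a bM, of "{a, ?a', b}" "{a, b, ?m b}" "{?a', b, ?m b}"])
            (use 3 E1 d in auto)
      qed
    qed
    have "inj_on ?m T" using MB_mate(4) TB by (metis inj_on_inverseI subsetD)
    then have "card T = card (?m ` T)" by (simp add: card_image)
    moreover have "card (X \<union> (Y \<union> Z)) + card (?m ` T) = card (X \<union> (Y \<union> Z) \<union> ?m ` T)"
      using fXYZ fT out by (intro card_Un_disjoint[symmetric]) auto
    moreover have "card (X \<union> (Y \<union> Z) \<union> ?m ` T) \<le> card B"
      using XYZ TB MB_mate(3) fin by (intro card_mono) auto
    ultimately show ?thesis using main by (simp add: T_def)
  qed
qed

lemma H'_meets_A:
  assumes "e \<in> H'" shows "\<exists>a\<in>A. a \<in> e"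
  using assms by (cases rule: H'_cases) (auto dest: MA_mate(1))

text \<open>The weights \<omega> make every hyperedge count at least twice: a hyperedge meeting a matched pair is
  counted from both of its ends.\<close>

lemma card_H'_if_few_matched:
  assumes few: "card MA \<le> 2 * (t - 1)"
  shows "2 * card H' \<le> card A * card B + 2 * (t - 1) * gain t"
proof -
  define \<omega> where "\<omega> a = (if a \<in> MA then 1 else 2 :: nat)" for a
  define K where "K a = (if a \<in> MA then {e\<in>H'. a \<in> e \<or> mateA a \<in> e} else {e\<in>H'. a \<in> e})" for a
  have fK: "finite (K a)" for a using fin by (simp add: K_def)
  have two: "2 \<le> (\<Sum>a\<in>{a\<in>A. e \<in> K a}. \<omega> a)" if e: "e \<in> H'" for e
  proof -
    obtain a where a: "a \<in> A" "a \<in> e" using H'_meets_A[OF e] by auto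
    show ?thesis
    proof (cases "a \<in> MA")
      case False
      then have "(\<Sum>a\<in>{a}. \<omega> a) \<le> (\<Sum>a\<in>{a\<in>A. e \<in> K a}. \<omega> a)"
        using a e fin by (intro sum_mono2) (auto simp: K_def)
      then show ?thesis using False by (simp add: \<omega>_def)
    next
      case True
      note m = MA_mate[OF True]
      have "(\<Sum>a\<in>{a, mateA a}. \<omega> a) \<le> (\<Sum>a\<in>{a\<in>A. e \<in> K a}. \<omega> a)"
        using a e fin m True by (intro sum_mono2) (auto simp: K_def)
      then show ?thesis using m True by (simp add: \<omega>_def)
    qed
  qed
  have "2 * card H' = (\<Sum>e\<in>H'. 2)" by simp
  also have "\<dots> \<le> (\<Sum>e\<in>H'. \<Sum>a\<in>{a\<in>A. e \<in> K a}. \<omega> a)" using two by (rule sum_mono)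
  also have "\<dots> = (\<Sum>a\<in>A. \<Sum>e\<in>{e\<in>H'. e \<in> K a}. \<omega> a)" using fin by (intro sum.swap_restrict)
  also have "\<dots> = (\<Sum>a\<in>A. \<omega> a * card (K a))"
    by (intro sum.cong refl) (auto simp: K_def intro: arg_cong[where f = card])
  also have "\<dots> \<le> (\<Sum>a\<in>A. card B + (if a \<in> MA then gain t else 0))"
  proof (rule sum_mono)
    fix a assume "a \<in> A"
    then show "\<omega> a * card (K a) \<le> card B + (if a \<in> MA then gain t else 0)"
      using card_matched[of a] card_unmatched[of a] by (simp add: \<omega>_def K_def)
  qed
  also have "\<dots> = card A * card B + card MA * gain t"
    using fin by (simp add: sum.distrib sum.If_cases MA_def Int_def)
  also have "\<dots> \<le> card A * card B + 2 * (t - 1) * gain t" using few by (intro add_left_mono mult_right_mono) auto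
  finally show ?thesis .
qed

text \<open>Count the pairs (a, b) for which the matched pair of \<open>a\<close> forms hyperedges
  with both \<open>b\<close> and its mate. A vertex \<open>b\<close> sees at most
  \<open>t - 1\<close> matched pairs in this way, since \<open>t\<close> of them would be pages of a
  book with core \<open>b\<close>, \<open>mateB b\<close>. A vertex \<open>a\<close> sees all but
  \<open>2 * \<kappa>\<close> vertices of \<open>MB\<close>. With \<open>2 * t - 1\<close> or more
  vertices in \<open>MA\<close> the two counts bound \<open>card MB\<close> by
  \<open>4 * t * \<kappa>\<close>.\<close>

lemma few_matched_A:
  assumes big: "4 * t * \<kappa> < card MB"
  shows "card MA \<le> 2 * (t - 1)"
proof -
  obtain idx :: "'a \<Rightarrow> nat" where idx: "inj_on idx V" by (rule obtain_idx)
  define I where "I a b \<longleftrightarrow> {a, mateA a, b} \<in> H \<and> {a, mateA a, mateB b} \<in> H" for a b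
  have col: "card {a\<in>MA. I a b} \<le> 2 * (t - 1)" if b: "b \<in> MB" for b
  proof -
    let ?J = "{a\<in>MA. I a b}"
    note mb = MB_mate[OF b]
    \<comment> \<open>One end of each matched pair, so that different pages use different
      hyperedges.\<close>
    define R where "R = {a\<in>?J. idx a < idx (mateA a)}"
    have fR: "finite R" using fin by (simp add: R_def)
    have "?J \<subseteq> R \<union> mateA ` R"
    proof
      fix a assume a: "a \<in> ?J"
      then have aM: "a \<in> MA" by simp
      note m = MA_mate[OF aM]
      have "idx a \<noteq> idx (mateA a)" using idx m AV by (metis inj_on_eq_iff subsetD)
      moreover have "mateA a \<in> ?J" using a m by (auto simp: I_def insert_commute)
      ultimately show "a \<in> R \<union> mateA ` R" using a m(4) unfolding R_def
        by (metis (mono_tags, lifting) Un_iff image_eqI linorder_neqE_nat mem_Collect_eq)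
    qed
    then have "card ?J \<le> card (R \<union> mateA ` R)" using fR by (intro card_mono) auto
    also have "\<dots> \<le> card R + card R" by (intro order.trans[OF card_Un_le] add_mono order.refl card_image_le fR)
    finally have J: "card ?J \<le> 2 * card R" by simp
    have "card R \<le> t - 1"
    proof (rule ccontr)
      assume "\<not> ?thesis"
      then have "t \<le> card R" by simp
      then obtain W where W: "W \<subseteq> R" "card W = t" "finite W" using fR by (meson obtain_subset_with_card_n)
      obtain y where y: "{b, mateB b, y} \<in> H" using third_outside_B[OF b, of "{}"] by auto
      have w: "w \<in> A" "mateA w \<in> A" "idx w < idx (mateA w)" "{w, mateA w, b} \<in> H" "{w, mateA w, mateB b} \<in> H"
        "w \<noteq> b" "w \<noteq> mateB b" "mateA w \<noteq> b" "mateA w \<noteq> mateB b" "mateA (mateA w) = w" if "w \<in> W" for w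
      proof -
        have "w \<in> R" using that W by auto
        then have wR: "w \<in> MA" "I w b" "idx w < idx (mateA w)" by (auto simp: R_def)
        then show "w \<in> A" "mateA w \<in> A" "idx w < idx (mateA w)" "{w, mateA w, b} \<in> H" "{w, mateA w, mateB b} \<in> H"
          "w \<noteq> b" "w \<noteq> mateB b" "mateA w \<noteq> b" "mateA w \<noteq> mateB b" "mateA (mateA w) = w"
          using MA_mate[OF wR(1)] mb not_both by (auto simp: I_def)
      qed
      have same: "u = v" if "{u, mateA u, c} = {v, mateA v, c}" "u \<in> W" "v \<in> W" "c = b \<or> c = mateB b" for u v c
      proof -
        have "u = v \<or> u = mateA v" using that w[OF that(2)] by auto
        moreover have "u \<noteq> mateA v" using w(3)[OF that(2)] w(3,10)[OF that(3)] by auto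
        ultimately show ?thesis by simp
      qed
      have "book_in H t b (mateB b)"
      proof (rule book_inI[of _ _ W _ "\<lambda>w. {w, mateA w, b}" "\<lambda>w. {w, mateA w, mateB b}" "{b, mateB b, y}"])
        show "inj_on (\<lambda>w. {w, mateA w, b}) W" "inj_on (\<lambda>w. {w, mateA w, mateB b}) W"
          using same by (auto intro!: inj_onI)
        have ne: "mateB b \<notin> {w, mateA w, b}" "b \<notin> {w, mateA w, mateB b}" if "w \<in> W" for w
          using w[OF that] mb by auto
        then show "(\<lambda>w. {w, mateA w, b}) ` W \<inter> (\<lambda>w. {w, mateA w, mateB b}) ` W = {}"
          by blast
        show "{b, mateB b, y} \<notin> (\<lambda>w. {w, mateA w, b}) ` W" "{b, mateB b, y} \<notin> (\<lambda>w. {w, mateA w, mateB b}) ` W"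
          using ne by blast+
        show "b \<notin> W" "mateB b \<notin> W" using w(6,7) by blast+
        show "card W = t" by (rule W(2))
      qed (use mb W(3) w(4,5) y in auto)
      then show False using free by blast
    qed
    then show ?thesis using J by simp
  qed
  \<comment> \<open>A vertex of \<open>MB\<close> is lost only if it or its mate is among the at
    most \<open>\<kappa>\<close> vertices outside the link.\<close>
  have row: "card MB - 2 * \<kappa> \<le> card {b\<in>MB. I a b}" if a: "a \<in> MA" for a
  proof -
    let ?L = "L a (mateA a)"
    let ?Q = "{b\<in>MB. b \<notin> ?L}"
    have "card B - \<kappa> \<le> card (?L \<inter> B)" using codegree_A MA_mate[OF a] by simp
    moreover have "card (B - ?L) = card B - card (?L \<inter> B)" using fin by (metis Int_commute card_Diff_subset_Int finite_Int)
    moreover have "card (?L \<inter> B) \<le> card B" using fin by (intro card_mono) auto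
    ultimately have "card (B - ?L) \<le> \<kappa>" by simp
    moreover have "card ?Q \<le> card (B - ?L)" using fin MB_mate(1) by (intro card_mono) auto
    ultimately have Q: "card ?Q \<le> \<kappa>" by linarith
    have "MB \<subseteq> {b\<in>MB. I a b} \<union> (?Q \<union> mateB ` ?Q)"
    proof
      fix b assume b: "b \<in> MB"
      show "b \<in> {b\<in>MB. I a b} \<union> (?Q \<union> mateB ` ?Q)"
      proof (cases "mateB b \<in> ?Q")
        case True
        then have "mateB (mateB b) \<in> mateB ` ?Q" by (rule imageI)
        then show ?thesis using MB_mate(4)[OF b] by simp
      next
        case False
        then show ?thesis using b MB_mate(6)[OF b] by (auto simp: I_def L_def)
      qed
    qed
    then have "card MB \<le> card ({b\<in>MB. I a b} \<union> (?Q \<union> mateB ` ?Q))" using fin by (intro card_mono) auto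
    also have "\<dots> \<le> card {b\<in>MB. I a b} + (card ?Q + card ?Q)"
      using fin by (intro order.trans[OF card_Un_le] add_mono order.refl card_image_le) auto
    finally show ?thesis using Q by linarith
  qed
  have "real (card MA) * (card MB - 2 * \<kappa>) = (\<Sum>a\<in>MA. card MB - 2 * \<kappa>)" by simp
  also have "\<dots> \<le> (\<Sum>a\<in>MA. real (card {b\<in>MB. I a b}))" using row by (rule sum_mono)
  also have "\<dots> = (\<Sum>a\<in>MA. \<Sum>b\<in>{b\<in>MB. I a b}. 1)" by simp
  also have "\<dots> = (\<Sum>b\<in>MB. \<Sum>a\<in>{a\<in>MA. I a b}. 1)" using fin by (intro sum.swap_restrict)
  also have "\<dots> = (\<Sum>b\<in>MB. real (card {a\<in>MA. I a b}))" by simp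
  also have "\<dots> \<le> (\<Sum>b\<in>MB. 2 * real (t - 1))"
  proof (rule sum_mono)
    fix b assume "b \<in> MB"
    then have "real (card {a\<in>MA. I a b}) \<le> real (2 * (t - 1))" using col by (simp only: of_nat_le_iff)
    then show "real (card {a\<in>MA. I a b}) \<le> 2 * real (t - 1)" by simp
  qed
  finally have le: "real (card MA) * (card MB - 2 * \<kappa>) \<le> card MB * (2 * real (t - 1))" by simp
  show ?thesis
  proof (rule ccontr)
    assume "\<not> ?thesis"
    then have "2 * t - 1 \<le> card MA" using t2 by simp
    then have "2 * real t - 1 \<le> card MA" using t2 by linarith
    moreover have pos: "0 \<le> card MB - 2 * \<kappa>"
    proof -
      have "2 * \<kappa> * 1 \<le> 2 * \<kappa> * (2 * t)" using \<kappa>_pos t2 by (intro mult_left_mono) auto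
      then show ?thesis using big by (simp add: mult_ac)
    qed
    ultimately have "(2 * real t - 1) * (card MB - 2 * \<kappa>) \<le> card MB * (2 * real (t - 1))"
      using le mult_right_mono[of "2 * real t - 1" "card MA" "card MB - 2 * \<kappa>"] by linarith
    then have "card MB \<le> (2 * real t - 1) * (2 * \<kappa>)" using t2 by (simp add: algebra_simps of_nat_diff)
    also have "\<dots> \<le> 4 * t * \<kappa>" using \<kappa>_pos by (simp add: algebra_simps)
    finally show False using big by simp
  qed
qed

end

section \<open>The count for both sides by symmetry\<close>

context matched_bipartition begin

interpretation sw: matched_bipartition V H t B A \<kappa>
  by (rule swapped)

lemma sw_simps: "sw.MA = MB" "sw.MB = MA" "sw.H' = H'"
  by (auto simp: sw.MA_def MB_def sw.MB_def MA_def sw.H'_def H'_def Un_commute)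

text \<open>If one matching has more than \<open>4 * t * \<kappa>\<close> vertices, the other one
  has at most \<open>2 * (t - 1)\<close> and the weighted count applies from its side. If both are
  small, choosing a matched vertex and a vertex of the other side already gives few enough
  hyperedges.\<close>

theorem card_H': "real (card H') \<le> card A * card B / 2 + (t - 1) * gain t"
proof -
  consider "4 * t * \<kappa> < card MB" | "4 * t * \<kappa> < card MA" | "card MA \<le> 4 * t * \<kappa>" "card MB \<le> 4 * t * \<kappa>"
    by linarith
  then show ?thesis
  proof cases
    case 1
    have "2 * card H' \<le> card A * card B + 2 * (t - 1) * gain t"
      by (rule card_H'_if_few_matched[OF few_matched_A[OF 1]])
    then have "real (2 * card H') \<le> real (card A * card B + 2 * (t - 1) * gain t)" by (simp only: of_nat_le_iff)
    then show ?thesis by simp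
  next
    case 2
    have "card sw.MA \<le> 2 * (t - 1)"
      using 2 by (intro sw.few_matched_A) (simp only: sw_simps)
    then have "2 * card sw.H' \<le> card B * card A + 2 * (t - 1) * gain t"
      by (rule sw.card_H'_if_few_matched)
    then have "2 * card H' \<le> card B * card A + 2 * (t - 1) * gain t"
      by (simp only: sw_simps)
    then have "real (2 * card H') \<le> real (card B * card A + 2 * (t - 1) * gain t)" by (simp only: of_nat_le_iff)
    then show ?thesis by (simp add: mult.commute)
  next
    case 3
    have "H' \<subseteq> (\<lambda>(a, b). {a, mateA a, b}) ` (MA \<times> B) \<union> (\<lambda>(a, b). {a, b, mateB b}) ` (A \<times> MB)"
    proof
      fix e assume "e \<in> H'"
      then show "e \<in> (\<lambda>(a, b). {a, mateA a, b}) ` (MA \<times> B) \<union> (\<lambda>(a, b). {a, b, mateB b}) ` (A \<times> MB)"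
        by (cases rule: H'_cases) auto
    qed
    then have "card H' \<le> card ((\<lambda>(a, b). {a, mateA a, b}) ` (MA \<times> B) \<union> (\<lambda>(a, b). {a, b, mateB b}) ` (A \<times> MB))"
      using fin by (intro card_mono) auto
    also have "\<dots> \<le> card (MA \<times> B) + card (A \<times> MB)"
      using fin by (intro order.trans[OF card_Un_le] add_mono card_image_le) auto
    finally have "real (card H') \<le> real (card MA) * card B + real (card A) * card MB"
      by (simp add: card_cartesian_product flip: of_nat_mult of_nat_add)
    also have "\<dots> \<le> (4 * t * \<kappa>) * card B + card A * (4 * t * \<kappa>)"
      using 3 by (intro add_mono mult_right_mono mult_left_mono) auto
    also have "\<dots> = 8 * t * \<kappa> * (card A + card B) / 2" by (simp add: algebra_simps)
    also have "\<dots> \<le> card A * card B / 2" using divide_right_mono[OF \<kappa>_small, of 2] by simp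
    finally show ?thesis by (smt (verit) of_nat_0_le_iff)
  qed
qed

end

section \<open>Vertices outside the core\<close>

text \<open>The real parameters z and h are small multiples of n, with z much smaller than h.\<close>

locale core_pair = book_free V H t
  for V :: "'a set" and H t +
  fixes A0 B0 :: "'a set" and z h :: real
  assumes A0V: "A0 \<subseteq> V" and B0V: "B0 \<subseteq> V" and disj0: "A0 \<inter> B0 = {}"
    and card_A0: "card V / 2 - z \<le> card A0" and card_B0: "card V / 2 - z \<le> card B0"
    and deg_A0: "a \<in> A0 \<Longrightarrow> card V / 2 - z \<le> card (N a \<inter> B0)"
    and deg_B0: "b \<in> B0 \<Longrightarrow> card V / 2 - z \<le> card (N b \<inter> A0)"
    and z: "6 * t + 10 \<le> z" and h: "1000 * t * z \<le> h" and n: "1000 * t * h \<le> card V"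
    and t2: "2 \<le> t"
begin

abbreviation "nn \<equiv> real (card V)"

lemma swapped: "core_pair V H t B0 A0 z h"
  by unfold_locales (use A0V B0V disj0 card_A0 card_B0 deg_A0 deg_B0 z h n t2 in auto)

lemma bounds: "0 < z" "2000 * z \<le> h" "2000 * h \<le> nn" "0 < h"
proof -
  show z0: "0 < z" using z by simp
  have "2000 * z \<le> 1000 * t * z" using t2 z0 by (intro mult_right_mono) auto
  then show hz: "2000 * z \<le> h" using h by linarith
  then show h0: "0 < h" using z0 by linarith
  have "2000 * h \<le> 1000 * t * h" using t2 h0 by (intro mult_right_mono) auto
  then show "2000 * h \<le> nn" using n by linarith
qed

lemma fin: "X \<subseteq> V \<Longrightarrow> finite X"
  using finite_V finite_subset by blast

lemma card_sum0: "real (card A0) + card B0 + card (V - (A0 \<union> B0)) = nn"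
proof -
  have "card (A0 \<union> B0) = card A0 + card B0" using fin A0V B0V disj0 by (intro card_Un_disjoint) auto
  moreover have "card (V - (A0 \<union> B0)) = card V - card (A0 \<union> B0)"
    using fin A0V B0V by (intro card_Diff_subset) auto
  moreover have "card (A0 \<union> B0) \<le> card V" using A0V B0V finite_V by (intro card_mono) auto
  ultimately show ?thesis by linarith
qed

lemma card_rest: "card (V - (A0 \<union> B0)) \<le> 2 * z"
  using card_sum0 card_A0 card_B0 by linarith

lemma card_B0_le: "card B0 \<le> nn / 2 + z"
  using card_sum0 card_A0 by linarith

text \<open>Inclusion-exclusion inside \<open>B0\<close>: all but \<open>3 * t\<close> of the common
  neighbours belong to \<open>D x y\<close>. One \<open>z\<close> pays for the size of
  \<open>B0\<close>, the other for \<open>3 * t\<close>.\<close>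

lemma card_D_lower:
  assumes "y \<in> N x"
  shows "real (card (N x \<inter> B0)) + card (N y \<inter> B0) - nn / 2 - 2 * z \<le> card (D x y \<inter> B0)"
proof -
  have "card (N x \<inter> B0) + card (N y \<inter> B0) = card (N x \<inter> B0 \<union> N y \<inter> B0) + card (N x \<inter> B0 \<inter> (N y \<inter> B0))"
    using finite_N by (intro card_Un_Int) auto
  moreover have "N x \<inter> B0 \<inter> (N y \<inter> B0) = N x \<inter> N y \<inter> B0" by auto
  moreover have "card (N x \<inter> B0 \<union> N y \<inter> B0) \<le> card B0" using fin B0V by (intro card_mono) auto
  ultimately have "card (N x \<inter> B0) + card (N y \<inter> B0) \<le> card B0 + (3 * t + card (D x y \<inter> B0))"
    using card_common_nbrs[OF assms, of B0] by simp
  then have "real (card (N x \<inter> B0)) + card (N y \<inter> B0) \<le> card B0 + (3 * t + card (D x y \<inter> B0))"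
    by linarith
  then show ?thesis using card_B0_le z by linarith
qed

text \<open>The side of \<open>A0\<close> enlarged by all vertices that are almost completely joined
  to \<open>B0\<close>; the tolerance \<open>h\<close> far exceeds the error \<open>z\<close> of the
  core.\<close>

definition A1 :: "'a set" where
  "A1 = {x\<in>V. nn / 2 - h \<le> card (N x \<inter> B0)}"

definition B1 :: "'a set" where
  "B1 = {x\<in>V. nn / 2 - h \<le> card (N x \<inter> A0)}"

lemma A0_A1: "A0 \<subseteq> A1" and B0_B1: "B0 \<subseteq> B1"
proof -
  show "A0 \<subseteq> A1" using A0V deg_A0 bounds by (fastforce simp: A1_def)
  show "B0 \<subseteq> B1" using B0V deg_B0 bounds by (fastforce simp: B1_def)
qed

lemma A1V: "A1 \<subseteq> V" and B1V: "B1 \<subseteq> V"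
  by (auto simp: A1_def B1_def)

text \<open>Two such neighbours would give two disjoint subsets of \<open>N x \<inter> B0\<close>,
  each missing at most \<open>h + 2 * z\<close> of it. This is impossible once the set has
  \<open>5 * h\<close> elements.\<close>

lemma unique_A1_nbr:
  assumes x: "5 * h \<le> card (N x \<inter> B0)" and y: "y \<in> N x" "y \<in> A1" and y': "y' \<in> N x" "y' \<in> A1"
  shows "y = y'"
proof (rule ccontr)
  assume "y \<noteq> y'"
  then have "card (D x y \<inter> B0) + card (D x y' \<inter> B0) \<le> card (N x \<inter> B0)" by (rule card_two_D)
  then have "real (card (D x y \<inter> B0)) + card (D x y' \<inter> B0) \<le> card (N x \<inter> B0)" by linarith
  moreover have "nn / 2 - h \<le> card (N y \<inter> B0)" "nn / 2 - h \<le> card (N y' \<inter> B0)"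
    using y y' by (auto simp: A1_def)
  ultimately show False
    using card_D_lower[OF y(1)] card_D_lower[OF y'(1)] x bounds by linarith
qed

lemma card_A1_nbrs:
  assumes "5 * h \<le> card (N x \<inter> B0)" shows "card (N x \<inter> A1) \<le> 1"
proof -
  have "finite (N x \<inter> A1)" using finite_N by simp
  then have "card (N x \<inter> A1) \<le> Suc 0"
    using unique_A1_nbr[OF assms] by (subst card_le_Suc0_iff_eq) auto
  then show ?thesis by simp
qed

text \<open>A vertex with many neighbours in \<open>B0\<close> has at most one neighbour in
  \<open>A1\<close>, which contains \<open>A0\<close>.\<close>

lemma not_both_sides:
  assumes "5 * h \<le> card (N x \<inter> B0)" "5 * h \<le> card (N x \<inter> A0)"
  shows False
proof -
  have "card (N x \<inter> A0) \<le> card (N x \<inter> A1)" using A0_A1 finite_N by (intro card_mono) auto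
  then have "real (card (N x \<inter> A0)) \<le> 1" using card_A1_nbrs[OF assms(1)] by linarith
  then show False using assms(2) bounds z by linarith
qed

lemma A1_deg: "x \<in> A1 \<Longrightarrow> 9 * h \<le> card (N x \<inter> B0)"
  using bounds by (simp add: A1_def)

lemma B1_deg: "x \<in> B1 \<Longrightarrow> 9 * h \<le> card (N x \<inter> A0)"
  using bounds by (simp add: B1_def)

lemma A1_B1: "A1 \<inter> B1 = {}"
proof -
  have False if "x \<in> A1" "x \<in> B1" for x
    using not_both_sides[of x] A1_deg[OF that(1)] B1_deg[OF that(2)] bounds by linarith
  then show ?thesis by blast
qed

text \<open>The exceptional vertices are those without a nearly full neighbourhood in A0 or B0. An
  exceptional vertex can form many hyperedges with its neighbour on the same side, so these
  neighbours PA and PB are removed along with the exceptional vertices. Each pair of an exceptional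
  vertex and such a neighbour still loses a linear number of hyperedges.\<close>

definition ZA :: "'a set" where
  "ZA = {x\<in>V - (A1 \<union> B1). 8 * h \<le> card (N x \<inter> B0)}"

definition ZB :: "'a set" where
  "ZB = {x\<in>V - (A1 \<union> B1). 8 * h \<le> card (N x \<inter> A0)}"

definition Z0 :: "'a set" where
  "Z0 = V - (A1 \<union> B1) - (ZA \<union> ZB)"

definition PA :: "'a set" where
  "PA = (\<Union>x\<in>ZA. N x \<inter> A1)"

definition PB :: "'a set" where
  "PB = (\<Union>x\<in>ZB. N x \<inter> B1)"

definition "SA = ZA \<union> PA"
definition "SB = ZB \<union> PB"
definition "A2 = A1 - PA"
definition "B2 = B1 - PB"
definition "S = SA \<union> SB \<union> Z0"

lemma ZA_ZB: "ZA \<inter> ZB = {}"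
proof -
  have False if "x \<in> ZA" "x \<in> ZB" for x
  proof (rule not_both_sides[of x])
    show "5 * h \<le> card (N x \<inter> B0)" "5 * h \<le> card (N x \<inter> A0)"
      using that bounds by (simp_all add: ZA_def ZB_def)
  qed
  then show ?thesis by blast
qed

lemma subsets: "ZA \<subseteq> V" "ZB \<subseteq> V" "Z0 \<subseteq> V" "PA \<subseteq> A1" "PB \<subseteq> B1" "A2 \<subseteq> A1" "B2 \<subseteq> B1"
  "SA \<subseteq> V" "SB \<subseteq> V" "S \<subseteq> V" "A2 \<subseteq> V" "B2 \<subseteq> V" "PA \<subseteq> V" "PB \<subseteq> V"
  using A1V B1V by (auto simp: ZA_def ZB_def Z0_def PA_def PB_def SA_def SB_def A2_def B2_def S_def)

lemma V_split: "V = S \<union> (A2 \<union> B2)" "S \<inter> (A2 \<union> B2) = {}" "A2 \<inter> B2 = {}"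
  "SA \<inter> SB = {}" "SA \<inter> Z0 = {}" "SB \<inter> Z0 = {}" "ZA \<inter> PA = {}" "SA \<inter> B2 = {}"
proof -
  show "V = S \<union> (A2 \<union> B2)" using subsets by (auto simp: S_def SA_def SB_def A2_def B2_def Z0_def)
  show "S \<inter> (A2 \<union> B2) = {}" "A2 \<inter> B2 = {}" "SA \<inter> SB = {}" "SA \<inter> Z0 = {}" "SB \<inter> Z0 = {}" "ZA \<inter> PA = {}" "SA \<inter> B2 = {}"
    using A1_B1 subsets(4,5) ZA_ZB
    by (auto simp: S_def SA_def SB_def A2_def B2_def Z0_def ZA_def ZB_def)
qed

lemma card_PA: "card PA \<le> card ZA"
proof -
  have "card PA \<le> (\<Sum>x\<in>ZA. card (N x \<inter> A1))"
    unfolding PA_def using fin subsets by (intro card_UN_le) auto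
  also have "\<dots> \<le> (\<Sum>x\<in>ZA. 1)"
  proof (rule sum_mono)
    fix x assume "x \<in> ZA"
    then show "card (N x \<inter> A1) \<le> 1" using bounds by (intro card_A1_nbrs) (simp add: ZA_def)
  qed
  finally show ?thesis by simp
qed

text \<open>For \<open>x\<close> in \<open>ZA\<close> this is the purpose of removing
  \<open>PA\<close>. A vertex of \<open>PA\<close> already shares about \<open>7 * h\<close>
  vertices of \<open>B0\<close> with an exceptional neighbour; a neighbour in \<open>A2\<close>
  would need almost all of \<open>B0\<close> in addition, disjointly.\<close>

lemma N_SA_A2:
  assumes x: "x \<in> SA" and y: "y \<in> A2" "y \<in> N x" shows False
proof (cases "x \<in> ZA")
  case True
  then show False using y by (auto simp: A2_def PA_def)
next
  case False
  then obtain w where w: "w \<in> ZA" "x \<in> N w" and xA: "x \<in> A1" using x by (auto simp: SA_def PA_def)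
  have wx: "w \<in> N x" using w N_sym by blast
  have wy: "w \<noteq> y" using w y by (auto simp: ZA_def A2_def)
  have "card (D x w \<inter> B0) + card (D x y \<inter> B0) \<le> card (N x \<inter> B0)" by (rule card_two_D[OF wy])
  also have "\<dots> \<le> card B0" using fin B0V by (intro card_mono) auto
  finally have "real (card (D x w \<inter> B0)) + card (D x y \<inter> B0) \<le> card B0" by linarith
  moreover have "nn / 2 - h \<le> card (N x \<inter> B0)" "nn / 2 - h \<le> card (N y \<inter> B0)" "8 * h \<le> card (N w \<inter> B0)"
    using xA y w by (auto simp: A1_def A2_def ZA_def)
  ultimately show False
    using card_D_lower[OF wx] card_D_lower[OF y(2)] card_B0_le bounds by linarith
qed

lemma B2_rest: "B2 \<subseteq> B0 \<union> (V - (A0 \<union> B0))"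
  using subsets A0_A1 A1_B1 by blast

lemma card_X_B2: "card (X \<inter> B2) \<le> card (X \<inter> B0) + 2 * z"
proof -
  have "card (X \<inter> B2) \<le> card ((X \<inter> B0) \<union> (V - (A0 \<union> B0)))"
    using B2_rest fin B0V finite_V by (intro card_mono) auto
  also have "\<dots> \<le> card (X \<inter> B0) + card (V - (A0 \<union> B0))" by (rule card_Un_le)
  finally show ?thesis using card_rest by linarith
qed

lemma card_B2_le: "card B2 \<le> nn / 2 + 3 * z"
  using card_X_B2[of UNIV] card_B0_le by simp

section \<open>Hyperedges between the exceptional vertices of one side and the other side\<close>

definition FA :: "'a set set" where
  "FA = {e\<in>H. e \<subseteq> SA \<union> B2 \<and> e \<inter> SA \<noteq> {} \<and> e \<inter> B2 \<noteq> {}}"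

text \<open>At most one of these hyperedges has its third vertex in \<open>B2\<close>, namely the
  mate of \<open>b\<close>. If there are at least two hyperedges and one has its third vertex
  \<open>y\<close> in \<open>SA\<close>, another one represents \<open>xb\<close> while this one
  represents \<open>yb\<close>, so \<open>b\<close> is good for \<open>x\<close>,
  \<open>y\<close>.\<close>

lemma card_FA_pair:
  assumes x: "x \<in> SA" and b: "b \<in> B2" and mate: "card (N b \<inter> B1) \<le> 1"
  shows "card {e\<in>FA. x \<in> e \<and> b \<in> e} \<le> (if b \<in> N x then 1 else 0) + card {y\<in>SA \<inter> N x. b \<in> good x y}"
proof -
  let ?E = "{e\<in>FA. x \<in> e \<and> b \<in> e}"
  let ?Y = "{y\<in>SA \<inter> N x. b \<in> good x y}"
  have xb: "x \<noteq> b" using x b V_split by auto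
  have fE: "finite ?E" using finite_H by (simp add: FA_def)
  have fY: "finite ?Y" using finite_N by simp
  show ?thesis
  proof (cases "?E = {}")
    case False
    then obtain e where "e \<in> H" "x \<in> e" "b \<in> e" by (auto simp: FA_def)
    then have bN: "b \<in> N x" using xb by (intro N_I)
    show ?thesis
    proof (cases "card ?E \<le> 1")
      case False
      define E1 where "E1 = {e\<in>?E. \<exists>c\<in>B2. c \<noteq> b \<and> e = {x, b, c}}"
      have fE1: "finite E1" by (rule finite_subset[OF _ fE]) (auto simp: E1_def)
      have E1: "card E1 \<le> Suc 0"
      proof (subst card_le_Suc0_iff_eq)
        show "finite E1" by (rule fE1)
        show "\<forall>e\<in>E1. \<forall>e'\<in>E1. e = e'"
        proof (intro ballI)
          fix e e' assume ee: "e \<in> E1" "e' \<in> E1"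
          then have "e \<in> H" "e' \<in> H" by (simp_all add: E1_def FA_def)
          moreover obtain c where "c \<in> B2" "e = {x, b, c}" using ee(1) unfolding E1_def by blast
          moreover obtain c' where "c' \<in> B2" "e' = {x, b, c'}" using ee(2) unfolding E1_def by blast
          ultimately have c: "c \<in> B2" "e = {x, b, c}" "{x, b, c} \<in> H" "c' \<in> B2" "e' = {x, b, c'}" "{x, b, c'} \<in> H"
            by simp_all
          then have "c \<in> N b \<inter> B1" "c' \<in> N b \<inter> B1" using edge_N subsets(7) by blast+
          moreover have "finite (N b \<inter> B1)" using finite_N by simp
          ultimately have "c = c'" using mate card_le_Suc0_iff_eq[of "N b \<inter> B1"] by auto
          then show "e = e'" using c by simp
        qed
      qed
      have "?E \<subseteq> E1 \<union> (\<lambda>y. {x, b, y}) ` ?Y"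
      proof
        fix e assume e: "e \<in> ?E"
        then have eH: "e \<in> H" "x \<in> e" "b \<in> e" and sub: "e \<subseteq> SA \<union> B2" by (auto simp: FA_def)
        obtain y where y: "e = {x, b, y}" "y \<noteq> x" "y \<noteq> b" by (rule edge_third[OF eH xb])
        show "e \<in> E1 \<union> (\<lambda>y. {x, b, y}) ` ?Y"
        proof (cases "y \<in> B2")
          case True then show ?thesis using e y by (auto simp: E1_def)
        next
          case False
          then have ySA: "y \<in> SA" using sub y by auto
          have yN: "y \<in> N x" using eH y by (intro N_I[of e]) auto
          have "\<not> ?E \<subseteq> {e}"
          proof
            assume "?E \<subseteq> {e}"
            then have "card ?E \<le> card {e}" by (intro card_mono) auto
            then show False using \<open>\<not> card ?E \<le> 1\<close> by simp
          qed
          then obtain e' where e': "e' \<in> H" "x \<in> e'" "b \<in> e'" "e' \<noteq> e" by (auto simp: FA_def)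
          have "y \<in> e" using y(1) by simp
          then have "\<exists>p\<in>H. \<exists>q\<in>H. p \<noteq> q \<and> x \<in> p \<and> b \<in> p \<and> y \<in> q \<and> b \<in> q"
            using e' eH by (intro bexI[OF _ e'(1)] bexI[OF _ eH(1)] conjI)
          then have "b \<in> good x y" using xb y(3) by (simp add: good_def)
          then show ?thesis using ySA yN y by auto
        qed
      qed
      then have "card ?E \<le> card (E1 \<union> (\<lambda>y. {x, b, y}) ` ?Y)"
        using fE1 fY by (intro card_mono) auto
      also have "\<dots> \<le> card E1 + card ?Y"
        by (intro order.trans[OF card_Un_le] add_mono order.refl card_image_le fY)
      finally show ?thesis using E1 bN by simp
    qed (use bN in simp)
  next
    case True
    then have "card ?E = 0" by (simp only: card.empty)
    then show ?thesis by linarith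
  qed
qed

text \<open>A hyperedge of \<open>FA\<close> is split 1 + 2 or 2 + 1 between \<open>SA\<close> and
  \<open>B2\<close>, so it contains exactly two cross pairs. The good terms add up to at most
  \<open>3 * t\<close> for each ordered pair in \<open>SA\<close>.\<close>

lemma card_FA:
  assumes mate: "\<And>b. b \<in> B2 \<Longrightarrow> card (N b \<inter> B1) \<le> 1"
  shows "2 * card FA \<le> (\<Sum>x\<in>SA. card (N x \<inter> B2)) + 3 * t * (card SA)\<^sup>2"
proof -
  have fS: "finite SA" "finite B2" using fin subsets by auto
  have fFA: "finite FA" using finite_H by (simp add: FA_def)
  have two: "2 \<le> card ((e \<inter> SA) \<times> (e \<inter> B2))" if e: "e \<in> FA" for e
  proof -
    have eH: "e \<in> H" "e \<subseteq> SA \<union> B2" "e \<inter> SA \<noteq> {}" "e \<inter> B2 \<noteq> {}" using e by (auto simp: FA_def)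
    have fe: "finite e" using edge_subset[OF eH(1)] by (rule fin)
    have "e = (e \<inter> SA) \<union> (e \<inter> B2)" using eH by auto
    moreover have "card ((e \<inter> SA) \<union> (e \<inter> B2)) = card (e \<inter> SA) + card (e \<inter> B2)"
      using fe V_split by (intro card_Un_disjoint) auto
    ultimately have "card (e \<inter> SA) + card (e \<inter> B2) = 3" using edge_card[OF eH(1)] by simp
    moreover have "card (e \<inter> SA) > 0" "card (e \<inter> B2) > 0" using fe eH by (auto simp: card_gt_0_iff)
    ultimately have "card (e \<inter> SA) = 1 \<and> card (e \<inter> B2) = 2 \<or> card (e \<inter> SA) = 2 \<and> card (e \<inter> B2) = 1" by linarith
    then show ?thesis by (auto simp: card_cartesian_product)
  qed
  have "2 * card FA = (\<Sum>e\<in>FA. 2)" by simp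
  also have "\<dots> \<le> (\<Sum>e\<in>FA. card ((e \<inter> SA) \<times> (e \<inter> B2)))" using two by (rule sum_mono)
  also have "\<dots> = (\<Sum>e\<in>FA. \<Sum>p\<in>{p\<in>SA \<times> B2. fst p \<in> e \<and> snd p \<in> e}. 1)"
    by (intro sum.cong refl) (auto intro!: arg_cong[where f = card])
  also have "\<dots> = (\<Sum>p\<in>SA \<times> B2. \<Sum>e\<in>{e\<in>FA. fst p \<in> e \<and> snd p \<in> e}. 1)"
    using fS fFA by (intro sum.swap_restrict) auto
  also have "\<dots> = (\<Sum>x\<in>SA. \<Sum>b\<in>B2. card {e\<in>FA. x \<in> e \<and> b \<in> e})"
    by (simp add: sum.cartesian_product case_prod_unfold)
  also have "\<dots> \<le> (\<Sum>x\<in>SA. \<Sum>b\<in>B2. (if b \<in> N x then 1 else 0) + card {y\<in>SA \<inter> N x. b \<in> good x y})"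
    by (intro sum_mono card_FA_pair mate)
  also have "\<dots> = (\<Sum>x\<in>SA. card (N x \<inter> B2)) + (\<Sum>x\<in>SA. \<Sum>b\<in>B2. card {y\<in>SA \<inter> N x. b \<in> good x y})"
    using fS by (simp add: sum.distrib sum.If_cases Int_commute)
  also have "(\<Sum>x\<in>SA. \<Sum>b\<in>B2. card {y\<in>SA \<inter> N x. b \<in> good x y}) \<le> (\<Sum>x\<in>SA. 3 * t * card SA)"
  proof (rule sum_mono)
    fix x
    have "(\<Sum>b\<in>B2. card {y\<in>SA \<inter> N x. b \<in> good x y}) = (\<Sum>b\<in>B2. \<Sum>y\<in>{y\<in>SA \<inter> N x. b \<in> good x y}. 1)" by simp
    also have "\<dots> = (\<Sum>y\<in>SA \<inter> N x. \<Sum>b\<in>{b\<in>B2. b \<in> good x y}. 1)"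
      using fS by (intro sum.swap_restrict) auto
    also have "\<dots> \<le> (\<Sum>y\<in>SA \<inter> N x. 3 * t)"
    proof (rule sum_mono)
      fix y assume "y \<in> SA \<inter> N x"
      then have "card (good x y) \<le> 3 * t" by (intro card_good) auto
      moreover have "card {b\<in>B2. b \<in> good x y} \<le> card (good x y)" using finite_good by (intro card_mono) auto
      ultimately show "(\<Sum>b\<in>{b\<in>B2. b \<in> good x y}. 1) \<le> 3 * t" by simp
    qed
    also have "\<dots> = 3 * t * card (SA \<inter> N x)" by simp
    also have "\<dots> \<le> 3 * t * card SA" using fS by (intro mult_left_mono card_mono) auto
    finally show "(\<Sum>b\<in>B2. card {y\<in>SA \<inter> N x. b \<in> good x y}) \<le> 3 * t * card SA" .
  qed
  finally show ?thesis by (simp add: power2_eq_square algebra_simps)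
qed

text \<open>A vertex of \<open>ZA\<close> misses \<open>h\<close> neighbours, a vertex of
  \<open>PA\<close> possibly none. As \<open>PA\<close> is no larger than \<open>ZA\<close>, the
  average loss over \<open>SA\<close> is still \<open>h / 2\<close>.\<close>

lemma card_FA_bound:
  assumes mate: "\<And>b. b \<in> B2 \<Longrightarrow> card (N b \<inter> B1) \<le> 1"
  shows "2 * real (card FA) \<le> card SA * (nn / 2 + 3 * z - h / 2) + 3 * t * (real (card SA))\<^sup>2"
proof -
  have f: "finite ZA" "finite PA" using fin subsets by auto
  have SA: "card SA = card ZA + card PA" unfolding SA_def using f V_split by (intro card_Un_disjoint)
  have "(\<Sum>x\<in>SA. real (card (N x \<inter> B2))) = (\<Sum>x\<in>ZA. real (card (N x \<inter> B2))) + (\<Sum>x\<in>PA. real (card (N x \<inter> B2)))"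
    unfolding SA_def using f V_split by (intro sum.union_disjoint)
  also have "\<dots> \<le> (\<Sum>x\<in>ZA. nn / 2 - h + 2 * z) + (\<Sum>x\<in>PA. nn / 2 + 3 * z)"
  proof (intro add_mono sum_mono)
    fix x assume "x \<in> ZA"
    then have "card (N x \<inter> B0) < nn / 2 - h" by (auto simp: ZA_def A1_def)
    then show "real (card (N x \<inter> B2)) \<le> nn / 2 - h + 2 * z" using card_X_B2[of "N x"] by linarith
  next
    fix x
    have "card (N x \<inter> B2) \<le> card B2" using fin subsets by (intro card_mono) auto
    then show "real (card (N x \<inter> B2)) \<le> nn / 2 + 3 * z" using card_B2_le by linarith
  qed
  also have "\<dots> = card ZA * (nn / 2 - h + 2 * z) + card PA * (nn / 2 + 3 * z)" by simp
  also have "\<dots> \<le> card SA * (nn / 2 + 3 * z - h / 2)"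
  proof -
    have "real (card PA) * h \<le> real (card ZA) * h" using card_PA bounds by (intro mult_right_mono) auto
    moreover have "0 \<le> real (card ZA) * z" using bounds by simp
    ultimately show ?thesis by (simp add: SA algebra_simps)
  qed
  finally have s: "(\<Sum>x\<in>SA. real (card (N x \<inter> B2))) \<le> card SA * (nn / 2 + 3 * z - h / 2)" .
  have "real (2 * card FA) \<le> real ((\<Sum>x\<in>SA. card (N x \<inter> B2)) + 3 * t * (card SA)\<^sup>2)"
    using card_FA[OF mate] by (simp only: of_nat_le_iff)
  then show ?thesis using s by simp
qed

text \<open>The two degree defects give \<open>2 * h\<close>; the removal of \<open>PB\<close> and
  the core errors cost only multiples of \<open>z\<close>, which fit into the third
  \<open>h\<close>.\<close>

lemma codegree_A2:
  assumes a: "a \<in> A2" and a': "a' \<in> N a \<inter> A2" and PB: "card PB \<le> 2 * z"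
  shows "card B2 - 3 * h \<le> card (L a a' \<inter> B2)"
proof -
  have "D a a' \<inter> B0 \<subseteq> (L a a' \<inter> B2) \<union> PB" using D_subset[of a a'] B0_B1 by (auto simp: B2_def)
  then have "card (D a a' \<inter> B0) \<le> card ((L a a' \<inter> B2) \<union> PB)"
    using fin subsets by (intro card_mono) auto
  also have "\<dots> \<le> card (L a a' \<inter> B2) + card PB" by (rule card_Un_le)
  finally have "real (card (D a a' \<inter> B0)) \<le> card (L a a' \<inter> B2) + 2 * z" using PB by linarith
  moreover have "nn / 2 - h \<le> card (N a \<inter> B0)" "nn / 2 - h \<le> card (N a' \<inter> B0)"
    using a a' by (auto simp: A1_def A2_def)
  ultimately show ?thesis using card_D_lower[of a' a] a' card_B2_le bounds by auto
qed

lemma card_A2_lower: "nn / 2 - 3 * z \<le> card A2"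
proof -
  have "ZA \<subseteq> V - (A0 \<union> B0)" using A0_A1 B0_B1 by (auto simp: ZA_def)
  then have "card ZA \<le> card (V - (A0 \<union> B0))" using finite_V by (intro card_mono) auto
  then have PA: "card PA \<le> 2 * z" using card_PA card_rest by linarith
  have "card A0 - card PA \<le> card (A0 - PA)" using fin subsets by (intro diff_card_le_card_Diff) auto
  also have "\<dots> \<le> card A2" using A0_A1 fin subsets by (intro card_mono) (auto simp: A2_def)
  finally show ?thesis using PA card_A0 by linarith
qed

end

section \<open>Both sides together, and the final upper bound\<close>

context core_pair begin

interpretation sw: core_pair V H t B0 A0 z h
  by (rule swapped)

lemma sw_simps: "sw.A1 = B1" "sw.B1 = A1" "sw.ZA = ZB" "sw.ZB = ZA" "sw.PA = PB" "sw.PB = PA"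
  "sw.SA = SB" "sw.A2 = B2" "sw.B2 = A2"
proof -
  show 1: "sw.A1 = B1" "sw.B1 = A1" by (auto simp: sw.A1_def B1_def sw.B1_def A1_def)
  show 2: "sw.ZA = ZB" "sw.ZB = ZA"
    unfolding sw.ZA_def ZB_def sw.ZB_def ZA_def 1 by auto
  show 3: "sw.PA = PB" "sw.PB = PA"
    unfolding sw.PA_def PB_def sw.PB_def PA_def 1 2 by auto
  show "sw.SA = SB" "sw.A2 = B2" "sw.B2 = A2"
    unfolding sw.SA_def SB_def sw.A2_def B2_def sw.B2_def A2_def 1 2 3 by auto
qed

definition FB :: "'a set set" where
  "FB = {e\<in>H. e \<subseteq> SB \<union> A2 \<and> e \<inter> SB \<noteq> {} \<and> e \<inter> A2 \<noteq> {}}"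

lemma mate_B1: "b \<in> B1 \<Longrightarrow> card (N b \<inter> B1) \<le> 1"
  using sw.card_A1_nbrs[of b] B1_deg[of b] bounds by (simp add: sw_simps)

lemma mate_A1: "a \<in> A1 \<Longrightarrow> card (N a \<inter> A1) \<le> 1"
  using card_A1_nbrs[of a] A1_deg[of a] bounds by simp

lemma N_SB_B2: "x \<in> SB \<Longrightarrow> y \<in> B2 \<Longrightarrow> y \<in> N x \<Longrightarrow> False"
  using sw.N_SA_A2[of x y] by (simp add: sw_simps)

lemma card_FB_bound:
  "2 * real (card FB) \<le> card SB * (nn / 2 + 3 * z - h / 2) + 3 * t * (real (card SB))\<^sup>2"
proof -
  have "sw.FA = FB" by (simp add: sw.FA_def FB_def sw_simps)
  moreover have "card (N b \<inter> A1) \<le> 1" if "b \<in> A2" for b using that mate_A1 subsets by blast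
  ultimately show ?thesis using sw.card_FA_bound by (simp add: sw_simps)
qed

lemma card_Z: "card ZA + card ZB + card Z0 \<le> 2 * z"
proof -
  have f: "finite ZA" "finite ZB" "finite Z0" using fin subsets by auto
  have "card (ZA \<union> ZB \<union> Z0) = card ZA + card ZB + card Z0"
    using f ZA_ZB by (subst card_Un_disjoint; auto simp: card_Un_disjoint Z0_def)+
  moreover have "ZA \<union> ZB \<union> Z0 \<subseteq> V - (A0 \<union> B0)" using A0_A1 B0_B1 by (auto simp: ZA_def ZB_def Z0_def)
  then have "card (ZA \<union> ZB \<union> Z0) \<le> card (V - (A0 \<union> B0))" using finite_V by (intro card_mono) auto
  ultimately show ?thesis using card_rest by linarith
qed

lemma card_PB: "card PB \<le> card ZB"
  using sw.card_PA by (simp add: sw_simps)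

lemma card_S: "card S = card SA + card SB + card Z0" "card S \<le> 4 * z"
proof -
  have f: "finite SA" "finite SB" "finite Z0" using fin subsets by auto
  show eq: "card S = card SA + card SB + card Z0"
    unfolding S_def using f V_split(4-6) by (subst card_Un_disjoint; auto simp: card_Un_disjoint)+
  have "card SA \<le> card ZA + card PA" "card SB \<le> card ZB + card PB"
    unfolding SA_def SB_def by (rule card_Un_le)+
  then show "card S \<le> 4 * z" using eq card_Z card_PA card_PB by linarith
qed

text \<open>These vertices have few neighbours on both sides, hence shadow degree at most
  \<open>17 * h\<close>, and the number of hyperedges at a vertex is linear in its degree.\<close>

lemma card_edges_Z0:
  assumes "x \<in> Z0" shows "card {e\<in>H. x \<in> e} \<le> nn / 8"
proof -
  have x: "x \<in> V" "card (N x \<inter> B0) < 8 * h" "card (N x \<inter> A0) < 8 * h"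
    using assms by (auto simp: Z0_def ZA_def ZB_def)
  have "N x \<subseteq> (N x \<inter> A0) \<union> (N x \<inter> B0) \<union> (V - (A0 \<union> B0))" using N_subset by blast
  then have "card (N x) \<le> card ((N x \<inter> A0) \<union> (N x \<inter> B0) \<union> (V - (A0 \<union> B0)))"
    using finite_N finite_V by (intro card_mono) auto
  also have "\<dots> \<le> card (N x \<inter> A0) + card (N x \<inter> B0) + card (V - (A0 \<union> B0))"
    by (intro order.trans[OF card_Un_le] add_mono order.refl)
  finally have N: "card (N x) \<le> 17 * h" using x card_rest bounds by linarith
  have "{e\<in>H. x \<in> e} = {e\<in>H. x \<in> e \<and> e \<subseteq> insert x V}" using edge_subset by auto
  then have "card {e\<in>H. x \<in> e} \<le> (3 * t + 1) * card (N x \<inter> V)" using card_edges_at[of x V] by simp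
  moreover have "N x \<inter> V = N x" using N_subset by auto
  ultimately have "real (card {e\<in>H. x \<in> e}) \<le> real ((3 * t + 1) * card (N x))" by (simp only: of_nat_le_iff)
  also have "\<dots> \<le> (4 * real t) * (17 * h)" unfolding of_nat_mult using N t2 bounds by (intro mult_mono) auto
  also have "\<dots> \<le> nn / 8"
  proof -
    have "0 \<le> t * h" using bounds by simp
    then show ?thesis using n by simp
  qed
  finally show ?thesis .
qed

text \<open>By \<open>N_SA_A2\<close> and \<open>N_SB_B2\<close>, a hyperedge that meets
  \<open>S\<close> but neither meets \<open>Z0\<close> nor lies inside \<open>S\<close> belongs to
  \<open>FA\<close> or \<open>FB\<close>. The bound stays below n/4 for each vertex of
  \<open>S\<close>, the amount by which n^2/8 drops to first order when a vertex is deleted.\<close>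

lemma card_touching:
  "real (card {e\<in>H. e \<inter> S \<noteq> {}}) \<le> card S * (nn / 4 - h / 8)"
proof -
  let ?E0 = "\<Union>x\<in>Z0. {e\<in>H. x \<in> e}" let ?ES = "\<Union>x\<in>S. {e\<in>H. x \<in> e \<and> e \<subseteq> insert x S}"
  have f: "finite Z0" "finite S" using fin subsets by auto
  have "{e\<in>H. e \<inter> S \<noteq> {}} \<subseteq> ?E0 \<union> ?ES \<union> FA \<union> FB"
  proof
    fix e assume "e \<in> {e\<in>H. e \<inter> S \<noteq> {}}"
    then have e: "e \<in> H" "e \<inter> S \<noteq> {}" by auto
    have adj: "y \<in> N x" if "x \<in> e" "y \<in> e" "x \<noteq> y" for x y using N_I[OF e(1)] that by blast
    show "e \<in> ?E0 \<union> ?ES \<union> FA \<union> FB"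
    proof (cases "e \<inter> Z0 = {} \<and> \<not> e \<subseteq> S")
      case False
      then show ?thesis using e by blast
    next
      case True
      then obtain c where c: "c \<in> e" "c \<notin> S" by auto
      obtain s where s: "s \<in> e" "s \<in> S" using e by auto
      have ss: "s \<in> SA \<or> s \<in> SB" using s True by (auto simp: S_def)
      have cc: "c \<in> A2 \<or> c \<in> B2" using c edge_subset[OF e(1)] V_split(1) by auto
      have eV: "w \<in> SA \<or> w \<in> SB \<or> w \<in> A2 \<or> w \<in> B2" if "w \<in> e" for w
        using that edge_subset[OF e(1)] V_split(1) True by (auto simp: S_def)
      have nA: False if "x \<in> SA" "y \<in> A2" "x \<in> e" "y \<in> e" for x y
        using N_SA_A2[OF that(1,2)] adj that V_split(2) by (auto simp: S_def)
      have nB: False if "x \<in> SB" "y \<in> B2" "x \<in> e" "y \<in> e" for x y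
        using N_SB_B2[OF that(1,2)] adj that V_split(2) by (auto simp: S_def)
      show ?thesis
      proof (cases "c \<in> B2")
        case cB: True
        then have sA: "s \<in> SA" using ss nB s c by blast
        have "e \<subseteq> SA \<union> B2" using eV nA[OF sA _ s(1)] nB[OF _ cB _ c(1)] by blast
        then have "e \<in> FA" using e(1) sA s(1) cB c(1) by (auto simp: FA_def)
        then show ?thesis by simp
      next
        case False
        then have cA: "c \<in> A2" using cc by simp
        then have sB: "s \<in> SB" using ss nA s c by blast
        have "e \<subseteq> SB \<union> A2" using eV nB[OF sB _ s(1)] nA[OF _ cA _ c(1)] by blast
        then have "e \<in> FB" using e(1) sB s(1) cA c(1) by (auto simp: FB_def)
        then show ?thesis by simp
      qed
    qed
  qed
  then have "card {e\<in>H. e \<inter> S \<noteq> {}} \<le> card (?E0 \<union> ?ES \<union> FA \<union> FB)"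
    using finite_H f by (intro card_mono) (auto simp: FA_def FB_def)
  also have "\<dots> \<le> card ?E0 + card ?ES + card FA + card FB"
    by (intro order.trans[OF card_Un_le] add_mono order.refl)
  finally have tot: "real (card {e\<in>H. e \<inter> S \<noteq> {}}) \<le> card ?E0 + card ?ES + card FA + card FB" by linarith
  define s where "s = real (card S)"
  have s: "0 \<le> s" "s \<le> 4 * z" using card_S by (auto simp: s_def)
  have ss: "s = card SA + card SB + card Z0" using card_S(1) by (simp add: s_def)
  have "card ?E0 \<le> (\<Sum>x\<in>Z0. card {e\<in>H. x \<in> e})" by (rule card_UN_le[OF f(1)])
  then have "real (card ?E0) \<le> (\<Sum>x\<in>Z0. real (card {e\<in>H. x \<in> e}))" by (simp flip: of_nat_sum)
  also have "\<dots> \<le> (\<Sum>x\<in>Z0. nn / 8)" using card_edges_Z0 by (rule sum_mono)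
  finally have E0: "real (card ?E0) \<le> card Z0 * (nn / 8)" by simp
  have "card ?ES \<le> (\<Sum>x\<in>S. card {e\<in>H. x \<in> e \<and> e \<subseteq> insert x S})" by (rule card_UN_le[OF f(2)])
  also have "\<dots> \<le> (\<Sum>x\<in>S. (3 * t + 1) * card S)"
  proof (rule sum_mono)
    fix x
    have "card {e\<in>H. x \<in> e \<and> e \<subseteq> insert x S} \<le> (3 * t + 1) * card (N x \<inter> S)" by (rule card_edges_at)
    also have "\<dots> \<le> (3 * t + 1) * card S" using f by (intro mult_left_mono card_mono) auto
    finally show "card {e\<in>H. x \<in> e \<and> e \<subseteq> insert x S} \<le> (3 * t + 1) * card S" .
  qed
  finally have "card ?ES \<le> (3 * t + 1) * (card S * card S)" by (simp add: algebra_simps)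
  then have "real (card ?ES) \<le> real ((3 * t + 1) * (card S * card S))" by (simp only: of_nat_le_iff)
  then have ES: "real (card ?ES) \<le> (3 * t + 1) * (s * s)" by (simp add: s_def algebra_simps)
  have FA: "2 * real (card FA) \<le> card SA * (nn / 2 + 3 * z - h / 2) + 3 * t * (real (card SA))\<^sup>2"
    using card_FA_bound mate_B1 subsets by blast
  have sq: "(real (card SA))\<^sup>2 + (real (card SB))\<^sup>2 \<le> s * s"
    unfolding ss power2_eq_square by (simp add: algebra_simps)
  have sq': "3 * t * (real (card SA))\<^sup>2 + 3 * t * (real (card SB))\<^sup>2 \<le> 3 * t * (s * s)"
    using mult_left_mono[OF sq, of "3 * t"] by (simp add: algebra_simps)
  have "2 * (real (card FA) + card FB) \<le> (real (card SA) + card SB) * (nn / 2 + 3 * z - h / 2) + 3 * t * (s * s)"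
    using FA card_FB_bound sq' by (simp add: algebra_simps)
  moreover have "card Z0 * (nn / 4) \<le> card Z0 * (nn / 2 + 3 * z - h / 2)"
    using bounds by (intro mult_left_mono) auto
  ultimately have "2 * (real (card FA) + card FB) + card Z0 * (nn / 4) \<le> s * (nn / 2 + 3 * z - h / 2) + 3 * t * (s * s)"
    unfolding ss by (simp add: algebra_simps)
  then have "real (card {e\<in>H. e \<inter> S \<noteq> {}}) \<le> s * (nn / 4 + 3 / 2 * z - h / 4) + 3 / 2 * t * (s * s) + (3 * t + 1) * (s * s)"
    using tot E0 ES by (simp add: algebra_simps)
  \<comment> \<open>The terms quadratic in \<open>s\<close> become linear through
    \<open>s \<le> 4 * z\<close>; the result is far below the gain \<open>s * h / 8\<close>.\<close>
  also have "\<dots> \<le> s * (nn / 4 + 3 / 2 * z - h / 4) + s * (20 * t * z)"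
  proof -
    have "3 / 2 * t * (s * s) + (3 * t + 1) * (s * s) = (9 / 2 * t + 1) * (s * s)" by (simp add: algebra_simps)
    also have "\<dots> \<le> (5 * t) * (s * (4 * z))" using t2 s by (intro mult_mono mult_left_mono) auto
    finally show ?thesis by (simp add: algebra_simps)
  qed
  also have "\<dots> = s * (nn / 4 + 3 / 2 * z - h / 4 + 20 * t * z)" by (simp add: algebra_simps)
  also have "\<dots> \<le> s * (nn / 4 - h / 8)"
  proof (rule mult_left_mono)
    show "nn / 4 + 3 / 2 * z - h / 4 + 20 * t * z \<le> nn / 4 - h / 8" using h bounds by linarith
  qed (use s in simp)
  finally show ?thesis by (simp add: s_def)
qed

lemma matched: "matched_bipartition V H t A2 B2 (3 * h)"
proof -
  have PB: "card PB \<le> 2 * z" "card PA \<le> 2 * z" using card_PA card_PB card_Z by linarith+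
  have l: "nn / 2 - 3 * z \<le> card A2" "nn / 2 - 3 * z \<le> card B2"
    using card_A2_lower sw.card_A2_lower by (simp_all add: sw_simps)
  have u: "card B2 \<le> nn / 2 + 3 * z" "card A2 \<le> nn / 2 + 3 * z"
    using card_B2_le sw.card_B2_le by (simp_all add: sw_simps)
  have th: "0 \<le> t * h" using bounds by simp
  have "real (card A2) + card B2 \<le> 2 * nn" using u bounds by linarith
  then have "8 * t * (3 * h) * (real (card A2) + card B2) \<le> 8 * t * (3 * h) * (2 * nn)"
    using bounds by (intro mult_left_mono) auto
  also have "\<dots> \<le> (nn / 10) * nn"
  proof -
    have "48 * t * h * nn \<le> (nn / 10) * nn" using n th by (intro mult_right_mono) auto
    then show ?thesis by simp
  qed
  also have "\<dots> \<le> (nn / 3) * (nn / 3)" by simp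
  also have "\<dots> \<le> card A2 * card B2" unfolding of_nat_mult using l bounds by (intro mult_mono) auto
  finally have small: "8 * t * (3 * h) * (real (card A2) + card B2) \<le> card A2 * card B2" .
  have mA: "card (N a \<inter> A2) \<le> 1" if "a \<in> A2" for a
  proof -
    have "card (N a \<inter> A2) \<le> card (N a \<inter> A1)" using finite_N subsets by (intro card_mono) auto
    moreover have "card (N a \<inter> A1) \<le> 1" using that mate_A1 subsets by blast
    ultimately show ?thesis by linarith
  qed
  have mB: "card (N b \<inter> B2) \<le> 1" if "b \<in> B2" for b
  proof -
    have "card (N b \<inter> B2) \<le> card (N b \<inter> B1)" using finite_N subsets by (intro card_mono) auto
    moreover have "card (N b \<inter> B1) \<le> 1" using that mate_B1 subsets by blast
    ultimately show ?thesis by linarith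
  qed
  have cA: "card B2 - 3 * h \<le> card (L a a' \<inter> B2)" if "a \<in> A2" "a' \<in> N a \<inter> A2" for a a'
    using codegree_A2[OF that] PB by simp
  have cB: "card A2 - 3 * h \<le> card (L b b' \<inter> A2)" if "b \<in> B2" "b' \<in> N b \<inter> B2" for b b'
    using sw.codegree_A2[of b b'] that PB by (simp add: sw_simps)
  have la: "t + 3 + 3 * h \<le> card A2" "t + 3 + 3 * h \<le> card B2" using l bounds z by linarith+
  show ?thesis
    by unfold_locales (use subsets V_split(3) bounds t2 mA mB cA cB la small in auto)
qed

text \<open>Hyperedges avoiding \<open>S\<close> are counted by the matched bipartition. With s =
  |S| the two bounds add up to n^2/8 + s(s - h)/8 plus the excess, and s is at most
  \<open>4 * z\<close>, well below \<open>h\<close>.\<close>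

theorem card_H_bound: "real (card H) \<le> nn\<^sup>2 / 8 + (t - 1) * gain t"
proof -
  interpret mb: matched_bipartition V H t A2 B2 "3 * h" by (rule matched)
  have "H = {e\<in>H. e \<inter> S \<noteq> {}} \<union> mb.H'"
    using edge_subset V_split(1,2) by (fastforce simp: mb.H'_def)
  then have "card H \<le> card {e\<in>H. e \<inter> S \<noteq> {}} + card mb.H'" by (metis card_Un_le)
  then have "real (card H) \<le> card {e\<in>H. e \<inter> S \<noteq> {}} + real (card mb.H')" by linarith
  also have "\<dots> \<le> card S * (nn / 4 - h / 8) + (card A2 * card B2 / 2 + (t - 1) * gain t)"
    using card_touching mb.card_H' by linarith
  finally have le: "real (card H) \<le> card S * (nn / 4 - h / 8) + (card A2 * card B2 / 2 + (t - 1) * gain t)" .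
  define s where "s = real (card S)"
  have s: "0 \<le> s" "s \<le> h" using card_S bounds by (auto simp: s_def)
  have f: "finite S" "finite A2" "finite B2" using fin subsets by auto
  have "card V = card S + (card A2 + card B2)"
    using f V_split(1,2,3) by (metis card_Un_disjoint finite_UnI)
  then have sum: "real (card A2) + card B2 = nn - s" by (simp add: s_def)
  have "4 * (real (card A2) * card B2) \<le> (real (card A2) + card B2)\<^sup>2"
    using zero_le_power2[of "real (card A2) - card B2"] by (simp add: power2_eq_square algebra_simps)
  then have "card A2 * card B2 / 2 \<le> (nn - s)\<^sup>2 / 8" unfolding sum by simp
  moreover have "s * (nn / 4 - h / 8) + (nn - s)\<^sup>2 / 8 = nn\<^sup>2 / 8 + s * (s - h) / 8"
    by (simp add: power2_eq_square field_simps)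
  moreover have "s * (s - h) \<le> 0" using s by (simp add: mult_nonneg_nonpos)
  ultimately show ?thesis using le unfolding s_def by linarith
qed

end

theorem upper_bound:
  assumes t2: "2 \<le> t"
  shows "\<exists>n0. \<forall>(V::'a set) H. book_free V H t \<longrightarrow> n0 \<le> card V \<longrightarrow>
    card H \<le> (card V)\<^sup>2 div 8 + (t - 1) * gain t"
proof -
  \<comment> \<open>The scales are h = \<open>\<theta>\<close> n and z = \<open>\<zeta>\<close> n,
    with the two ratios required by \<open>core_pair\<close> attained exactly.\<close>
  define \<theta> where "\<theta> = 1 / (1000 * real t)"
  define \<zeta> where "\<zeta> = \<theta> / (1000 * real t)"
  have pos: "0 < \<theta>" "0 < \<zeta>" using t2 by (auto simp: \<theta>_def \<zeta>_def)
  have mul: "1000 * t * \<theta> = 1" "1000 * t * \<zeta> = \<theta>" using t2 by (auto simp: \<theta>_def \<zeta>_def)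
  obtain n1 where n1: "\<forall>(V::'a set) H. book_free V H t \<longrightarrow> n1 \<le> card V \<longrightarrow> (card V)\<^sup>2 / 8 \<le> card H \<longrightarrow>
    (\<exists>A B. A \<subseteq> V \<and> B \<subseteq> V \<and> A \<inter> B = {} \<and>
      (1 / 2 - \<zeta>) * card V \<le> card A \<and> (1 / 2 - \<zeta>) * card V \<le> card B \<and>
      (\<forall>a\<in>A. (1 / 2 - \<zeta>) * card V \<le> card (book_free.N H a \<inter> B)) \<and>
      (\<forall>b\<in>B. (1 / 2 - \<zeta>) * card V \<le> card (book_free.N H b \<inter> A)))"
    using core_structure[OF pos(2), of t, where 'a = 'a] by (elim exE)
  obtain n2 :: nat where n2: "(6 * t + 10) / \<zeta> \<le> n2" using real_arch_simple by blast
  show ?thesis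
  proof (intro exI[of _ "max n1 n2"] allI impI)
    fix V :: "'a set" and H
    assume bf: "book_free V H t" and n: "max n1 n2 \<le> card V"
    interpret book_free V H t by (rule bf)
    let ?c = "(t - 1) * gain t"
    have real: "real (card H) \<le> (real (card V))\<^sup>2 / 8 + ?c"
    proof (cases "(card V)\<^sup>2 / 8 \<le> card H")
      case False
      then have "real (card H) < (real (card V))\<^sup>2 / 8" by simp
      moreover have "0 \<le> real ?c" by (rule of_nat_0_le_iff)
      ultimately show ?thesis by linarith
    next
      case True
      obtain A B where AB: "A \<subseteq> V" "B \<subseteq> V" "A \<inter> B = {}"
        "(1 / 2 - \<zeta>) * card V \<le> card A" "(1 / 2 - \<zeta>) * card V \<le> card B"
        "\<forall>a\<in>A. (1 / 2 - \<zeta>) * card V \<le> card (N a \<inter> B)"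
        "\<forall>b\<in>B. (1 / 2 - \<zeta>) * card V \<le> card (N b \<inter> A)"
        using n1[rule_format, OF bf _ True] n by auto
      have eq: "(1 / 2 - \<zeta>) * card V = card V / 2 - \<zeta> * card V" by (simp add: algebra_simps)
      have "(6 * t + 10) / \<zeta> \<le> card V" using n n2 by linarith
      then have z: "6 * t + 10 \<le> \<zeta> * card V" using pos by (simp add: divide_le_eq mult.commute)
      have zh: "1000 * t * (\<zeta> * card V) \<le> \<theta> * card V" "1000 * t * (\<theta> * card V) \<le> card V"
        by (simp_all only: mult.assoc[symmetric] mul mult_1 order.refl)
      have "core_pair V H t A B (\<zeta> * card V) (\<theta> * card V)"
        by unfold_locales (use AB t2 z zh in \<open>auto simp: eq\<close>)
      then show ?thesis by (rule core_pair.card_H_bound)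
    qed
    then have "8 * real (card H) \<le> (real (card V))\<^sup>2 + 8 * real ?c" by simp
    then have "real (8 * card H) \<le> real ((card V)\<^sup>2 + 8 * ?c)" by simp
    then have "8 * card H \<le> (card V)\<^sup>2 + 8 * ?c" by (simp only: of_nat_le_iff)
    then show "card H \<le> (card V)\<^sup>2 div 8 + ?c" by linarith
  qed
qed

section \<open>The extremal construction\<close>

text \<open>The blocks are the pairs 2k, 2k + 1. The vertices below 2q form B, the other ones form A, and
  the s blocks following B are the special pairs of A.\<close>

locale extremal_construction =
  fixes q s n :: nat
  assumes sq: "s \<le> q" and n: "2 * q + 2 * s \<le> n"
begin

text \<open>The second part yields the s^2 extra triples. Only the even vertex of a special pair
  receives them, so that a page of the special pair itself has just one way to reach the odd
  vertex.\<close>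

definition I1 :: "(nat \<times> nat) set" where
  "I1 = {2 * (q + s)..<n} \<times> {..<q} \<union> (\<lambda>i. 2 * (q + i)) ` {..<s} \<times> {..<s}"

definition I2 :: "(nat \<times> nat) set" where
  "I2 = {..<s} \<times> {..<2 * q}"

definition e1 :: "nat \<times> nat \<Rightarrow> nat set" where
  "e1 = (\<lambda>(x, j). {x, 2 * j, 2 * j + 1})"

definition e2 :: "nat \<times> nat \<Rightarrow> nat set" where
  "e2 = (\<lambda>(i, b). {2 * (q + i), 2 * (q + i) + 1, b})"

definition H :: "nat set set" where
  "H = e1 ` I1 \<union> e2 ` I2"

lemma I1_D: "(x, j) \<in> I1 \<Longrightarrow> 2 * q \<le> x \<and> x < n \<and> j < q \<and> (2 * (q + s) \<le> x \<or> even x \<and> x < 2 * (q + s) \<and> j < s)"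
  using sq n by (auto simp: I1_def)

lemma H_cases:
  assumes "e \<in> H"
  obtains x j where "e = {x, 2 * j, 2 * j + 1}" "2 * q \<le> x" "x < n" "j < q"
      "2 * (q + s) \<le> x \<or> even x \<and> x < 2 * (q + s) \<and> j < s"
  | i b where "e = {2 * (q + i), 2 * (q + i) + 1, b}" "i < s" "b < 2 * q"
  using assms I1_D by (auto simp: H_def e1_def e2_def I2_def)

lemma upper_e1: "p \<in> I1 \<Longrightarrow> {y \<in> e1 p. 2 * q \<le> y} = {fst p}"
  using I1_D[of "fst p" "snd p"] by (cases p) (auto simp: e1_def)

lemma upper_e2: "p \<in> I2 \<Longrightarrow> {y \<in> e2 p. 2 * q \<le> y} = {2 * (q + fst p), 2 * (q + fst p) + 1}"
  by (cases p) (auto simp: e2_def I2_def)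

lemma lower_e1: "p \<in> I1 \<Longrightarrow> {y \<in> e1 p. y < 2 * q} = {2 * snd p, 2 * snd p + 1}"
  using I1_D[of "fst p" "snd p"] by (cases p) (auto simp: e1_def)

lemma lower_e2: "p \<in> I2 \<Longrightarrow> {y \<in> e2 p. y < 2 * q} = {snd p}"
  by (cases p) (auto simp: e2_def I2_def)

lemma double_pair_eq: "{2 * j, 2 * j + 1} = {2 * k, 2 * k + (1::nat)} \<longleftrightarrow> j = k"
  by (auto simp: doubleton_eq_iff)

lemma inj_e1: "inj_on e1 I1"
proof (rule inj_onI)
  fix p p' assume p: "p \<in> I1" "p' \<in> I1" "e1 p = e1 p'"
  have "{fst p} = {fst p'}" using upper_e1[OF p(1)] upper_e1[OF p(2)] p(3) by simp
  moreover have "{2 * snd p, 2 * snd p + 1} = {2 * snd p', 2 * snd p' + 1}"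
    using lower_e1[OF p(1)] lower_e1[OF p(2)] p(3) by simp
  ultimately show "p = p'" unfolding double_pair_eq by (simp add: prod_eq_iff)
qed

lemma inj_e2: "inj_on e2 I2"
proof (rule inj_onI)
  fix p p' assume p: "p \<in> I2" "p' \<in> I2" "e2 p = e2 p'"
  have "{snd p} = {snd p'}" using lower_e2[OF p(1)] lower_e2[OF p(2)] p(3) by simp
  moreover have "{2 * (q + fst p), 2 * (q + fst p) + 1} = {2 * (q + fst p'), 2 * (q + fst p') + 1}"
    using upper_e2[OF p(1)] upper_e2[OF p(2)] p(3) by simp
  ultimately show "p = p'" unfolding double_pair_eq by (simp add: prod_eq_iff)
qed

text \<open>Exchanging the triples at a special pair leaves their number unchanged: two vertices
  with q blocks each, against one pair with 2q vertices. Only the s^2 extra triples are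
  gained.\<close>

lemma card_H: "card H = (n - 2 * q) * q + s ^ 2"
proof -
  have "card I1 = (n - 2 * (q + s)) * q + s * s"
  proof -
    have "inj_on (\<lambda>i. 2 * (q + i)) {..<s}" by (auto simp: inj_on_def)
    then show ?thesis unfolding I1_def
      by (subst card_Un_disjoint) (auto simp: card_cartesian_product card_image)
  qed
  moreover have "card I2 = s * (2 * q)" by (simp add: I2_def card_cartesian_product)
  moreover have "card H = card I1 + card I2"
  proof -
    have "e1 ` I1 \<inter> e2 ` I2 = {}"
    proof (rule ccontr)
      assume "\<not> ?thesis"
      then obtain p p' where p: "p \<in> I1" "p' \<in> I2" "e1 p = e2 p'" by auto
      have "{fst p} = {y \<in> e1 p. 2 * q \<le> y}" by (rule upper_e1[OF p(1), symmetric])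
      also have "\<dots> = {y \<in> e2 p'. 2 * q \<le> y}" by (simp only: p(3))
      also have "\<dots> = {2 * (q + fst p'), 2 * (q + fst p') + 1}" by (rule upper_e2[OF p(2)])
      finally show False by auto
    qed
    moreover have "finite I1" "finite I2" by (simp_all add: I1_def I2_def)
    ultimately show ?thesis unfolding H_def
      by (simp add: card_Un_disjoint card_image inj_e1 inj_e2)
  qed
  moreover have "(n - 2 * (q + s)) * q + s * (2 * q) = (n - 2 * q) * q"
  proof -
    have "n - 2 * q = (n - 2 * (q + s)) + 2 * s" using n by simp
    then show ?thesis by (simp add: algebra_simps)
  qed
  ultimately show ?thesis by (simp add: power2_eq_square)
qed

lemma H_edge:
  assumes "e \<in> H" shows "e \<subseteq> {..<n} \<and> card e = 3"
  using assms by (cases rule: H_cases) (use n in \<open>auto simp: card_insert_if\<close>)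

lemma low_pair:
  assumes "e \<in> H" "x \<in> e" "y \<in> e" "x \<noteq> y" "x < 2 * q" "y < 2 * q"
  shows "x div 2 = y div 2"
  using assms(1) by (cases rule: H_cases) (use assms in auto)

lemma high_pair:
  assumes "e \<in> H" "x \<in> e" "y \<in> e" "x \<noteq> y" "2 * q \<le> x" "2 * q \<le> y"
  shows "x div 2 = y div 2 \<and> x < 2 * (q + s) \<and> y < 2 * (q + s)"
  using assms(1) by (cases rule: H_cases) (use assms in auto)

lemma cross_pair:
  assumes "e \<in> H" "x \<in> e" "y \<in> e" "2 * q \<le> x" "y < 2 * q"
  obtains "e = {x, 2 * (y div 2), 2 * (y div 2) + 1}" "2 * (q + s) \<le> x \<or> even x \<and> y div 2 < s"
  | "e = {2 * (x div 2), 2 * (x div 2) + 1, y}" "x < 2 * (q + s)"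
  using assms(1)
proof (cases rule: H_cases)
  case (1 x' j)
  then have "x' = x" "y div 2 = j" using assms by auto
  then show ?thesis using that(1) 1 by auto
next
  case (2 i b)
  then have "b = y" "x div 2 = q + i" using assms by auto
  then show ?thesis using that(2) 2 assms by auto
qed

lemma div2_eq: "x div 2 = y div 2 \<Longrightarrow> x \<noteq> y \<Longrightarrow> even x \<Longrightarrow> y = x + (1::nat)"
  by presburger

text \<open>Pages must lie in \<open>A\<close>. A vertex outside the special pairs is joined to both
  ends of the block by the same triple, so it is no page. Inside a special pair only three triples
  are available, while two pages would need four; this leaves at most \<open>s\<close>
  pages.\<close>

lemma no_book_low:
  assumes st: "s < t" and b: "even b" "b + 1 < 2 * q"
  shows "\<not> book_in H t b (b + 1)"
proof
  assume "book_in H t b (b + 1)"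
  then obtain W g h where W: "finite W" "card W = t" "b \<notin> W" "b + 1 \<notin> W"
    and inj: "inj_on g W" "inj_on h W" "g ` W \<inter> h ` W = {}"
    and gh: "\<And>w. w \<in> W \<Longrightarrow> g w \<in> H \<and> b \<in> g w \<and> w \<in> g w \<and> h w \<in> H \<and> b + 1 \<in> h w \<and> w \<in> h w"
    unfolding book_in_def by metis
  have bd: "2 * (b div 2) = b" "2 * ((b + 1) div 2) = b" using b by auto
  \<comment> \<open>The triples of \<open>H\<close> that join the block of \<open>b\<close> to the
    k-th block, when that block is a special pair.\<close>
  let ?C = "\<lambda>k. {{2 * k, 2 * k + 1, b}, {2 * k, 2 * k + 1, b + 1}, {2 * k, b, b + 1}}"
  have gne: "g w \<noteq> h w'" if "w \<in> W" "w' \<in> W" for w w' using inj(3) that by blast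
  have high: "2 * q \<le> w" if w: "w \<in> W" for w
  proof (rule ccontr)
    assume "\<not> ?thesis"
    then have "b div 2 = w div 2" using low_pair[of "g w" b w] gh[OF w] b W(3) w by auto
    then have "w = b + 1" using div2_eq[of b w] b W(3) w by auto
    then show False using w W(4) by simp
  qed
  have C: "w < 2 * (q + s) \<and> g w \<in> ?C (w div 2) \<and> h w \<in> ?C (w div 2)" if w: "w \<in> W" for w
  proof -
    have b2: "b < 2 * q" using b by simp
    have g: "g w = {w, b, b + 1} \<and> (2 * (q + s) \<le> w \<or> even w) \<or> g w = {2 * (w div 2), 2 * (w div 2) + 1, b} \<and> w < 2 * (q + s)"
      using cross_pair[of "g w" w b] gh[OF w] high[OF w] b2 bd by metis
    have h: "h w = {w, b, b + 1} \<and> (2 * (q + s) \<le> w \<or> even w) \<or> h w = {2 * (w div 2), 2 * (w div 2) + 1, b + 1} \<and> w < 2 * (q + s)"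
      using cross_pair[of "h w" w "b + 1"] gh[OF w] high[OF w] b(2) bd by metis
    have lt: "w < 2 * (q + s)" using g h gne[OF w w] by auto
    then have "g w = {2 * (w div 2), b, b + 1} \<or> g w = {2 * (w div 2), 2 * (w div 2) + 1, b}"
      "h w = {2 * (w div 2), b, b + 1} \<or> h w = {2 * (w div 2), 2 * (w div 2) + 1, b + 1}"
      using g h lt dvd_mult_div_cancel[of 2 w] by (metis not_less)+
    then show ?thesis using lt by auto
  qed
  have "inj_on (\<lambda>w. w div 2) W"
  proof (rule inj_onI, rule ccontr)
    fix w w' assume w: "w \<in> W" "w' \<in> W" "w div 2 = w' div 2" "w \<noteq> w'"
    have "g w \<noteq> g w'" "h w \<noteq> h w'" using inj w by (meson inj_on_eq_iff)+
    then have "card {g w, g w', h w, h w'} = 4" using gne w by auto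
    moreover have "{g w, g w', h w, h w'} \<subseteq> ?C (w div 2)" using C[OF w(1)] C[OF w(2)] w(3) by auto
    then have "card {g w, g w', h w, h w'} \<le> card (?C (w div 2))" by (intro card_mono) auto
    moreover have "card (?C (w div 2)) \<le> 3" by (simp add: card_insert_if)
    ultimately show False by simp
  qed
  then have "card W = card ((\<lambda>w. w div 2) ` W)" by (simp add: card_image)
  also have "\<dots> \<le> card {q..<q + s}"
  proof (rule card_mono)
    show "(\<lambda>w. w div 2) ` W \<subseteq> {q..<q + s}"
    proof (rule image_subsetI)
      fix w assume "w \<in> W"
      then have "2 * q \<le> w" "w < 2 * (q + s)" using high C by auto
      then show "w div 2 \<in> {q..<q + s}" by auto
    qed
  qed simp
  finally show False using st W by simp
qed

text \<open>Pages lie in \<open>B\<close>. The odd end \<open>a + 1\<close> reaches \<open>w\<close>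
  only through \<open>{a, a + 1, w}\<close>, so \<open>a\<close> must use an extra triple, and this
  triple is the same for both vertices of a block. There are \<open>s\<close> such blocks.\<close>

lemma no_book_high:
  assumes st: "s < t" and a: "even a" "2 * q \<le> a" "a + 1 < 2 * (q + s)"
  shows "\<not> book_in H t a (a + 1)"
proof
  assume "book_in H t a (a + 1)"
  then obtain W g h where W: "finite W" "card W = t" "a \<notin> W" "a + 1 \<notin> W"
    and inj: "inj_on g W" "inj_on h W" "g ` W \<inter> h ` W = {}"
    and gh: "\<And>w. w \<in> W \<Longrightarrow> g w \<in> H \<and> a \<in> g w \<and> w \<in> g w \<and> h w \<in> H \<and> a + 1 \<in> h w \<and> w \<in> h w"
    unfolding book_in_def by metis
  have ad: "2 * (a div 2) = a" "2 * ((a + 1) div 2) = a" "odd (a + 1)" using a by auto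
  have gne: "g w \<noteq> h w'" if "w \<in> W" "w' \<in> W" for w w' using inj(3) that by blast
  have low: "w < 2 * q" if w: "w \<in> W" for w
  proof (rule ccontr)
    assume "\<not> ?thesis"
    then have "a div 2 = w div 2" using high_pair[of "g w" a w] gh[OF w] a W(3) w by auto
    then have "w = a + 1" using div2_eq[of a w] a W(3) w by auto
    then show False using w W(4) by simp
  qed
  have g: "g w = {a, 2 * (w div 2), 2 * (w div 2) + 1} \<and> w div 2 < s" if w: "w \<in> W" for w
  proof -
    have "h w = {a, a + 1, w}"
      using cross_pair[of "h w" "a + 1" w] gh[OF w] low[OF w] a ad by (metis not_less trans_le_add1)
    moreover have "g w = {a, 2 * (w div 2), 2 * (w div 2) + 1} \<and> (2 * (q + s) \<le> a \<or> w div 2 < s) \<or> g w = {a, a + 1, w}"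
      using cross_pair[of "g w" a w] gh[OF w] low[OF w] a ad by metis
    ultimately show ?thesis using gne[OF w w] a by auto
  qed
  have "inj_on (\<lambda>w. w div 2) W"
  proof (rule inj_onI)
    fix w w' assume w: "w \<in> W" "w' \<in> W" "w div 2 = w' div 2"
    then have "g w = g w'" using g by simp
    then show "w = w'" using inj w by (meson inj_on_eq_iff)
  qed
  then have "card W = card ((\<lambda>w. w div 2) ` W)" by (simp add: card_image)
  also have "\<dots> \<le> card {..<s}" using g by (intro card_mono) auto
  finally show False using st W by simp
qed

text \<open>A page shares its side with \<open>u\<close> or with \<open>v\<close>, hence is the
  block partner of that vertex, and \<open>u\<close> has a shadow neighbour on its side only in a
  special pair. This gives two pages at most, which for t = 2 are excluded by taking s = 0.\<close>

lemma no_book_cross: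
  assumes t: "2 \<le> t" "s = 0 \<or> 3 \<le> t" and uv: "2 * q \<le> u" "v < 2 * q"
  shows "\<not> book_in H t u v"
proof
  assume "book_in H t u v"
  then obtain W g h where W: "finite W" "card W = t" "u \<notin> W" "v \<notin> W"
    and gh: "\<And>w. w \<in> W \<Longrightarrow> g w \<in> H \<and> u \<in> g w \<and> w \<in> g w \<and> h w \<in> H \<and> v \<in> h w \<and> w \<in> h w"
    unfolding book_in_def by metis
  \<comment> \<open>The other vertex of the block of \<open>x\<close>.\<close>
  define p where "p x = (if even x then x + 1 else x - 1)" for x :: nat
  have p: "y = p x" if "x div 2 = y div 2" "x \<noteq> y" for x y
    using that unfolding p_def by presburger
  have "w = p v \<or> 0 < s \<and> w = p u" if w: "w \<in> W" for w
  proof (cases "w < 2 * q")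
    case True
    then have "v div 2 = w div 2" using low_pair[of "h w" v w] gh[OF w] uv W w by auto
    then show ?thesis using p[of v w] w W by auto
  next
    case False
    then have "u div 2 = w div 2 \<and> w < 2 * (q + s)" using high_pair[of "g w" u w] gh[OF w] uv W w by auto
    then show ?thesis using p[of u w] w W False by auto
  qed
  then have sub: "W \<subseteq> {p v} \<union> (if 0 < s then {p u} else {})" by auto
  then have "card W \<le> card ({p v} \<union> (if 0 < s then {p u} else {}))" by (intro card_mono) auto
  also have "\<dots> \<le> (if 0 < s then 2 else 1)" by (simp add: card_insert_if)
  finally show False using t W by (auto split: if_splits)
qed

lemma no_book:
  assumes t: "2 \<le> t" "s = 0 \<or> 3 \<le> t" "s < t"
  shows "\<not> book_in H t u v"
proof
  assume b: "book_in H t u v"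
  then obtain e where e: "e \<in> H" "u \<in> e" "v \<in> e" and ne: "u \<noteq> v" unfolding book_in_def by metis
  have ev: "even u \<or> even v" if "u div 2 = v div 2" using that ne by presburger
  consider "u < 2 * q" "v < 2 * q" | "2 * q \<le> u" "2 * q \<le> v" | "2 * q \<le> u" "v < 2 * q" | "u < 2 * q" "2 * q \<le> v"
    by linarith
  then show False
  proof cases
    case 1
    have d: "u div 2 = v div 2" by (rule low_pair[OF e ne 1])
    show False using ev[OF d] no_book_low[OF t(3)] b book_in_sym[OF b] div2_eq[of u v] div2_eq[of v u] d ne 1
      by metis
  next
    case 2
    have d: "u div 2 = v div 2" "u < 2 * (q + s)" "v < 2 * (q + s)" using high_pair[OF e ne 2] by auto
    show False using ev[OF d(1)] no_book_high[OF t(3)] b book_in_sym[OF b] div2_eq[of u v] div2_eq[of v u] d ne 2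
      by metis
  next
    case 3
    then show False using no_book_cross[OF t(1,2)] b by blast
  next
    case 4
    then show False using no_book_cross[OF t(1,2)] book_in_sym[OF b] by blast
  qed
qed

end

text \<open>With q = \<open>(n + 1) div 4\<close> the even part 2q is as close to n/2 as parity
  allows, and (n - 2q)q differs from n^2/8 by less than 1.\<close>

lemma balanced_product: "(n - 2 * ((n + 1) div 4)) * ((n + 1) div 4) = n\<^sup>2 div (8::nat)"
proof -
  define k where "k = n div 4"
  have "n = 4 * k \<or> n = 4 * k + 1 \<or> n = 4 * k + 2 \<or> n = 4 * k + 3" unfolding k_def by presburger
  then show ?thesis
  proof (elim disjE)
    assume n: "n = 4 * k"
    have "(n + 1) div 4 = k" using n by presburger
    then show ?thesis by (simp add: n power2_eq_square)
  next
    assume n: "n = 4 * k + 1"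
    have "n\<^sup>2 = 8 * ((2 * k + 1) * k) + 1" by (simp add: n power2_eq_square algebra_simps)
    then have "n\<^sup>2 div 8 = (2 * k + 1) * k" by simp
    moreover have "(n + 1) div 4 = k" using n by presburger
    ultimately show ?thesis by (simp add: n)
  next
    assume n: "n = 4 * k + 2"
    have "n\<^sup>2 = 8 * ((2 * k + 2) * k) + 4" by (simp add: n power2_eq_square algebra_simps)
    then have "n\<^sup>2 div 8 = (2 * k + 2) * k" by simp
    moreover have "(n + 1) div 4 = k" using n by presburger
    ultimately show ?thesis by (simp add: n)
  next
    assume n: "n = 4 * k + 3"
    have "n\<^sup>2 = 8 * ((2 * k + 1) * (k + 1)) + 1" by (simp add: n power2_eq_square algebra_simps)
    then have "n\<^sup>2 div 8 = (2 * k + 1) * (k + 1)" by simp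
    moreover have "(n + 1) div 4 = k + 1" by (simp add: n)
    ultimately show ?thesis by (simp add: n)
  qed
qed

section \<open>The Turan numbers of Berge books\<close>

lemma ex_berge_book:
  assumes t: "2 \<le> t"
  shows "\<exists>n0. \<forall>n\<ge>n0. ex_berge 3 n (book_V t) (book_E t) = n\<^sup>2 div 8 + (t - 1) * gain t"
proof -
  obtain n1 where n1: "\<forall>(V::nat set) H. book_free V H t \<longrightarrow> n1 \<le> card V \<longrightarrow>
      card H \<le> (card V)\<^sup>2 div 8 + (t - 1) * gain t"
    using upper_bound[OF t] by (elim exE)
  show ?thesis
  proof (intro exI[of _ "max n1 (8 * t)"] allI impI)
    fix n assume large: "max n1 (8 * t) \<le> n"
    define q where "q = (n + 1) div 4"
    \<comment> \<open>For t = 2 a special pair would create a second page for a core between the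
      sides. In all cases \<open>s ^ 2\<close> equals \<open>(t - 1) * gain t\<close>.\<close>
    define s where "s = (if t = 2 then 0 else t - 1)"
    interpret extremal_construction q s n
      by unfold_locales (use large in \<open>auto simp: q_def s_def\<close>)
    let ?M = "{card H | H. H \<subseteq> {e. e \<subseteq> {..<n} \<and> card e = 3} \<and> \<not> berge_contains (book_V t) (book_E t) {..<n} H}"
    have "\<not> berge_contains (book_V t) (book_E t) {..<n} H"
      using berge_contains_bookD no_book[of t] t by (fastforce simp: s_def split: if_splits)
    then have "card H \<in> ?M" using H_edge by blast
    moreover have "card H = n\<^sup>2 div 8 + (t - 1) * gain t"
    proof -
      have "(n - 2 * q) * q = n\<^sup>2 div 8" unfolding q_def by (rule balanced_product)
      moreover have "s\<^sup>2 = (t - 1) * gain t" by (simp add: s_def gain_def power2_eq_square)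
      ultimately show ?thesis by (simp only: card_H)
    qed
    moreover have "m \<le> n\<^sup>2 div 8 + (t - 1) * gain t" if m: "m \<in> ?M" for m
    proof -
      obtain K where K: "m = card K" "K \<subseteq> {e. e \<subseteq> {..<n} \<and> card e = 3}"
        "\<not> berge_contains (book_V t) (book_E t) {..<n} K" using m by blast
      have sub: "e \<subseteq> {..<n}" "card e = 3" if "e \<in> K" for e using that K(2) by auto
      have "book_free {..<n} K t"
      proof
        show "\<not> book_in K t u v" for u v
          using K(3) berge_contains_bookI[of K t u v "{..<n}"] sub by blast
      qed (use sub in auto)
      then show ?thesis using n1[rule_format, of "{..<n}" K] large K(1) by simp
    qed
    moreover have "finite ?M"
    proof (rule finite_subset)
      show "?M \<subseteq> card ` Pow {e. e \<subseteq> {..<n} \<and> card e = 3}" by blast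
      show "finite (card ` Pow {e. e \<subseteq> {..<n} \<and> card e = 3})"
        by (intro finite_imageI) (simp add: finite_subset[of _ "Pow {..<n}"] Collect_mono_iff subset_iff)
    qed
    ultimately show "ex_berge 3 n (book_V t) (book_E t) = n\<^sup>2 div 8 + (t - 1) * gain t"
      unfolding ex_berge_def by (intro Max_eqI) auto
  qed
qed

theorem theorem3:
  shows "(\<exists>n0. \<forall>n\<ge>n0. ex_berge 3 n (book_V 2) (book_E 2) = n ^ 2 div 8) \<and>
         (\<forall>t::nat. t \<ge> 3 \<longrightarrow> (\<exists>n0. \<forall>n\<ge>n0.
             ex_berge 3 n (book_V t) (book_E t) = n ^ 2 div 8 + (t - 1) ^ 2))"
proof (intro conjI allI impI)
  show "\<exists>n0. \<forall>n\<ge>n0. ex_berge 3 n (book_V 2) (book_E 2) = n ^ 2 div 8"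
    using ex_berge_book[of 2] by (simp add: gain_def)
next
  fix t :: nat assume "3 \<le> t"
  then show "\<exists>n0. \<forall>n\<ge>n0. ex_berge 3 n (book_V t) (book_E t) = n ^ 2 div 8 + (t - 1) ^ 2"
    using ex_berge_book[of t] by (simp add: gain_def power2_eq_square)
qed

end
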